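(* Let $(R,\mathfrak m,k)$ be a regular Noetherian local ring of dimension $2$, let $\mathcal V$ be the partially ordered set of normalized proper valuations centered at $R$, and let $\tilde\nu_{\mathfrak m}\in\mathcal V$ be the multiplicity valuation, $\tilde\nu_{\mathfrak m}(f)=\max\{i\mid f\in\mathfrak m^i\}$ for $f\in R\setminus\{0\}$. Then $\mathcal V$ is a complete (rooted) nonmetric tree rooted at $\tilde\nu_{\mathfrak m}$.
   Context: A valuation centered at $R$ is a function $\nu:R\to[0,\infty]=\mathbb R_{\ge0}\cup\{\infty\}$ such that $\nu(f+g)\ge\min(\nu(f),\nu(g))$ and $\nu(fg)=\nu(f)+\nu(g)$ for all $f,g\in R$, $\nu(0)=\infty$, $\nu(1)=0$, and $\nu(f)>0$ for all $f\in\mathfrak m$. Nonzero elements are allowed to have value $\infty$. The valuation is proper if $\nu$ is not identically $0$ on $R\setminus\{0\}$ and $\nu(\mathfrak m)\neq\{\infty\}$. It is normalized if $\inf\{\nu(f)\mid f\in\mathfrak m\}=1$. $\mathcal V$ denotes the set of normalized proper valuations centered at $R$ (each class of proper valuations modulo multiplication by positive real constants has exactly one normalized representative), partially ordered by: $\mu\le\nu$ if and only if $\mu(f)\le\nu(f)$ for all $f\in R$. A rooted nonmetric tree is a poset $(\mathcal T,\le)$ such that: (T1) every set of the form $I_\tau=\{\sigma\in\mathcal T\mid\sigma\le\tau\}$ is isomorphic, as an ordered set, to a real interval; (T2) every totally ordered convex subset of $\mathcal T$ is isomorphic to a real interval; (T3) every non-empty subset of $\mathcal T$ has an infimum in $\mathcal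 T$. (A subset $S$ is convex if $\sigma\le\tau\le\sigma'$ with $\sigma,\sigma'\in S$ implies $\tau\in S$.) The root is the smallest element of $\mathcal T$. The tree is complete if every increasing sequence $\{\tau_i\}_{i\ge1}$ in $\mathcal T$ has a majorant, i.e. an element $\tau_\infty\in\mathcal T$ with $\tau_i\le\tau_\infty$ for every $i$. *)

theory Defs
  imports "HOL-Analysis.Analysis" "HOL-Algebra.Algebra"
begin

section \<open>Regular local rings\<close>

text \<open>
  Supremum of the lengths \<open>n\<close> of chains \<open>P\<^sub>0 \<subset> \<dots> \<subset> P\<^sub>n\<close> of prime ideals;
  such a chain is a list with \<open>n + 1\<close> entries.
\<close>
definition krull_dim :: "('a, 'b) ring_scheme \<Rightarrow> enat" where
  "krull_dim R =
     (SUP Ps \<in> {Ps. Ps \<noteq> [] \<and> (\<forall>P \<in> set Ps. primeideal P R) \<and> sorted_wrt (\<subset>) Ps}.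
        enat (length Ps - 1))"

locale noetherian_local_ring = cring R + noetherian_ring R for R (structure) and \<mm> +
  assumes unique_maximalideal: "{I. maximalideal I R} = {\<mm>}"

text \<open>Regularity: the maximal ideal can be generated by \<open>dim R\<close> elements.\<close>
locale regular_local_ring = noetherian_local_ring +
  assumes regular:
    "\<exists>S \<subseteq> carrier R. finite S \<and> enat (card S) = krull_dim R \<and> \<mm> = Idl S"


section \<open>Valuations centered at a local ring\<close>

text \<open>
  Functions on \<open>R\<close> are represented by their extensional extensions, so that two valuations
  that agree on \<open>carrier R\<close> are equal.
\<close>
locale centered_valuation =
  fixes R :: "('a, 'b) ring_scheme" (structure)
    and \<mm> :: "'a set"
    and \<nu> :: "'a \<Rightarrow> ennreal"
  assumes val_extensional: "\<nu> \<in> extensional (carrier R)"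
    and val_add: "\<lbrakk>f \<in> carrier R; g \<in> carrier R\<rbrakk> \<Longrightarrow> \<nu> (f \<oplus> g) \<ge> min (\<nu> f) (\<nu> g)"
    and val_mult: "\<lbrakk>f \<in> carrier R; g \<in> carrier R\<rbrakk> \<Longrightarrow> \<nu> (f \<otimes> g) = \<nu> f + \<nu> g"
    and val_zero: "\<nu> \<zero> = \<infinity>"
    and val_one: "\<nu> \<one> = 0"
    and val_pos: "f \<in> \<mm> \<Longrightarrow> \<nu> f > 0"

definition proper_valuation :: "('a, 'b) ring_scheme \<Rightarrow> 'a set \<Rightarrow> ('a \<Rightarrow> ennreal) \<Rightarrow> bool" where
  "proper_valuation R \<mm> \<nu> \<longleftrightarrow>
     \<not> (\<forall>f \<in> carrier R - {\<zero>\<^bsub>R\<^esub>}. \<nu> f = 0) \<and> \<nu> ` \<mm> \<noteq> {\<infinity>}"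

definition normalized_valuation :: "'a set \<Rightarrow> ('a \<Rightarrow> ennreal) \<Rightarrow> bool" where
  "normalized_valuation \<mm> \<nu> \<longleftrightarrow> (INF f \<in> \<mm>. \<nu> f) = 1"

definition valuation_poset ::
    "('a, 'b) ring_scheme \<Rightarrow> 'a set \<Rightarrow> ('a \<Rightarrow> ennreal) gorder" where
  "valuation_poset R \<mm> =
     \<lparr>carrier = {\<nu>. centered_valuation R \<mm> \<nu> \<and> proper_valuation R \<mm> \<nu> \<and> normalized_valuation \<mm> \<nu>},
      eq = (=),
      le = (\<lambda>\<mu> \<nu>. \<forall>f \<in> carrier R. \<mu> f \<le> \<nu> f)\<rparr>"

text \<open>
  The power \<open>\<mm>\<^sup>i\<close> is taken in the monoid of ideals of \<open>R\<close>, whose unit is \<open>R\<close> itself. For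
  \<open>f \<noteq> \<zero>\<close> in a Noetherian local ring the set of exponents is finite by Krull's intersection
  theorem.
\<close>
definition multiplicity_valuation ::
    "('a, 'b) ring_scheme \<Rightarrow> 'a set \<Rightarrow> 'a \<Rightarrow> ennreal" where
  "multiplicity_valuation R \<mm> =
     (\<lambda>f \<in> carrier R.
        if f = \<zero>\<^bsub>R\<^esub> then \<infinity> else of_nat (Max {i :: nat. f \<in> \<mm> [^]\<^bsub>ideals_set R\<^esub> i}))"


section \<open>Rooted nonmetric trees\<close>

definition iso_real_interval :: "'a gorder \<Rightarrow> 'a set \<Rightarrow> bool" where
  "iso_real_interval T S \<longleftrightarrow>
     (\<exists>(J :: real set) f. is_interval J \<and> bij_betw f S J \<and>
        order_emb (T\<lparr>carrier := S\<rparr>) \<lparr>carrier = J, eq = (=), le = (\<le>)\<rparr> f)"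

text \<open>
  Note that the empty set counts as a real interval, and hence so does the empty convex subset
  in \<open>T2\<close>.
\<close>
locale rooted_nonmetric_tree = partial_order T for T :: "'a gorder" (structure) +
  assumes T1: "\<tau> \<in> carrier T \<Longrightarrow> iso_real_interval T {\<sigma> \<in> carrier T. \<sigma> \<sqsubseteq> \<tau>}"
    and T2: "\<lbrakk>S \<subseteq> carrier T;
              \<forall>\<sigma> \<in> S. \<forall>\<tau> \<in> S. \<sigma> \<sqsubseteq> \<tau> \<or> \<tau> \<sqsubseteq> \<sigma>;
              \<forall>\<sigma> \<in> S. \<forall>\<sigma>' \<in> S. \<forall>\<tau> \<in> carrier T. \<sigma> \<sqsubseteq> \<tau> \<and> \<tau> \<sqsubseteq> \<sigma>' \<longrightarrow> \<tau> \<in> S\<rbrakk>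
             \<Longrightarrow> iso_real_interval T S"
    and T3: "\<lbrakk>S \<subseteq> carrier T; S \<noteq> {}\<rbrakk> \<Longrightarrow> \<exists>\<sigma>. greatest T \<sigma> (Lower T S)"

definition tree_root :: "'a gorder \<Rightarrow> 'a \<Rightarrow> bool" where
  "tree_root T \<rho> \<longleftrightarrow> least T \<rho> (carrier T)"

locale complete_rooted_nonmetric_tree = rooted_nonmetric_tree +
  assumes increasing_seq_majorant:
    "\<lbrakk>\<And>i :: nat. \<tau> i \<in> carrier T; \<And>i. \<tau> i \<sqsubseteq> \<tau> (Suc i)\<rbrakk>
       \<Longrightarrow> \<exists>\<upsilon> \<in> carrier T. \<forall>i. \<tau> i \<sqsubseteq> \<upsilon>"

end

theory Submission
  imports Defs
begin

text \<open>
  Let \<open>\<mm> = (x, y)\<close>. A normalized valuation takes the value 1 at \<open>x\<close> or at \<open>y\<close>, say at \<open>x\<close>. The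
  value in the discrete valuation ring \<open>R / (x)\<close> serves as a degree on \<open>R\<close>: elements of \<open>R\<close> can be
  divided by an element \<open>\<phi>\<close> of degree \<open>d\<close>, with remainders that are powers of \<open>x\<close> times elements of
  degree less than \<open>d\<close> (up to Krull's intersection theorem this is Weierstrass division, but no
  completion is needed). If \<open>\<rho> < \<tau>\<close> and \<open>\<phi>\<close> has minimal degree \<open>d\<close> with \<open>\<rho> \<phi> < \<tau> \<phi>\<close>, then \<open>\<rho>\<close> is
  determined by \<open>\<rho> \<phi>\<close> and by \<open>\<tau>\<close> in degrees below \<open>d\<close>, as for MacLane's key polynomials. Hence the
  valuations below \<open>\<tau>\<close> form a chain, on which \<open>\<rho> \<mapsto> sup \<rho> \<psi> / deg \<psi>\<close> is strictly increasing with
  value \<open>\<rho> \<phi> / d\<close>. This function takes all intermediate values: pointwise suprema of chains are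
  valuations, and \<open>\<rho>\<close> can be augmented by prescribing any larger value \<open>s < \<tau> \<phi>\<close> at \<open>\<phi>\<close>. Infima in
  the tree are suprema of the chains of lower bounds.
\<close>

section \<open>Noetherian local rings\<close>

text \<open>Remainders of division by \<open>\<phi>\<close> are neither unique nor closed under
  addition. What compensates is the larger valuation: \<open>\<tau>\<close> exceeds
  \<open>\<rho>\<close> at \<open>\<phi>\<close> and agrees with it on remainders, which rules out
  cancellation between \<open>q \<otimes> \<phi>\<close> and a remainder \<open>c\<close>. The same
  comparison shows that two divisions of one element have remainders of equal value, and that the
  value of a product of remainders survives in the remainder of the product; multiplicativity of the
  augmented function rests on this. Division may also go on forever, so repeated division only
  yields estimates truncated at \<open>n\<close> times a positive value, and \<open>n\<close> then
  grows. Since values may be infinite, finiteness is secured before a cancellation.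

  The condition \<open>\<nu> x = 1\<close> lets powers of \<open>x\<close> cancel when valuations
  are compared, leaving elements that have a degree. It describes only part of the tree. The part
  with \<open>\<nu> y = 1\<close> is handled by symmetry, and both parts are closed downwards, which
  suffices because each axiom concerns a chain or elements below one point.\<close>

lemma (in noetherian_ring) maximal_ideal_in_family:
  assumes "\<A> \<subseteq> {I. ideal I R}" "I0 \<in> \<A>"
  obtains M where "M \<in> \<A>" "I0 \<subseteq> M" "\<And>J. J \<in> \<A> \<Longrightarrow> M \<subseteq> J \<Longrightarrow> J = M"
proof -
  define T where "T = {J \<in> \<A>. I0 \<subseteq> J}"
  have "\<exists>M\<in>T. \<forall>J\<in>T. M \<subseteq> J \<longrightarrow> J = M"
  proof (rule subset_Zorn)
    fix C assume C: "subset.chain T C"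
    show "\<exists>U\<in>T. \<forall>J\<in>C. J \<subseteq> U"
    proof (cases "C = {}")
      case True
      with assms show ?thesis unfolding T_def by auto
    next
      case False
      have "subset.chain {I. ideal I R} C"
        using C assms(1) unfolding T_def pred_on.chain_def by auto
      \<comment> \<open>The Noetherian condition: a nonempty chain of ideals has a largest member,
        so the bound required by Zorn's lemma stays in the family, whatever the family is.\<close>
      then have "\<Union>C \<in> C" by (rule ideal_chain_is_trivial[OF False])
      then have "\<Union>C \<in> T" using C unfolding pred_on.chain_def by (meson subsetD)
      then show ?thesis by (intro bexI[of _ "\<Union>C"]) auto
    qed
  qed
  then obtain M where "M \<in> T" "\<forall>J\<in>T. M \<subseteq> J \<longrightarrow> J = M" by blast
  then show ?thesis by (intro that[of M]) (auto simp: T_def)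
qed

lemma (in noetherian_ring) ascending_ideals_stabilise:
  assumes "\<And>n. ideal (C n) R" "\<And>n. C n \<subseteq> C (Suc n)"
  obtains k :: nat where "C (Suc k) = C k"
proof -
  obtain M where M: "M \<in> range C" "\<And>J. J \<in> range C \<Longrightarrow> M \<subseteq> J \<Longrightarrow> J = M"
  proof (rule maximal_ideal_in_family)
    show "range C \<subseteq> {I. ideal I R}" using assms(1) by auto
    show "C 0 \<in> range C" by simp
  qed blast
  then obtain k where "M = C k" by auto
  then show ?thesis using that[of k] M(2)[of "C (Suc k)"] assms(2) by auto
qed

section \<open>Adjoining an element to an ideal; saturations and colon ideals\<close>

context cring
begin

lemma diff_add_cancel: "\<lbrakk>a \<in> carrier R; b \<in> carrier R\<rbrakk> \<Longrightarrow> (a \<ominus> b) \<oplus> b = a"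
  by (simp add: a_minus_def a_assoc l_neg)

lemma add_diff_cancel_left: "\<lbrakk>a \<in> carrier R; b \<in> carrier R\<rbrakk> \<Longrightarrow> (a \<oplus> b) \<ominus> a = b"
  by (metis a_comm a_minus_def add.inv_closed a_assoc r_neg r_zero)

lemma add_diff_cancel_right: "\<lbrakk>a \<in> carrier R; b \<in> carrier R\<rbrakk> \<Longrightarrow> (a \<oplus> b) \<ominus> b = a"
  by (simp add: a_minus_def a_assoc r_neg)

lemma r_diff_distr:
  "\<lbrakk>a \<in> carrier R; b \<in> carrier R; c \<in> carrier R\<rbrakk> \<Longrightarrow> a \<otimes> (b \<ominus> c) = a \<otimes> b \<ominus> a \<otimes> c"
  by (simp add: a_minus_def r_distr r_minus)

definition adjoin :: "'a set \<Rightarrow> 'a \<Rightarrow> 'a set"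
  where "adjoin I a = {i \<oplus> a \<otimes> r | i r. i \<in> I \<and> r \<in> carrier R}"

lemma mem_adjoin_iff:
  "f \<in> adjoin I a \<longleftrightarrow> (\<exists>i\<in>I. \<exists>r\<in>carrier R. f = i \<oplus> a \<otimes> r)"
  unfolding adjoin_def by auto

lemma adjoin_ideal:
  assumes "ideal I R" "a \<in> carrier R"
  shows "ideal (adjoin I a) R"
proof -
  have "adjoin I a = I <+>\<^bsub>R\<^esub> PIdl a"
  proof (rule Set.set_eqI)
    fix f
    have "f \<in> I <+>\<^bsub>R\<^esub> PIdl a \<longleftrightarrow> (\<exists>i\<in>I. \<exists>r\<in>carrier R. f = i \<oplus> r \<otimes> a)"
      unfolding set_add_def' cgenideal_def by auto
    also have "\<dots> \<longleftrightarrow> (\<exists>i\<in>I. \<exists>r\<in>carrier R. f = i \<oplus> a \<otimes> r)"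
      using assms(2) by (intro bex_cong refl) (simp add: m_comm)
    finally show "f \<in> adjoin I a \<longleftrightarrow> f \<in> I <+>\<^bsub>R\<^esub> PIdl a" unfolding mem_adjoin_iff by simp
  qed
  then show ?thesis using assms add_ideals cgenideal_ideal by simp
qed

lemma subset_adjoin:
  assumes "ideal I R" "a \<in> carrier R"
  shows "I \<subseteq> adjoin I a"
proof
  fix i assume i: "i \<in> I"
  then have "i = i \<oplus> a \<otimes> \<zero>" using assms ideal.Icarr by fastforce
  then show "i \<in> adjoin I a" using i assms mem_adjoin_iff by blast
qed

lemma mult_mem_adjoin:
  assumes "ideal I R" "a \<in> carrier R" "r \<in> carrier R"
  shows "a \<otimes> r \<in> adjoin I a"
proof -
  have "a \<otimes> r = \<zero> \<oplus> a \<otimes> r" using assms by simp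
  moreover have "\<zero> \<in> I" using assms(1) by (simp add: additive_subgroup.zero_closed ideal.axioms(1))
  ultimately show ?thesis using assms mem_adjoin_iff by blast
qed

lemma mem_PIdl_iff:
  assumes "a \<in> carrier R"
  shows "f \<in> PIdl a \<longleftrightarrow> (\<exists>r\<in>carrier R. f = a \<otimes> r)"
  unfolding cgenideal_def using assms m_comm by auto

text \<open>This set is the contraction of the extension of \<open>Q\<close> to the localization at
  the powers of \<open>x\<close>, described without forming the localization.\<close>

lemma saturation_ideal:
  assumes Q: "ideal Q R" and x: "x \<in> carrier R"
  shows "ideal {b \<in> carrier R. \<exists>s::nat. x [^] s \<otimes> b \<in> Q} R"
proof -
  interpret Q: ideal Q R by fact
  let ?S = "{b \<in> carrier R. \<exists>s::nat. x [^] s \<otimes> b \<in> Q}"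
  have mult: "r \<otimes> b \<in> ?S" if b: "b \<in> ?S" and r: "r \<in> carrier R" for b r
  proof -
    from b obtain s :: nat where s: "b \<in> carrier R" "x [^] s \<otimes> b \<in> Q" by auto
    have "x [^] s \<otimes> (r \<otimes> b) = r \<otimes> (x [^] s \<otimes> b)"
      using s(1) r x by (simp add: m_ac)
    also have "\<dots> \<in> Q" using s r Q.I_l_closed by blast
    finally show ?thesis using s r by auto
  qed
  have add: "b \<oplus> c \<in> ?S" if b: "b \<in> ?S" and c: "c \<in> ?S" for b c
  proof -
    from b obtain s :: nat where s: "b \<in> carrier R" "x [^] s \<otimes> b \<in> Q" by auto
    from c obtain t :: nat where t: "c \<in> carrier R" "x [^] t \<otimes> c \<in> Q" by auto
    have "x [^] (s + t) \<otimes> (b \<oplus> c) = x [^] t \<otimes> (x [^] s \<otimes> b) \<oplus> x [^] s \<otimes> (x [^] t \<otimes> c)"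
      using s(1) t(1) x by (simp add: nat_pow_mult[symmetric] r_distr m_ac)
    also have "\<dots> \<in> Q" using s t x Q.I_l_closed by simp
    finally show ?thesis using s t by blast
  qed
  show ?thesis
  proof (rule idealI)
    show "subgroup ?S (add_monoid R)"
    proof (rule add.subgroupI)
      show "?S \<noteq> {}" using Q.zero_closed x by (auto intro!: exI[of _ \<zero>])
      show "\<ominus> a \<in> ?S" if "a \<in> ?S" for a
        using mult[OF that, of "\<ominus> \<one>"] that by (auto simp: l_minus)
    qed (use add in auto)
    show "r \<otimes> a \<in> ?S" "a \<otimes> r \<in> ?S" if "a \<in> ?S" "r \<in> carrier R" for a r
      using mult[OF that] that m_comm[of a r] by auto
  qed (rule ring_axioms)
qed

lemma colon_ideal:
  assumes Q: "ideal Q R" and z: "z \<in> carrier R"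
  shows "ideal {b \<in> carrier R. z \<otimes> b \<in> Q} R"
proof -
  interpret Q: ideal Q R by fact
  let ?S = "{b \<in> carrier R. z \<otimes> b \<in> Q}"
  have mult: "r \<otimes> b \<in> ?S" if b: "b \<in> ?S" and r: "r \<in> carrier R" for b r
  proof -
    have "z \<otimes> (r \<otimes> b) = r \<otimes> (z \<otimes> b)"
      using b r z by (simp add: m_ac)
    also have "\<dots> \<in> Q" using b r Q.I_l_closed by blast
    finally show ?thesis using b r by auto
  qed
  show ?thesis
  proof (rule idealI)
    show "subgroup ?S (add_monoid R)"
    proof (rule add.subgroupI)
      show "?S \<noteq> {}" using Q.zero_closed z by (auto intro!: exI[of _ \<zero>])
      show "\<ominus> a \<in> ?S" if "a \<in> ?S" for a
        using mult[OF that, of "\<ominus> \<one>"] that by (auto simp: l_minus)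
    qed (use z r_distr in auto)
    show "r \<otimes> a \<in> ?S" "a \<otimes> r \<in> ?S" if "a \<in> ?S" "r \<in> carrier R" for a r
      using mult[OF that] that m_comm[of a r] by auto
  qed (rule ring_axioms)
qed

end

lemma (in primeideal) pow_mem_imp_mem:
  assumes "a \<in> carrier R" "a [^] (n::nat) \<in> I"
  shows "a \<in> I"
  using assms(2)
proof (induction n)
  case 0
  then show ?case using one_imp_carrier I_notcarr by simp
next
  case (Suc n)
  then show ?case using assms(1) I_prime[of "a [^] n" a] by auto
qed

section \<open>Nakayama's lemma and Krull's intersection theorem\<close>

locale noetherian_local = cring R + noetherian_ring R for R (structure) +
  fixes \<mm>
  assumes max_ideal: "ideal \<mm> R"
    and one_notin_max: "\<one> \<notin> \<mm>"
    and unitI: "\<lbrakk>u \<in> carrier R; u \<notin> \<mm>\<rbrakk> \<Longrightarrow> u \<in> Units R"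
begin

lemma max_carrier: "a \<in> \<mm> \<Longrightarrow> a \<in> carrier R"
  using max_ideal ideal.Icarr by fast

lemma one_minus_unit:
  assumes "a \<in> \<mm>"
  shows "\<one> \<ominus> a \<in> Units R"
proof (rule unitI)
  interpret m: ideal \<mm> R by (rule max_ideal)
  have a: "a \<in> carrier R" using assms max_carrier by blast
  show "\<one> \<ominus> a \<in> carrier R" using a by simp
  show "\<one> \<ominus> a \<notin> \<mm>"
  proof
    assume "\<one> \<ominus> a \<in> \<mm>"
    then have "(\<one> \<ominus> a) \<oplus> a \<in> \<mm>" using assms m.a_closed by blast
    moreover have "(\<one> \<ominus> a) \<oplus> a = \<one>" using a by (simp add: a_minus_def a_assoc l_neg)
    ultimately show False using one_notin_max by simp
  qed
qed

text \<open>An ideal \<open>L\<close> that is maximal among those not containing \<open>M\<close>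
  makes \<open>M\<close> cyclic modulo \<open>L\<close>: any \<open>b\<close> in \<open>M\<close>
  outside \<open>L\<close> satisfies \<open>M \<subseteq> adjoin L b\<close>. Inserting this into
  the decomposition of \<open>b\<close> gives
  \<open>b \<otimes> (\<one> \<ominus> u) \<in> L\<close> with \<open>u\<close> in
  \<open>\<mm>\<close>, where the second factor is a unit. There are two multipliers so that both
  generators of \<open>\<mm>\<close> can be used; a single one is passed twice.\<close>

lemma nakayama:
  assumes M: "ideal M R" and N: "ideal N R" and x: "x \<in> \<mm>" and y: "y \<in> \<mm>"
    and dec: "\<And>b. b \<in> M \<Longrightarrow> \<exists>n\<in>N. \<exists>p\<in>M. \<exists>q\<in>M. b = n \<oplus> x \<otimes> p \<oplus> y \<otimes> q"
  shows "M \<subseteq> N"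
proof (rule ccontr)
  assume "\<not> M \<subseteq> N"
  then have NF: "N \<in> {J. ideal J R \<and> \<not> M \<subseteq> J}" using N by simp
  obtain L where LF: "L \<in> {J. ideal J R \<and> \<not> M \<subseteq> J}" and NL: "N \<subseteq> L"
    and Lmax: "\<And>J. J \<in> {J. ideal J R \<and> \<not> M \<subseteq> J} \<Longrightarrow> L \<subseteq> J \<Longrightarrow> J = L"
    by (rule maximal_ideal_in_family[OF _ NF]) auto
  then have L: "ideal L R" "\<not> M \<subseteq> L" "N \<subseteq> L" by auto
  interpret L: ideal L R by fact
  interpret m: ideal \<mm> R by (rule max_ideal)
  obtain b where b: "b \<in> M" "b \<notin> L" using L(2) by auto
  have bc: "b \<in> carrier R" using b M ideal.Icarr by fast
  have sub: "L \<subseteq> adjoin L b" using subset_adjoin L.is_ideal bc by blast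
  have "b \<otimes> \<one> \<in> adjoin L b" using mult_mem_adjoin[OF L(1) bc] by simp
  then have "adjoin L b \<noteq> L" using b(2) bc by auto
  then have MLb: "M \<subseteq> adjoin L b"
    using Lmax[of "adjoin L b"] adjoin_ideal[OF L(1) bc] sub by auto
  obtain n p q where npq: "n \<in> N" "p \<in> M" "q \<in> M" "b = n \<oplus> x \<otimes> p \<oplus> y \<otimes> q"
    using dec[OF b(1)] by blast
  obtain l r where p: "l \<in> L" "r \<in> carrier R" "p = l \<oplus> b \<otimes> r"
    using MLb npq(2) mem_adjoin_iff by blast
  obtain l' r' where q: "l' \<in> L" "r' \<in> carrier R" "q = l' \<oplus> b \<otimes> r'"
    using MLb npq(3) mem_adjoin_iff by blast
  have c: "x \<in> carrier R" "y \<in> carrier R" "n \<in> carrier R" "l \<in> carrier R" "l' \<in> carrier R" "n \<in> L"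
    using x y max_carrier npq(1) L(3) L.Icarr p q by auto
  let ?k = "n \<oplus> x \<otimes> l \<oplus> y \<otimes> l'"
  let ?u = "x \<otimes> r \<oplus> y \<otimes> r'"
  have u: "?u \<in> \<mm>" using x y p q m.I_r_closed m.a_closed by blast
  have kc: "?k \<in> L" using c p q L.I_l_closed L.a_closed by blast
  have uc: "?u \<in> carrier R" "?k \<in> carrier R" using u kc m.Icarr L.Icarr by blast+
  have "x \<otimes> p = x \<otimes> l \<oplus> b \<otimes> (x \<otimes> r)" "y \<otimes> q = y \<otimes> l' \<oplus> b \<otimes> (y \<otimes> r')"
    unfolding p(3) q(3) using c p(2) q(2) bc by (simp_all add: r_distr m_ac)
  then have "n \<oplus> x \<otimes> p \<oplus> y \<otimes> q = ?k \<oplus> b \<otimes> ?u"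
    using c p(2) q(2) bc by (simp add: r_distr a_ac)
  then have bk: "b = ?k \<oplus> b \<otimes> ?u" using npq(4) by simp
  have "b \<otimes> (\<one> \<ominus> ?u) = b \<ominus> b \<otimes> ?u" using uc(1) bc r_diff_distr[OF bc one_closed uc(1)] by simp
  also have "\<dots> = (?k \<oplus> b \<otimes> ?u) \<ominus> b \<otimes> ?u" using bk by simp
  also have "\<dots> = ?k" by (rule add_diff_cancel_right[OF uc(2) m_closed[OF bc uc(1)]])
  finally have eq: "b \<otimes> (\<one> \<ominus> ?u) = ?k" .
  have "?k \<otimes> inv (\<one> \<ominus> ?u) \<in> L" using kc one_minus_unit[OF u] L.I_r_closed by blast
  moreover have "?k \<otimes> inv (\<one> \<ominus> ?u) = b"
    unfolding eq[symmetric] using one_minus_unit[OF u] bc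
    by (simp add: m_assoc Units_closed del: minus_closed)
  ultimately show False using b(2) by simp
qed

text \<open>Stabilisation of the colon ideals of \<open>I\<close> by powers of \<open>z\<close>
  takes the place of the Artin-Rees lemma: it allows elements of the intersection \<open>N\<close>
  to be divided by \<open>z\<close> within \<open>N\<close>, up to elements of \<open>I\<close>, and
  then Nakayama's lemma applies.\<close>

lemma krull_intersection:
  assumes I: "ideal I R" and z: "z \<in> \<mm>" and f: "\<And>n::nat. f \<in> adjoin I (z [^] n)"
  shows "f \<in> I"
proof -
  interpret I: ideal I R by fact
  have zc: "z \<in> carrier R" using z max_carrier by blast
  define N where "N = (\<Inter>n::nat. adjoin I (z [^] n))"
  have N: "ideal N R" unfolding N_def
    using i_Intersect[of "range (\<lambda>n::nat. adjoin I (z [^] n))"] adjoin_ideal[OF I] zc by auto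
  interpret N: ideal N R by fact
  have ND: "b \<in> adjoin I (z [^] n)" if "b \<in> N" for b and n :: nat
    using that unfolding N_def by (rule INT_D) simp
  have IN: "I \<subseteq> N" unfolding N_def using subset_adjoin[OF I] zc by auto
  define C where "C n = {b \<in> carrier R. z [^] (n::nat) \<otimes> b \<in> I}" for n
  obtain k where k: "C (Suc k) = C k"
  proof (rule ascending_ideals_stabilise)
    show "ideal (C n) R" for n unfolding C_def using colon_ideal I zc by simp
    show "C n \<subseteq> C (Suc n)" for n
    proof
      fix b assume b: "b \<in> C n"
      have "z [^] Suc n \<otimes> b = z \<otimes> (z [^] n \<otimes> b)" using b zc by (simp add: C_def m_ac)
      then show "b \<in> C (Suc n)" using b zc I.I_l_closed by (simp add: C_def)
    qed
  qed
  have "N \<subseteq> I"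
  proof (rule nakayama[OF N I z z])
    fix b assume b: "b \<in> N"
    then obtain i r where ir: "i \<in> I" "r \<in> carrier R" "b = i \<oplus> z [^] Suc k \<otimes> r"
      using ND[of b "Suc k"] unfolding mem_adjoin_iff by auto
    \<comment> \<open>Two expansions of \<open>b\<close>, with exponents \<open>Suc k\<close> and
      \<open>Suc k + n\<close>, are compared. Their difference puts
      \<open>r \<ominus> z [^] n \<otimes> t\<close> into \<open>C (Suc k)\<close>, which equals
      \<open>C k\<close>, so one factor \<open>z\<close> may be dropped.\<close>
    have rN: "z [^] k \<otimes> r \<in> N" unfolding N_def
    proof (rule INT_I)
      fix n :: nat
      obtain j t where jt: "j \<in> I" "t \<in> carrier R" "b = j \<oplus> z [^] (Suc k + n) \<otimes> t"
        using ND[OF b, of "Suc k + n"] unfolding mem_adjoin_iff by auto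
      have jc: "i \<in> carrier R" "j \<in> carrier R" using I.Icarr ir jt by auto
      have e: "i \<oplus> z [^] Suc k \<otimes> r = j \<oplus> z [^] (Suc k + n) \<otimes> t" using ir jt by simp
      have pw: "z [^] (Suc k + n) = z [^] Suc k \<otimes> z [^] n" using zc by (rule nat_pow_mult[symmetric])
      have c: "z [^] Suc k \<in> carrier R" "z [^] n \<in> carrier R" "z [^] k \<in> carrier R"
        "z [^] n \<otimes> t \<in> carrier R" using zc jt by auto
      have "z [^] Suc k \<otimes> (r \<ominus> z [^] n \<otimes> t) = z [^] Suc k \<otimes> r \<ominus> z [^] Suc k \<otimes> (z [^] n \<otimes> t)"
        by (rule r_diff_distr[OF c(1) ir(2) c(4)])
      also have "z [^] Suc k \<otimes> r = b \<ominus> i"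
        unfolding ir(3) using add_diff_cancel_left[OF jc(1) m_closed[OF c(1) ir(2)]] by simp
      also have "z [^] Suc k \<otimes> (z [^] n \<otimes> t) = b \<ominus> j"
        unfolding jt(3) pw using add_diff_cancel_left[OF jc(2) m_closed[OF c(1) c(4)]] c(1,2) jt(2)
        by (simp only: m_assoc)
      also have "(b \<ominus> i) \<ominus> (b \<ominus> j) = j \<ominus> i"
      proof -
        have bc: "b \<in> carrier R" using b N.Icarr by blast
        have "(b \<ominus> i) \<ominus> (b \<ominus> j) = (b \<oplus> (j \<ominus> i)) \<ominus> b"
          using bc jc by (simp add: a_minus_def minus_add a_ac)
        then show ?thesis using add_diff_cancel_left[of b "j \<ominus> i"] bc jc by simp
      qed
      finally have "z [^] Suc k \<otimes> (r \<ominus> z [^] n \<otimes> t) \<in> I"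
        using ir jt by (simp add: a_minus_def)
      then have "r \<ominus> z [^] n \<otimes> t \<in> C (Suc k)" using zc ir jt unfolding C_def by simp
      then have d: "z [^] k \<otimes> (r \<ominus> z [^] n \<otimes> t) \<in> I" unfolding k by (simp add: C_def)
      have "z [^] k \<otimes> r = z [^] k \<otimes> ((r \<ominus> z [^] n \<otimes> t) \<oplus> z [^] n \<otimes> t)"
        using diff_add_cancel[OF ir(2) c(4)] by simp
      also have "\<dots> = z [^] k \<otimes> (r \<ominus> z [^] n \<otimes> t) \<oplus> z [^] k \<otimes> (z [^] n \<otimes> t)"
        using c ir(2) jt(2) by (intro r_distr) auto
      also have "z [^] k \<otimes> (z [^] n \<otimes> t) = z [^] n \<otimes> (z [^] k \<otimes> t)"
        by (rule m_lcomm[OF c(3) c(2) jt(2)])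
      finally have "z [^] k \<otimes> r = z [^] k \<otimes> (r \<ominus> z [^] n \<otimes> t) \<oplus> z [^] n \<otimes> (z [^] k \<otimes> t)" .
      then show "z [^] k \<otimes> r \<in> adjoin I (z [^] n)"
        unfolding mem_adjoin_iff using d c(3) jt(2) by auto
    qed
    have "b = i \<oplus> z \<otimes> (z [^] k \<otimes> r) \<oplus> z \<otimes> \<zero>"
      using ir zc I.Icarr by (simp add: m_ac)
    then show "\<exists>n\<in>I. \<exists>p\<in>N. \<exists>q\<in>N. b = n \<oplus> z \<otimes> p \<oplus> z \<otimes> q"
      using ir rN N.zero_closed by blast
  qed
  moreover have "f \<in> N" using f unfolding N_def by simp
  ultimately show ?thesis by blast
qed

end

section \<open>The principal ideal theorem and systems of parameters\<close>

locale two_generated_local = noetherian_local +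
  fixes x y
  assumes x_carrier [simp, intro]: "x \<in> carrier R" and y_carrier [simp, intro]: "y \<in> carrier R"
    and max_eq: "\<mm> = {x \<otimes> a \<oplus> y \<otimes> b | a b. a \<in> carrier R \<and> b \<in> carrier R}"
begin

lemma max_memI: "\<lbrakk>a \<in> carrier R; b \<in> carrier R\<rbrakk> \<Longrightarrow> x \<otimes> a \<oplus> y \<otimes> b \<in> \<mm>"
  unfolding max_eq by blast

lemma max_memE:
  assumes "f \<in> \<mm>"
  obtains a b where "a \<in> carrier R" "b \<in> carrier R" "f = x \<otimes> a \<oplus> y \<otimes> b"
  using assms unfolding max_eq by blast

lemma x_max: "x \<in> \<mm>" and y_max: "y \<in> \<mm>"
  using max_memI[of \<one> \<zero>] max_memI[of \<zero> \<one>] by simp_all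

text \<open>Modulo \<open>K\<close> the maximal ideal is generated by \<open>y\<close> alone. By
  Krull's intersection theorem \<open>y\<close> can be divided out only finitely often, and after
  the last division the cofactor lies outside \<open>\<mm>\<close>.\<close>

lemma mem_or_unit_times_power:
  assumes K: "ideal K R" and xK: "x \<in> K" and f: "f \<in> carrier R" "f \<notin> K"
  obtains u n \<kappa> where "u \<in> Units R" "\<kappa> \<in> K" "f = \<kappa> \<oplus> u \<otimes> y [^] (n::nat)"
proof -
  interpret K: ideal K R by fact
  have "\<exists>n::nat. f \<notin> adjoin K (y [^] n)"
    using krull_intersection[OF K y_max] f(2) by blast
  define n where "n = (LEAST n::nat. f \<notin> adjoin K (y [^] n))"
  have n: "f \<notin> adjoin K (y [^] n)"
    unfolding n_def by (rule LeastI_ex) fact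
  have less: "f \<in> adjoin K (y [^] i)" if "i < n" for i :: nat
    using not_less_Least[OF that[unfolded n_def]] by simp
  have "f \<in> adjoin K (y [^] (0::nat))"
    using mult_mem_adjoin[OF K, of \<one> f] f by simp
  then obtain k where k: "n = Suc k" using n by (cases n) auto
  then obtain \<kappa> u where u: "\<kappa> \<in> K" "u \<in> carrier R" "f = \<kappa> \<oplus> y [^] k \<otimes> u"
    using less[of k] unfolding mem_adjoin_iff by auto
  have "u \<notin> \<mm>"
  proof
    assume "u \<in> \<mm>"
    then obtain a b where ab: "a \<in> carrier R" "b \<in> carrier R" "u = x \<otimes> a \<oplus> y \<otimes> b"
      by (rule max_memE)
    have "f = (\<kappa> \<oplus> x \<otimes> (y [^] k \<otimes> a)) \<oplus> y [^] Suc k \<otimes> b"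
      unfolding u(3) ab(3) using ab u K.Icarr by (simp add: r_distr m_ac a_ac)
    moreover have "\<kappa> \<oplus> x \<otimes> (y [^] k \<otimes> a) \<in> K" using u ab xK K.I_r_closed by simp
    ultimately have "f \<in> adjoin K (y [^] Suc k)" unfolding mem_adjoin_iff using ab(2) by blast
    then show False using n k by simp
  qed
  then show ?thesis using that[of u \<kappa> k] u unitI m_comm by simp
qed

text \<open>Modulo \<open>K\<close>, two elements outside \<open>K\<close> are units times powers of
  \<open>y\<close>, and hence so is their product.\<close>

lemma prime_containing_x:
  assumes K: "ideal K R" and xK: "x \<in> K" and y: "\<And>n::nat. y [^] n \<notin> K"
  shows "primeideal K R"
proof (rule primeidealI)
  interpret K: ideal K R by fact
  show "carrier R \<noteq> K" using y[of 0] by auto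
  fix a b assume ab: "a \<in> carrier R" "b \<in> carrier R" "a \<otimes> b \<in> K"
  show "a \<in> K \<or> b \<in> K"
  proof (rule ccontr)
    assume neg: "\<not> (a \<in> K \<or> b \<in> K)"
    obtain u n \<kappa> where u: "u \<in> Units R" "\<kappa> \<in> K" "a = \<kappa> \<oplus> u \<otimes> y [^] (n::nat)"
      using neg by (auto intro: mem_or_unit_times_power[OF K xK ab(1)])
    obtain v l \<mu> where v: "v \<in> Units R" "\<mu> \<in> K" "b = \<mu> \<oplus> v \<otimes> y [^] (l::nat)"
      using neg by (auto intro: mem_or_unit_times_power[OF K xK ab(2)])
    have c: "u \<in> carrier R" "v \<in> carrier R" "\<kappa> \<in> carrier R" "\<mu> \<in> carrier R"
      using u v K.Icarr by auto
    have w: "u \<otimes> v \<in> Units R" using u v by simp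
    have "a \<otimes> b = (\<kappa> \<otimes> b \<oplus> (u \<otimes> y [^] n) \<otimes> \<mu>) \<oplus> (u \<otimes> v) \<otimes> y [^] (n + l)"
      unfolding u(3) v(3) using c by (simp add: l_distr r_distr m_ac a_ac nat_pow_mult[symmetric])
    moreover have k: "\<kappa> \<otimes> b \<oplus> (u \<otimes> y [^] n) \<otimes> \<mu> \<in> K"
      using u v c ab K.I_r_closed K.I_l_closed by simp
    ultimately have "(u \<otimes> v) \<otimes> y [^] (n + l) = a \<otimes> b \<ominus> (\<kappa> \<otimes> b \<oplus> (u \<otimes> y [^] n) \<otimes> \<mu>)"
      using add_diff_cancel_left[OF K.Icarr[OF k], of "(u \<otimes> v) \<otimes> y [^] (n + l)"] c by simp
    then have "(u \<otimes> v) \<otimes> y [^] (n + l) \<in> K"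
      using ab(3) k by (simp add: a_minus_def)
    then have "inv (u \<otimes> v) \<otimes> ((u \<otimes> v) \<otimes> y [^] (n + l)) \<in> K"
      using K.I_l_closed w by blast
    moreover have "inv (u \<otimes> v) \<otimes> ((u \<otimes> v) \<otimes> y [^] (n + l)) = y [^] (n + l)"
      using w Units_closed[OF w] by (simp add: m_assoc[symmetric] del: Units_m_closed)
    ultimately show False using y by simp
  qed
qed (use K is_cring in auto)

lemma prime_not_containing_gens:
  assumes "primeideal P R" "P \<subset> \<mm>"
  shows "x \<notin> P \<or> y \<notin> P"
proof (rule ccontr)
  interpret P: primeideal P R by fact
  assume "\<not> ?thesis"
  then have "\<mm> \<subseteq> P" unfolding max_eq using P.I_r_closed by auto
  then show False using assms by blast
qed

text \<open>
  The ideals \<open>I n\<close> play the role of the symbolic powers of \<open>P\<^sub>1\<close> in the usual proof of Krull's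
  principal ideal theorem, with powers of \<open>x\<close> as the only denominators.
\<close>
lemma principal_ideal_theorem:
  assumes P0: "primeideal P0 R" and P1: "primeideal P1 R" and P01: "P0 \<subset> P1" and P1m: "P1 \<subset> \<mm>"
  shows "y [^] (d::nat) \<notin> adjoin P0 x"
proof
  assume yd: "y [^] d \<in> adjoin P0 x"
  interpret P0: primeideal P0 R by fact
  interpret P1: primeideal P1 R by fact
  obtain a where a: "a \<in> P1" "a \<notin> P0" using P01 by blast
  have ac: "a \<in> carrier R" using a P1.Icarr by blast
  define K where "K = adjoin P0 x"
  define Q where "Q n = adjoin P0 (a [^] n)" for n :: nat
  define I where "I n = {b \<in> carrier R. \<exists>s::nat. x [^] s \<otimes> b \<in> Q n}" for n
  define J where "J n = adjoin (I n) x" for n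
  have Q: "ideal (Q n) R" for n unfolding Q_def using adjoin_ideal P0.is_ideal ac by blast
  have I: "ideal (I n) R" for n unfolding I_def using saturation_ideal Q by simp
  have J: "ideal (J n) R" for n unfolding J_def using adjoin_ideal I by simp
  have K: "ideal K R" unfolding K_def using adjoin_ideal P0.is_ideal by simp
  have xK: "x \<in> K" unfolding K_def using mult_mem_adjoin[OF P0.is_ideal, of x \<one>] by simp
  have Q_mono: "Q (Suc n) \<subseteq> Q n" for n
  proof
    fix f assume "f \<in> Q (Suc n)"
    then obtain p r where "p \<in> P0" "r \<in> carrier R" "f = p \<oplus> a [^] Suc n \<otimes> r"
      unfolding Q_def mem_adjoin_iff by blast
    moreover then have "f = p \<oplus> a [^] n \<otimes> (a \<otimes> r)" using ac by (simp add: m_assoc)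
    ultimately show "f \<in> Q n" unfolding Q_def mem_adjoin_iff using ac by blast
  qed
  have I_mono: "I (Suc n) \<subseteq> I n" for n unfolding I_def using Q_mono by blast
  have J_mono: "J (Suc n) \<subseteq> J n" for n
    unfolding J_def adjoin_def using I_mono by blast
  have P0I: "P0 \<subseteq> I n" for n
  proof
    fix p assume p: "p \<in> P0"
    then have "x [^] (0::nat) \<otimes> p \<in> Q n"
      using subset_adjoin[OF P0.is_ideal, of "a [^] n"] ac P0.Icarr unfolding Q_def by auto
    then show "p \<in> I n" unfolding I_def using p P0.Icarr by blast
  qed
  have KJ: "K \<subseteq> J n" for n unfolding K_def J_def adjoin_def using P0I by blast
  define h where "h n = (LEAST k. y [^] (k::nat) \<in> J n)" for n
  have ydJ: "y [^] d \<in> J n" for n using yd KJ K_def by blast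
  have h: "y [^] h n \<in> J n" for n unfolding h_def using ydJ by (rule LeastI)
  have h_le: "h n \<le> k" if "y [^] k \<in> J n" for n k unfolding h_def using that by (rule Least_le)
  \<comment> \<open>Since \<open>J n\<close> contains \<open>K\<close>, the number
    \<open>h n\<close> is the length of \<open>R\<close> modulo \<open>J n\<close>. It never exceeds
    \<open>d\<close>, which stands in for the descending chain condition modulo
    \<open>K\<close>.\<close>
  have "\<exists>n. h (Suc n) = h n"
  proof (rule ccontr)
    assume neg: "\<nexists>n. h (Suc n) = h n"
    have "h n < h (Suc n)" for n
    proof -
      have "h n \<le> h (Suc n)" using h[of "Suc n"] J_mono h_le by blast
      then show ?thesis using neg by (metis le_neq_implies_less)
    qed
    then have "strict_mono h" by (simp add: strict_mono_Suc_iff)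
    then have "Suc d \<le> h (Suc d)" by (rule strict_mono_imp_increasing)
    moreover have "h (Suc d) \<le> d" using h_le ydJ by blast
    ultimately show False by simp
  qed
  then obtain n where n: "h (Suc n) = h n" by blast
  interpret In: ideal "I n" R by (rule I)
  interpret IS: ideal "I (Suc n)" R by (rule I)
  interpret JS: ideal "J (Suc n)" R by (rule J)
  interpret Jn: ideal "J n" R by (rule J)
  \<comment> \<open>An ideal containing \<open>K\<close> is determined by the least power of
    \<open>y\<close> in it.\<close>
  have JJ: "J n \<subseteq> J (Suc n)"
  proof
    fix f assume f: "f \<in> J n"
    show "f \<in> J (Suc n)"
    proof (cases "f \<in> K")
      case True then show ?thesis using KJ by blast
    next
      case False
      obtain u k \<kappa> where u: "u \<in> Units R" "\<kappa> \<in> K" "f = \<kappa> \<oplus> u \<otimes> y [^] (k::nat)"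
        by (rule mem_or_unit_times_power[OF K xK Jn.Icarr[OF f] False])
      have uc: "u \<in> carrier R" "\<kappa> \<in> carrier R" "\<kappa> \<in> J n"
        using u(1) Jn.Icarr[OF subsetD[OF KJ u(2)]] subsetD[OF KJ u(2)] by auto
      have "f \<ominus> \<kappa> \<in> J n" using f uc by (simp add: a_minus_def)
      moreover have "f \<ominus> \<kappa> = u \<otimes> y [^] k" 
        unfolding u(3) using uc by (simp add: add_diff_cancel_left)
      ultimately have "inv u \<otimes> (u \<otimes> y [^] k) \<in> J n"
        using Jn.I_l_closed u by (metis Units_inv_closed)
      moreover have "inv u \<otimes> (u \<otimes> y [^] k) = y [^] k"
        using u uc by (simp add: m_assoc[symmetric])
      ultimately have "h (Suc n) \<le> k" using h_le n by simp
      then obtain j where j: "k = h (Suc n) + j" using le_Suc_ex by blast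
      have "y [^] k \<in> J (Suc n)"
        unfolding j nat_pow_mult[OF y_carrier, symmetric] using h JS.I_r_closed by simp
      then show ?thesis unfolding u(3) using u(2) KJ uc JS.I_l_closed JS.a_closed by blast
    qed
  qed
  \<comment> \<open>\<open>I n\<close> is saturated with respect to \<open>x\<close>: if it contains
    \<open>x \<otimes> r\<close>, it contains \<open>r\<close>. So \<open>I n\<close> lies in
    \<open>I (Suc n)\<close> plus \<open>x\<close> times \<open>I n\<close>.\<close>
  have "I n \<subseteq> I (Suc n)"
  proof (rule nakayama[OF I I x_max y_max])
    fix b assume b: "b \<in> I n"
    then have "b \<in> J (Suc n)" using JJ subset_adjoin[OF I x_carrier] unfolding J_def by blast
    then obtain c r where c: "c \<in> I (Suc n)" "r \<in> carrier R" "b = c \<oplus> x \<otimes> r"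
      unfolding J_def mem_adjoin_iff by blast
    have cn: "c \<in> I n" "c \<in> carrier R" using c I_mono IS.Icarr by auto
    have "b \<ominus> c \<in> I n" using b cn by (simp add: a_minus_def)
    moreover have "b \<ominus> c = x \<otimes> r" unfolding c(3) using cn c(2) by (simp add: add_diff_cancel_left)
    ultimately obtain s :: nat where "x [^] s \<otimes> (x \<otimes> r) \<in> Q n" unfolding I_def by auto
    then have "x [^] Suc s \<otimes> r \<in> Q n" using c by (simp add: m_assoc)
    then have "r \<in> I n" unfolding I_def using c by blast
    moreover have "b = c \<oplus> x \<otimes> r \<oplus> y \<otimes> \<zero>" using c cn by simp
    ultimately show "\<exists>n'\<in>I (Suc n). \<exists>p\<in>I n. \<exists>q\<in>I n. b = n' \<oplus> x \<otimes> p \<oplus> y \<otimes> q"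
      using c In.zero_closed by blast
  qed
  moreover have "x [^] (0::nat) \<otimes> a [^] n \<in> Q n"
    unfolding Q_def using mult_mem_adjoin[OF P0.is_ideal, of "a [^] n" \<one>] ac by simp
  then have "a [^] n \<in> I n" unfolding I_def using ac by blast
  ultimately obtain s :: nat where "x [^] s \<otimes> a [^] n \<in> Q (Suc n)" unfolding I_def by blast
  then obtain p r where pr: "p \<in> P0" "r \<in> carrier R" "x [^] s \<otimes> a [^] n = p \<oplus> a [^] Suc n \<otimes> r"
    unfolding Q_def mem_adjoin_iff by blast
  have pc: "p \<in> carrier R" using pr P0.Icarr by blast
  have "a [^] n \<otimes> (x [^] s \<ominus> a \<otimes> r) = x [^] s \<otimes> a [^] n \<ominus> a [^] Suc n \<otimes> r"
    using ac pr(2) by (simp add: r_diff_distr m_ac)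
  also have "\<dots> = p" unfolding pr(3) using pc pr(2) ac by (simp add: add_diff_cancel_right del: nat_pow_Suc)
  finally have "a [^] n \<otimes> (x [^] s \<ominus> a \<otimes> r) \<in> P0" using pr by simp
  \<comment> \<open>The factor \<open>a [^] n\<close> cancels modulo the prime \<open>P0\<close>,
    since \<open>a\<close> was chosen outside it. What is left forces \<open>x\<close>, and then
    \<open>y\<close>, into \<open>P1\<close>.\<close>
  then have "x [^] s \<ominus> a \<otimes> r \<in> P0"
    using P0.I_prime[of "a [^] n" "x [^] s \<ominus> a \<otimes> r"] P0.pow_mem_imp_mem[OF ac] a(2) ac pr(2) by auto
  then have "x [^] s \<ominus> a \<otimes> r \<in> P1" using P01 by blast
  then have "(x [^] s \<ominus> a \<otimes> r) \<oplus> a \<otimes> r \<in> P1" using a pr P1.I_r_closed P1.a_closed by blast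
  moreover have "(x [^] s \<ominus> a \<otimes> r) \<oplus> a \<otimes> r = x [^] s"
    using ac pr(2) by (simp add: diff_add_cancel)
  ultimately have "x [^] s \<in> P1" by (simp only:)
  then have xP1: "x \<in> P1" by (rule P1.pow_mem_imp_mem[OF x_carrier])
  have "K \<subseteq> P1" unfolding K_def adjoin_def using xP1 P01 P1.I_r_closed by auto
  then have "y [^] d \<in> P1" using yd unfolding K_def by (rule subsetD)
  then have "y \<in> P1" by (rule P1.pow_mem_imp_mem[OF y_carrier])
  then show False using prime_not_containing_gens[OF P1 P1m] xP1 by simp
qed

text \<open>The chain of primes makes \<open>adjoin P0 x\<close> prime and keeps \<open>y\<close>
  out of it. An element of \<open>P0\<close>, written in terms of \<open>x\<close> and
  \<open>y\<close>, can then be rewritten with both coefficients in \<open>P0\<close>, so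
  \<open>P0\<close> vanishes by Nakayama's lemma, and \<open>adjoin P0 x\<close> is the ideal
  generated by \<open>x\<close>.\<close>

lemma domain_and_prime_generator:
  assumes P0: "primeideal P0 R" and P1: "primeideal P1 R" and P01: "P0 \<subset> P1" and P1m: "P1 \<subset> \<mm>"
  shows "domain R" "primeideal (PIdl x) R" "y \<notin> PIdl x" "x \<noteq> \<zero>"
proof -
  interpret P0: primeideal P0 R by fact
  interpret P1: primeideal P1 R by fact
  define K where "K = adjoin P0 x"
  have K: "ideal K R" unfolding K_def using adjoin_ideal P0.is_ideal by simp
  have xK: "x \<in> K" unfolding K_def using mult_mem_adjoin[OF P0.is_ideal, of x \<one>] by simp
  have yK: "y [^] n \<notin> K" for n :: nat
    unfolding K_def by (rule principal_ideal_theorem[OF assms])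
  interpret K: primeideal K R by (rule prime_containing_x[OF K xK yK])
  have y1K: "y \<notin> K" using yK[of 1] by simp
  have xP0: "x \<notin> P0"
  proof
    assume xP0: "x \<in> P0"
    have KP0: "K \<subseteq> P0" unfolding K_def adjoin_def using xP0 P0.I_r_closed by auto
    obtain a where a: "a \<in> P1" "a \<notin> P0" using P01 by blast
    have "a \<notin> K" using a KP0 by blast
    then obtain u n \<kappa> where u: "u \<in> Units R" "\<kappa> \<in> K" "a = \<kappa> \<oplus> u \<otimes> y [^] (n::nat)"
      by (rule mem_or_unit_times_power[OF K xK P1.Icarr[OF a(1)]])
    have uc: "u \<in> carrier R" "\<kappa> \<in> carrier R" "\<kappa> \<in> P1"
      using u(1) K.Icarr[OF u(2)] subsetD[OF KP0 u(2)] P01 by auto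
    have "a \<ominus> \<kappa> \<in> P1" using a uc by (simp add: a_minus_def)
    moreover have "a \<ominus> \<kappa> = u \<otimes> y [^] n" 
      unfolding u(3) using uc by (simp add: add_diff_cancel_left)
    ultimately have "inv u \<otimes> (u \<otimes> y [^] n) \<in> P1"
      using P1.I_l_closed u by (metis Units_inv_closed)
    moreover have "inv u \<otimes> (u \<otimes> y [^] n) = y [^] n"
      using u uc by (simp add: m_assoc[symmetric])
    ultimately have "y [^] n \<in> P1" by (simp only:)
    then have "y \<in> P1" by (rule P1.pow_mem_imp_mem[OF y_carrier])
    then show False using prime_not_containing_gens[OF P1 P1m] xP0 P01 by auto
  qed
  have "P0 \<subseteq> {\<zero>}"
  proof (rule nakayama[OF P0.is_ideal zeroideal x_max y_max])
    fix f assume f: "f \<in> P0"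
    then have "f \<in> \<mm>" using P01 P1m by blast
    then obtain a b where ab: "a \<in> carrier R" "b \<in> carrier R" "f = x \<otimes> a \<oplus> y \<otimes> b"
      by (rule max_memE)
    have "f \<in> K" using f subset_adjoin[OF P0.is_ideal x_carrier] unfolding K_def by blast
    then have "f \<ominus> x \<otimes> a \<in> K" using xK K.I_r_closed ab by (simp add: a_minus_def)
    moreover have "f \<ominus> x \<otimes> a = y \<otimes> b"
      unfolding ab(3) using ab(1,2) by (simp add: add_diff_cancel_left)
    ultimately have "b \<in> K" using K.I_prime[of y b] ab y1K by auto
    then obtain p c where pc: "p \<in> P0" "c \<in> carrier R" "b = p \<oplus> x \<otimes> c"
      unfolding K_def mem_adjoin_iff by blast
    have pcar: "p \<in> carrier R" using pc P0.Icarr by blast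
    have f_eq: "f = x \<otimes> (a \<oplus> y \<otimes> c) \<oplus> y \<otimes> p"
      unfolding ab(3) pc(3) using ab(1) pc(2) pcar by (simp add: r_distr m_ac a_ac)
    have "f \<ominus> y \<otimes> p \<in> P0" using f pc P0.I_l_closed by (simp add: a_minus_def)
    moreover have "f \<ominus> y \<otimes> p = x \<otimes> (a \<oplus> y \<otimes> c)"
      unfolding f_eq using ab(1) pc(2) pcar by (simp add: add_diff_cancel_right)
    ultimately have "a \<oplus> y \<otimes> c \<in> P0" using P0.I_prime[of x "a \<oplus> y \<otimes> c"] xP0 ab pc by auto
    moreover have "f = \<zero> \<oplus> x \<otimes> (a \<oplus> y \<otimes> c) \<oplus> y \<otimes> p"
      using f_eq ab(1) pc(2) pcar by simp
    ultimately show "\<exists>n\<in>{\<zero>}. \<exists>p\<in>P0. \<exists>q\<in>P0. f = n \<oplus> x \<otimes> p \<oplus> y \<otimes> q"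
      using pc by blast
  qed
  then have P0_eq: "P0 = {\<zero>}" using P0.zero_closed by blast
  show "domain R"
  proof (rule domainI)
    show "\<one> \<noteq> \<zero>" using P0.I_notcarr P0.one_imp_carrier P0.zero_closed by auto
    show "a = \<zero> \<or> b = \<zero>" if "a \<otimes> b = \<zero>" "a \<in> carrier R" "b \<in> carrier R" for a b
      using P0.I_prime[of a b] that P0_eq by auto
  qed (rule is_cring)
  have "K = PIdl x"
  proof (rule Set.set_eqI)
    fix f
    have "f \<in> K \<longleftrightarrow> (\<exists>r\<in>carrier R. f = \<zero> \<oplus> x \<otimes> r)"
      unfolding K_def mem_adjoin_iff P0_eq by simp
    also have "\<dots> \<longleftrightarrow> f \<in> PIdl x"
      unfolding mem_PIdl_iff[OF x_carrier] by (intro bex_cong refl) simp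
    finally show "f \<in> K \<longleftrightarrow> f \<in> PIdl x" .
  qed
  then show "primeideal (PIdl x) R" "y \<notin> PIdl x" using K.primeideal y1K by auto
  show "x \<noteq> \<zero>" using xP0 P0.zero_closed by auto
qed

end

locale regular_parameters = two_generated_local R \<mm> x y + "domain" R for R (structure) and \<mm> x y +
  assumes x_nonzero: "x \<noteq> \<zero>"
    and prime_x: "primeideal (PIdl x) R"
    and y_notin: "y \<notin> PIdl x"

text \<open>The chain of primes does not distinguish the two generators, so either can play the part
  of the element of value 1.\<close>

lemma (in two_generated_local) regular_parametersI:
  assumes "primeideal P0 R" "primeideal P1 R" "P0 \<subset> P1" "P1 \<subset> \<mm>"
  shows "regular_parameters R \<mm> x y" "regular_parameters R \<mm> y x"
proof -
  note d = domain_and_prime_generator[OF assms]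
  show "regular_parameters R \<mm> x y"
    by (intro regular_parameters.intro regular_parameters_axioms.intro two_generated_local_axioms d)
  have swap: "two_generated_local R \<mm> y x"
  proof unfold_locales
    have "{x \<otimes> a \<oplus> y \<otimes> b | a b. a \<in> carrier R \<and> b \<in> carrier R}
      \<subseteq> {y \<otimes> a \<oplus> x \<otimes> b | a b. a \<in> carrier R \<and> b \<in> carrier R}"
    proof clarify
      fix a b assume ab: "a \<in> carrier R" "b \<in> carrier R"
      then have "x \<otimes> a \<oplus> y \<otimes> b = y \<otimes> b \<oplus> x \<otimes> a" by (simp add: a_comm)
      with ab show "\<exists>a' b'. x \<otimes> a \<oplus> y \<otimes> b = y \<otimes> a' \<oplus> x \<otimes> b' \<and> a' \<in> carrier R \<and> b' \<in> carrier R"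
        by metis
    qed
    moreover have "{y \<otimes> a \<oplus> x \<otimes> b | a b. a \<in> carrier R \<and> b \<in> carrier R} 
      \<subseteq> {x \<otimes> a \<oplus> y \<otimes> b | a b. a \<in> carrier R \<and> b \<in> carrier R}"
    proof clarify
      fix a b assume ab: "a \<in> carrier R" "b \<in> carrier R"
      then have "y \<otimes> a \<oplus> x \<otimes> b = x \<otimes> b \<oplus> y \<otimes> a" by (simp add: a_comm)
      with ab show "\<exists>a' b'. y \<otimes> a \<oplus> x \<otimes> b = x \<otimes> a' \<oplus> y \<otimes> b' \<and> a' \<in> carrier R \<and> b' \<in> carrier R"
        by metis
    qed
    ultimately show "\<mm> = {y \<otimes> a \<oplus> x \<otimes> b | a b. a \<in> carrier R \<and> b \<in> carrier R}"
      unfolding max_eq by (rule equalityI)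
  qed auto
  show "regular_parameters R \<mm> y x"
    by (intro regular_parameters.intro regular_parameters_axioms.intro swap d
        two_generated_local.domain_and_prime_generator[OF swap assms])
qed

section \<open>Regular parameters from the definition of regularity\<close>

lemma noetherian_local_if_unique_maximalideal:
  fixes R (structure)
  assumes "noetherian_local_ring R \<mm>"
  shows "noetherian_local R \<mm>"
    and "\<And>I. ideal I R \<Longrightarrow> \<one> \<notin> I \<Longrightarrow> I \<subseteq> \<mm>"
proof -
  interpret noetherian_local_ring R \<mm> by fact
  have "maximalideal \<mm> R" using unique_maximalideal by (metis mem_Collect_eq singletonI)
  then interpret m: maximalideal \<mm> R .
  show sub: "I \<subseteq> \<mm>" if I: "ideal I R" "\<one> \<notin> I" for I
  proof -
    have IF: "I \<in> {J. ideal J R \<and> \<one> \<notin> J}" using I by simp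
    obtain M where M: "M \<in> {J. ideal J R \<and> \<one> \<notin> J}" "I \<subseteq> M"
      "\<And>J. J \<in> {J. ideal J R \<and> \<one> \<notin> J} \<Longrightarrow> M \<subseteq> J \<Longrightarrow> J = M"
      by (rule maximal_ideal_in_family[OF _ IF]) auto
    have "maximalideal M R"
    proof (rule maximalidealI)
      show "ideal M R" using M by simp
      show "carrier R \<noteq> M" using M(1) one_closed by auto
      show "J = M \<or> J = carrier R" if J: "ideal J R" "M \<subseteq> J" "J \<subseteq> carrier R" for J
        using M(3)[of J] J ideal.one_imp_carrier[OF J(1)] by auto
    qed
    then have "M = \<mm>" using unique_maximalideal by (metis mem_Collect_eq singletonD)
    then show ?thesis using M(2) by simp
  qed
  show "noetherian_local R \<mm>"
  proof (intro noetherian_local.intro noetherian_local_axioms.intro is_cring noetherian_ring_axioms)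
    show "ideal \<mm> R" by (rule m.is_ideal)
    show "\<one> \<notin> \<mm>" using m.I_notcarr m.one_imp_carrier by auto
    fix u assume u: "u \<in> carrier R" "u \<notin> \<mm>"
    have "\<one> \<in> PIdl u"
      using sub[OF cgenideal_ideal[OF u(1)]] cgenideal_self[OF u(1)] u(2) by auto
    then obtain r where "r \<in> carrier R" "\<one> = u \<otimes> r"
      unfolding mem_PIdl_iff[OF u(1)] by auto
    then show "u \<in> Units R" using u(1) m_comm unfolding Units_def by auto
  qed
qed

lemma (in cring) Idl_pair:
  assumes x: "x \<in> carrier R" and y: "y \<in> carrier R"
  shows "Idl {x, y} = {x \<otimes> a \<oplus> y \<otimes> b | a b. a \<in> carrier R \<and> b \<in> carrier R}"
proof
  have eq: "{x \<otimes> a \<oplus> y \<otimes> b | a b. a \<in> carrier R \<and> b \<in> carrier R} = adjoin (PIdl x) y"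
    unfolding adjoin_def mem_PIdl_iff[OF x] by auto
  have xI: "ideal (PIdl x) R" using cgenideal_ideal x .
  have xm: "x \<in> adjoin (PIdl x) y"
    using subset_adjoin[OF xI y] cgenideal_self[OF x] by auto
  have ym: "y \<in> adjoin (PIdl x) y" 
    using mult_mem_adjoin[OF xI y one_closed] y by simp
  show "Idl {x, y} \<subseteq> {x \<otimes> a \<oplus> y \<otimes> b | a b. a \<in> carrier R \<and> b \<in> carrier R}"
    unfolding eq by (rule genideal_minimal) (use adjoin_ideal[OF xI y] xm ym in auto)
  interpret I: ideal "Idl {x, y}" R using genideal_ideal x y by simp
  have "x \<in> Idl {x, y}" "y \<in> Idl {x, y}" using genideal_self[of "{x, y}"] x y by auto
  then have "x \<otimes> a \<oplus> y \<otimes> b \<in> Idl {x, y}" if "a \<in> carrier R" "b \<in> carrier R" for a b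
    using that by (intro I.a_closed I.I_r_closed)
  then show "{x \<otimes> a \<oplus> y \<otimes> b | a b. a \<in> carrier R \<and> b \<in> carrier R} \<subseteq> Idl {x, y}"
    by (auto simp only:)
qed

text \<open>If every chain had length at most 1, so would the supremum. A longer chain is cut down
  to its first three members.\<close>

lemma krull_dim_two_chain:
  assumes "krull_dim R = 2"
  obtains P0 P1 P2 where "primeideal P0 R" "primeideal P1 R" "primeideal P2 R" "P0 \<subset> P1" "P1 \<subset> P2"
proof -
  let ?A = "{Ps. Ps \<noteq> [] \<and> (\<forall>P \<in> set Ps. primeideal P R) \<and> sorted_wrt (\<subset>) Ps}"
  have "\<exists>Ps\<in>?A. 2 \<le> length Ps - 1"
  proof (rule ccontr)
    assume neg: "\<not> ?thesis"
    have "enat (length Ps - 1) \<le> 1" if Ps: "Ps \<in> ?A" for Ps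
    proof (rule ccontr)
      assume "\<not> enat (length Ps - 1) \<le> 1"
      then have "2 \<le> length Ps - 1" by (simp add: one_enat_def)
      then show False using neg Ps by (simp only: bex_simps) blast
    qed
    then have "krull_dim R \<le> 1" unfolding krull_dim_def by (rule SUP_least)
    then show False using assms by simp
  qed
  then obtain Ps where Ps: "Ps \<in> ?A" "2 \<le> length Ps - 1" by auto
  then show ?thesis
    using that[of "Ps ! 0" "Ps ! 1" "Ps ! 2"] sorted_wrt_nth_less[of "(\<subset>)" Ps 0 1]
      sorted_wrt_nth_less[of "(\<subset>)" Ps 1 2] by auto
qed

lemma regular_local_ring_parameters:
  fixes R (structure)
  assumes "regular_local_ring R \<mm>" "krull_dim R = 2"
  obtains x y where "regular_parameters R \<mm> x y" "regular_parameters R \<mm> y x"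
proof -
  interpret regular_local_ring R \<mm> by fact
  note loc = noetherian_local_if_unique_maximalideal[OF noetherian_local_ring_axioms]
  interpret noetherian_local R \<mm> by (rule loc(1))
  obtain S where S: "S \<subseteq> carrier R" "card S = 2" "\<mm> = Idl S"
    using regular assms(2) by (auto simp: numeral_eq_enat)
  obtain x y where xy: "S = {x, y}" using S(2) unfolding card_2_iff by auto
  interpret two_generated_local R \<mm> x y
    by unfold_locales (use S xy Idl_pair[of x y] in auto)
  obtain P0 P1 P2 where P: "primeideal P0 R" "primeideal P1 R" "primeideal P2 R" "P0 \<subset> P1" "P1 \<subset> P2"
    using krull_dim_two_chain[OF assms(2)] .
  interpret P2: primeideal P2 R by fact
  have "P2 \<subseteq> \<mm>" using loc(2)[OF P2.is_ideal] P2.I_notcarr P2.one_imp_carrier by auto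
  then have "P1 \<subset> \<mm>" using P by auto
  then show ?thesis using that regular_parametersI[OF P(1,2,4)] by auto
qed

section \<open>Degree and division\<close>

context regular_parameters
begin

lemma x_ideal: "ideal (PIdl x) R"
  by (rule cgenideal_ideal) simp

text \<open>\<open>has_deg f n\<close>: the residue of \<open>f\<close> in the discrete valuation ring \<open>R / (x)\<close> has value \<open>n\<close>.\<close>
definition has_deg :: "'a \<Rightarrow> nat \<Rightarrow> bool"
  where "has_deg f n \<longleftrightarrow> (\<exists>u\<in>Units R. \<exists>g\<in>carrier R. f = u \<otimes> y [^] n \<oplus> x \<otimes> g)"

lemma has_degI: "\<lbrakk>u \<in> Units R; g \<in> carrier R; f = u \<otimes> y [^] n \<oplus> x \<otimes> g\<rbrakk> \<Longrightarrow> has_deg f n"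
  unfolding has_deg_def by blast

lemma has_degE:
  assumes "has_deg f n"
  obtains u g where "u \<in> Units R" "u \<in> carrier R" "g \<in> carrier R" "f = u \<otimes> y [^] n \<oplus> x \<otimes> g"
  using assms Units_closed unfolding has_deg_def by auto

lemma has_deg_carrier: "has_deg f n \<Longrightarrow> f \<in> carrier R"
  by (elim has_degE) simp

lemma multiple_or_has_deg:
  assumes "f \<in> carrier R"
  obtains (multiple) g where "g \<in> carrier R" "f = x \<otimes> g" | (deg) n where "has_deg f n"
proof (cases "f \<in> PIdl x")
  case True
  then show ?thesis using that(1) unfolding mem_PIdl_iff[OF x_carrier] by auto
next
  case False
  have xK: "x \<in> PIdl x" by (rule cgenideal_self) simp
  obtain u n \<kappa> where u: "u \<in> Units R" "\<kappa> \<in> PIdl x" "f = \<kappa> \<oplus> u \<otimes> y [^] (n::nat)"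
    by (rule mem_or_unit_times_power[OF x_ideal xK assms False])
  obtain g where g: "g \<in> carrier R" "\<kappa> = x \<otimes> g" using u(2) unfolding mem_PIdl_iff[OF x_carrier] by auto
  have "has_deg f n"
    by (rule has_degI[OF u(1) g(1)]) (use u g Units_closed[OF u(1)] in \<open>simp add: a_comm\<close>)
  then show ?thesis by (rule that(2))
qed

lemma has_deg_mult:
  assumes "has_deg f n" "has_deg g k"
  shows "has_deg (f \<otimes> g) (n + k)"
proof -
  obtain u a where u: "u \<in> Units R" "u \<in> carrier R" "a \<in> carrier R" "f = u \<otimes> y [^] n \<oplus> x \<otimes> a"
    using assms(1) by (rule has_degE)
  obtain v b where v: "v \<in> Units R" "v \<in> carrier R" "b \<in> carrier R" "g = v \<otimes> y [^] k \<oplus> x \<otimes> b"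
    using assms(2) by (rule has_degE)
  have gc: "g \<in> carrier R" using assms(2) by (rule has_deg_carrier)
  show ?thesis
  proof (rule has_degI)
    show "u \<otimes> v \<in> Units R" using u v by simp
    show "u \<otimes> y [^] n \<otimes> b \<oplus> a \<otimes> g \<in> carrier R" using u v by simp
    have "f \<otimes> g = u \<otimes> y [^] n \<otimes> g \<oplus> x \<otimes> (a \<otimes> g)"
      using u(2,3) gc unfolding u(4) by (simp add: l_distr m_assoc)
    also have "u \<otimes> y [^] n \<otimes> g = u \<otimes> v \<otimes> (y [^] n \<otimes> y [^] k) \<oplus> x \<otimes> (u \<otimes> y [^] n \<otimes> b)"
      using u(2,3) v(2,3) unfolding v(4) by (simp add: r_distr m_ac)
    also have "y [^] n \<otimes> y [^] k = y [^] (n + k)" by (simp add: nat_pow_mult)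
    finally show "f \<otimes> g = u \<otimes> v \<otimes> y [^] (n + k) \<oplus> x \<otimes> (u \<otimes> y [^] n \<otimes> b \<oplus> a \<otimes> g)"
      using u(2,3) v(2,3) gc by (simp add: r_distr a_assoc)
  qed
qed

lemma has_deg_unit: "u \<in> Units R \<Longrightarrow> has_deg u 0"
  by (rule has_degI[of u \<zero>]) (auto simp: Units_closed)

lemma has_deg_y_pow: "has_deg (y [^] n) n"
  by (rule has_degI[of \<one> \<zero>]) auto

lemma has_deg_pow: "has_deg f n \<Longrightarrow> has_deg (f [^] (k::nat)) (n * k)"
proof (induction k)
  case 0
  then show ?case using has_deg_unit[of \<one>] by simp
next
  case (Suc k)
  then show ?case using has_deg_mult[OF Suc.IH Suc.prems] Suc.prems by (simp add: add.commute)
qed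

lemma has_deg_add_x:
  assumes "has_deg f n" "r \<in> carrier R"
  shows "has_deg (f \<oplus> x \<otimes> r) n"
proof -
  obtain u g where u: "u \<in> Units R" "u \<in> carrier R" "g \<in> carrier R" "f = u \<otimes> y [^] n \<oplus> x \<otimes> g"
    using assms(1) by (rule has_degE)
  show ?thesis
    by (rule has_degI[OF u(1), of "g \<oplus> r"]) (use u(2-4) assms(2) in \<open>simp_all add: r_distr a_assoc\<close>)
qed

lemma unit_notin_max:
  assumes "u \<in> Units R"
  shows "u \<notin> \<mm>"
proof
  interpret m: ideal \<mm> R by (rule max_ideal)
  assume "u \<in> \<mm>"
  then have "inv u \<otimes> u \<in> \<mm>" by (rule m.I_l_closed) (rule Units_inv_closed[OF assms])
  then show False using one_notin_max assms(1) by simp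
qed

lemma unit_add_max:
  assumes "u \<in> Units R" "a \<in> \<mm>"
  shows "u \<oplus> a \<in> Units R"
proof (rule unitI)
  interpret m: ideal \<mm> R by (rule max_ideal)
  have c: "u \<in> carrier R" "a \<in> carrier R" using assms max_carrier Units_closed by auto
  show "u \<oplus> a \<in> carrier R" using c by simp
  show "u \<oplus> a \<notin> \<mm>"
  proof
    assume "u \<oplus> a \<in> \<mm>"
    then have "(u \<oplus> a) \<ominus> a \<in> \<mm>" using assms(2) by (simp add: a_minus_def)
    then have "u \<in> \<mm>" using add_diff_cancel_right[OF c] by simp
    then show False using unit_notin_max assms(1) by simp
  qed
qed

lemma y_pow_notin: "y [^] (n::nat) \<notin> PIdl x"
  using primeideal.pow_mem_imp_mem[OF prime_x y_carrier] y_notin by auto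

text \<open>Membership in the ideal \<open>(x, y^k)\<close> does not refer to a representation of
  \<open>f\<close>, so this makes the degree unique. For \<open>k > n\<close>, primality of
  \<open>(x)\<close> would cancel \<open>y [^] n\<close> and leave a unit in
  \<open>(x)\<close>.\<close>

lemma has_deg_mem_adjoin_iff:
  assumes "has_deg f n"
  shows "f \<in> adjoin (PIdl x) (y [^] k) \<longleftrightarrow> k \<le> n"
proof
  interpret px: primeideal "PIdl x" R by (rule prime_x)
  interpret m: ideal \<mm> R by (rule max_ideal)
  obtain u g where u: "u \<in> Units R" "u \<in> carrier R" "g \<in> carrier R" "f = u \<otimes> y [^] n \<oplus> x \<otimes> g"
    using assms by (rule has_degE)
  have xg: "x \<otimes> g \<in> PIdl x" using u(3) unfolding mem_PIdl_iff[OF x_carrier] by auto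
  { assume "k \<le> n"
    then obtain j where j: "n = k + j" using le_Suc_ex by blast
    have "f = x \<otimes> g \<oplus> y [^] k \<otimes> (u \<otimes> y [^] j)"
      unfolding u(4) j using u(2,3) by (simp add: nat_pow_mult[symmetric] m_ac a_comm)
    moreover have "u \<otimes> y [^] j \<in> carrier R" using u by simp
    ultimately show "f \<in> adjoin (PIdl x) (y [^] k)" unfolding mem_adjoin_iff using xg by blast }
  { assume "f \<in> adjoin (PIdl x) (y [^] k)"
    then obtain h r where h: "h \<in> PIdl x" "r \<in> carrier R" "f = h \<oplus> y [^] k \<otimes> r"
      unfolding mem_adjoin_iff by auto
    show "k \<le> n"
    proof (rule ccontr)
      assume "\<not> k \<le> n"
      then obtain j where j: "k = n + Suc j" by (metis less_iff_Suc_add add_Suc_right not_le)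
      have hc: "h \<in> carrier R" using h(1) px.Icarr by simp
      have ab: "u \<otimes> y [^] n \<in> carrier R" "y [^] k \<otimes> r \<in> carrier R" "x \<otimes> g \<in> carrier R"
        using u h by auto
      define t where "t = \<ominus> (y [^] Suc j \<otimes> r)"
      have t: "t \<in> carrier R" using h unfolding t_def by simp
      have "y [^] n \<otimes> (u \<oplus> t) = u \<otimes> y [^] n \<ominus> y [^] k \<otimes> r"
        unfolding t_def j using u(2) h(2)
        by (simp add: nat_pow_mult[symmetric] r_distr r_minus a_minus_def m_ac del: nat_pow_Suc)
      also have "u \<otimes> y [^] n = f \<ominus> x \<otimes> g" unfolding u(4) using add_diff_cancel_right ab by simp
      also have "y [^] k \<otimes> r = f \<ominus> h" unfolding h(3) using add_diff_cancel_left[OF hc ab(2)] by simp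
      also have "(f \<ominus> x \<otimes> g) \<ominus> (f \<ominus> h) = h \<ominus> x \<otimes> g"
      proof -
        have fc: "f \<in> carrier R" using has_deg_carrier assms .
        have "(f \<ominus> x \<otimes> g) \<ominus> (f \<ominus> h) = (f \<oplus> (h \<ominus> x \<otimes> g)) \<ominus> f"
          using fc hc ab by (simp add: a_minus_def minus_add a_ac)
        then show ?thesis using add_diff_cancel_left[of f "h \<ominus> x \<otimes> g"] fc hc ab by simp
      qed
      finally have eq: "y [^] n \<otimes> (u \<oplus> t) = h \<ominus> x \<otimes> g" .
      have "h \<ominus> x \<otimes> g \<in> PIdl x" using h(1) xg unfolding a_minus_def by simp
      then have "y [^] n \<otimes> (u \<oplus> t) \<in> PIdl x" unfolding eq .
      then have "u \<oplus> t \<in> PIdl x"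
        using px.I_prime[of "y [^] n" "u \<oplus> t"] y_pow_notin[of n] u(2) t by auto
      then obtain w where w: "w \<in> carrier R" "u \<oplus> t = x \<otimes> w"
        unfolding mem_PIdl_iff[OF x_carrier] by auto
      have "u \<oplus> t \<in> \<mm>" unfolding w(2) using x_max w m.I_r_closed by simp
      moreover have "y [^] Suc j \<otimes> r = y \<otimes> (y [^] j \<otimes> r)" using h by (simp add: m_ac)
      then have "t \<in> \<mm>" unfolding t_def using y_max h m.I_r_closed by simp
      then have "u \<oplus> t \<in> Units R" using unit_add_max u(1) by simp
      ultimately show False using unit_notin_max by simp
    qed }
qed

lemma has_deg_unique: "\<lbrakk>has_deg f n; has_deg f k\<rbrakk> \<Longrightarrow> n = k"
  using has_deg_mem_adjoin_iff[of f n n] has_deg_mem_adjoin_iff[of f n k]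
    has_deg_mem_adjoin_iff[of f k n] has_deg_mem_adjoin_iff[of f k k] by auto

lemma has_deg_zero_unit:
  assumes "has_deg f 0"
  shows "f \<in> Units R"
proof -
  interpret m: ideal \<mm> R by (rule max_ideal)
  obtain u g where u: "u \<in> Units R" "u \<in> carrier R" "g \<in> carrier R" "f = u \<otimes> y [^] (0::nat) \<oplus> x \<otimes> g"
    using assms by (rule has_degE)
  then show ?thesis using unit_add_max[of u "x \<otimes> g"] x_max m.I_r_closed by simp
qed

lemma has_deg_not_multiple:
  assumes "has_deg f n" "g \<in> carrier R"
  shows "f \<noteq> x \<otimes> g"
proof
  assume f: "f = x \<otimes> g"
  have "f \<in> PIdl x" unfolding f mem_PIdl_iff[OF x_carrier] using assms by auto
  then have "f \<in> adjoin (PIdl x) (y [^] Suc n)" using subset_adjoin[OF x_ideal, of "y [^] Suc n"] by auto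
  then show False using has_deg_mem_adjoin_iff[OF assms(1), of "Suc n"] by simp
qed

lemma has_deg_factor:
  assumes q: "q \<in> carrier R" and \<phi>: "has_deg \<phi> d" and r: "r \<in> carrier R"
    and \<psi>: "has_deg (q \<otimes> \<phi> \<oplus> x \<otimes> r) e"
  obtains k where "has_deg q k" "e = k + d"
  using q
proof (cases rule: multiple_or_has_deg)
  case (multiple g)
  have "q \<otimes> \<phi> \<oplus> x \<otimes> r = x \<otimes> (g \<otimes> \<phi> \<oplus> r)"
    using multiple r has_deg_carrier[OF \<phi>] by (simp add: r_distr m_assoc)
  then show ?thesis
    using has_deg_not_multiple[OF \<psi>, of "g \<otimes> \<phi> \<oplus> r"] multiple(1) r has_deg_carrier[OF \<phi>] by simp
next
  case (deg k)
  have "has_deg (q \<otimes> \<phi> \<oplus> x \<otimes> r) (k + d)"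
    by (intro has_deg_add_x has_deg_mult deg \<phi> r)
  then show ?thesis using that[OF deg] has_deg_unique[OF \<psi>] by simp
qed

text \<open>The degree is an order of vanishing modulo \<open>x\<close>; in contrast to polynomials,
  the smaller degree survives in a sum.\<close>

lemma has_deg_add_lower:
  assumes q: "q \<in> carrier R" and \<phi>: "has_deg \<phi> d" and r: "has_deg r e" and ed: "e < d"
  shows "has_deg (q \<otimes> \<phi> \<oplus> r) e"
proof -
  interpret m: ideal \<mm> R by (rule max_ideal)
  obtain j where j: "d = e + Suc j" using ed by (metis less_iff_Suc_add add_Suc_right)
  obtain u g where u: "u \<in> Units R" "u \<in> carrier R" "g \<in> carrier R" "r = u \<otimes> y [^] e \<oplus> x \<otimes> g"
    using r by (rule has_degE)
  obtain v h where v: "v \<in> Units R" "v \<in> carrier R" "h \<in> carrier R" "\<phi> = v \<otimes> y [^] d \<oplus> x \<otimes> h"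
    using \<phi> by (rule has_degE)
  let ?a = "q \<otimes> v \<otimes> y [^] Suc j"
  have "?a = y \<otimes> (q \<otimes> v \<otimes> y [^] j)" using q v by (simp add: m_ac)
  then have "?a \<in> \<mm>" using y_max q v m.I_r_closed by simp
  then have w: "u \<oplus> ?a \<in> Units R" using unit_add_max u by blast
  show ?thesis
  proof (rule has_degI[OF w])
    show "g \<oplus> q \<otimes> h \<in> carrier R" using u v q by simp
    have "q \<otimes> \<phi> = ?a \<otimes> y [^] e \<oplus> x \<otimes> (q \<otimes> h)"
      unfolding v(4) j using q v(2,3) by (simp add: nat_pow_mult[symmetric] r_distr m_ac del: nat_pow_Suc)
    then show "q \<otimes> \<phi> \<oplus> r = (u \<oplus> ?a) \<otimes> y [^] e \<oplus> x \<otimes> (g \<oplus> q \<otimes> h)"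
      unfolding u(4) using q u(2,3) v(2,3) by (simp add: l_distr r_distr a_ac del: nat_pow_Suc)
  qed
qed

text \<open>Successive approximation without a limit: while \<open>P\<close> fails, one more factor
  \<open>x\<close> is pulled out of the error modulo \<open>I\<close>. If this never stops,
  \<open>f\<close> lies in \<open>adjoin I (x [^] N)\<close> for every \<open>N\<close>, hence in
  \<open>I\<close>.\<close>

lemma strip_powers_of_x:
  assumes I: "ideal I R" and f: "f \<in> carrier R"
    and step: "\<And>g. g \<in> carrier R \<Longrightarrow> \<not> P g \<Longrightarrow> g \<in> adjoin I x"
  shows "f \<in> I \<or> (\<exists>i\<in>I. \<exists>N::nat. \<exists>g\<in>carrier R. P g \<and> f = i \<oplus> x [^] N \<otimes> g)"
proof (rule disjCI, rule krull_intersection[OF I x_max])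
  interpret I: ideal I R by fact
  assume neg: "\<not> (\<exists>i\<in>I. \<exists>N::nat. \<exists>g\<in>carrier R. P g \<and> f = i \<oplus> x [^] N \<otimes> g)"
  fix N :: nat
  show "f \<in> adjoin I (x [^] N)"
  proof (induction N)
    case 0
    show ?case using mult_mem_adjoin[OF I, of \<one> f] f by simp
  next
    case (Suc N)
    then obtain i g where i: "i \<in> I" "g \<in> carrier R" "f = i \<oplus> x [^] N \<otimes> g"
      unfolding mem_adjoin_iff by auto
    then have "\<not> P g" using neg by auto
    then have "g \<in> adjoin I x" using step i by auto
    then obtain j h where j: "j \<in> I" "h \<in> carrier R" "g = j \<oplus> x \<otimes> h"
      unfolding mem_adjoin_iff by auto
    have c: "i \<in> carrier R" "j \<in> carrier R" using i j I.Icarr by auto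
    have "f = (i \<oplus> x [^] N \<otimes> j) \<oplus> x [^] Suc N \<otimes> h"
      unfolding i(3) j(3) using c j(2) by (simp add: r_distr m_assoc a_assoc)
    moreover have "i \<oplus> x [^] N \<otimes> j \<in> I" using i j I.I_l_closed I.a_closed by simp
    ultimately show ?case unfolding mem_adjoin_iff using j(2) by auto
  qed
qed

lemma nonzero_eq_x_pow_times:
  assumes "f \<in> carrier R" "f \<noteq> \<zero>"
  obtains k g n where "f = x [^] (k::nat) \<otimes> g" "has_deg g n"
proof -
  have "f \<in> {\<zero>} \<or> (\<exists>i\<in>{\<zero>}. \<exists>N::nat. \<exists>g\<in>carrier R. (\<exists>n. has_deg g n) \<and> f = i \<oplus> x [^] N \<otimes> g)"
  proof (rule strip_powers_of_x[OF zeroideal assms(1)])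
    fix g assume g: "g \<in> carrier R" "\<nexists>n. has_deg g n"
    show "g \<in> adjoin {\<zero>} x"
      using g(1)
    proof (cases rule: multiple_or_has_deg)
      case (multiple h)
      then show ?thesis using mult_mem_adjoin[OF zeroideal x_carrier, of h] by simp
    qed (use g in simp)
  qed
  then obtain N :: nat and g n where "g \<in> carrier R" "has_deg g n" "f = \<zero> \<oplus> x [^] N \<otimes> g"
    using assms(2) by auto
  then show ?thesis using that[of N g n] by simp
qed

text \<open>The remainders of division by an element of degree \<open>d\<close>; they are not closed under addition.\<close>
definition remainder :: "nat \<Rightarrow> 'a \<Rightarrow> bool"
  where "remainder d c \<longleftrightarrow> c = \<zero> \<or> (\<exists>N::nat. \<exists>r e. c = x [^] N \<otimes> r \<and> has_deg r e \<and> e < d)"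

lemma remainder_carrier: "remainder d c \<Longrightarrow> c \<in> carrier R"
  unfolding remainder_def using has_deg_carrier by auto

text \<open>The approximation scheme is run with \<open>P\<close> saying that the degree is less
  than \<open>d\<close>. An element that fails is either divisible by \<open>x\<close> or has degree
  at least \<open>d\<close>, in which case a multiple of \<open>\<phi>\<close> removes its residue
  modulo \<open>x\<close>.\<close>

lemma division:
  assumes \<phi>: "has_deg \<phi> d" and f: "f \<in> carrier R"
  obtains q c where "q \<in> carrier R" "remainder d c" "f = q \<otimes> \<phi> \<oplus> c"
proof -
  have \<phi>c: "\<phi> \<in> carrier R" using has_deg_carrier \<phi> .
  obtain v h where v: "v \<in> Units R" "v \<in> carrier R" "h \<in> carrier R" "\<phi> = v \<otimes> y [^] d \<oplus> x \<otimes> h"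
    using \<phi> by (rule has_degE)
  have I: "ideal (PIdl \<phi>) R" using cgenideal_ideal \<phi>c .
  have "f \<in> PIdl \<phi> \<or> (\<exists>i\<in>PIdl \<phi>. \<exists>N::nat. \<exists>g\<in>carrier R. (\<exists>e<d. has_deg g e) \<and> f = i \<oplus> x [^] N \<otimes> g)"
  proof (rule strip_powers_of_x[OF I f])
    fix g assume g: "g \<in> carrier R" "\<not> (\<exists>e<d. has_deg g e)"
    show "g \<in> adjoin (PIdl \<phi>) x"
      using g(1)
    proof (cases rule: multiple_or_has_deg)
      case (multiple h)
      then show ?thesis using mult_mem_adjoin[OF I x_carrier, of h] by simp
    next
      case (deg e)
      then have "d \<le> e" using g(2) by (meson not_le)
      then obtain j where j: "e = d + j" using le_Suc_ex by blast
      obtain u a where u: "u \<in> Units R" "u \<in> carrier R" "a \<in> carrier R" "g = u \<otimes> y [^] e \<oplus> x \<otimes> a"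
        using deg by (rule has_degE)
      \<comment> \<open>Chosen so that \<open>w \<otimes> \<phi>\<close> and \<open>g\<close> have
        the same residue modulo \<open>x\<close>.\<close>
      define w where "w = u \<otimes> y [^] j \<otimes> inv v"
      have w: "w \<in> carrier R" using u v unfolding w_def by simp
      have wh: "w \<otimes> h \<in> carrier R" "x \<otimes> a \<in> carrier R" "x \<otimes> (w \<otimes> h) \<in> carrier R"
        "u \<otimes> y [^] e \<in> carrier R" using w v u by auto
      have wv: "w \<otimes> v = u \<otimes> y [^] j" using u v unfolding w_def by (simp add: m_assoc)
      have "w \<otimes> \<phi> = (w \<otimes> v) \<otimes> y [^] d \<oplus> x \<otimes> (w \<otimes> h)"
        unfolding v(4) using w v(2,3) by (simp add: r_distr m_ac)
      also have "(w \<otimes> v) \<otimes> y [^] d = u \<otimes> y [^] e"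
        unfolding wv j using u by (simp add: nat_pow_mult[symmetric] m_ac)
      finally have "w \<otimes> \<phi> \<oplus> x \<otimes> (a \<ominus> w \<otimes> h) = (u \<otimes> y [^] e \<oplus> x \<otimes> (w \<otimes> h)) \<oplus> (x \<otimes> a \<ominus> x \<otimes> (w \<otimes> h))"
        using r_diff_distr[OF x_carrier u(3) wh(1)] by simp
      also have "\<dots> = u \<otimes> y [^] e \<oplus> ((x \<otimes> a \<ominus> x \<otimes> (w \<otimes> h)) \<oplus> x \<otimes> (w \<otimes> h))"
        using wh by (simp add: a_ac)
      also have "\<dots> = g" unfolding u(4) using diff_add_cancel[OF wh(2,3)] by simp
      finally have "g = w \<otimes> \<phi> \<oplus> x \<otimes> (a \<ominus> w \<otimes> h)" ..
      moreover have "w \<otimes> \<phi> \<in> PIdl \<phi>" using w unfolding cgenideal_def by auto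
      moreover have "a \<ominus> w \<otimes> h \<in> carrier R" using u wh by simp
      ultimately show ?thesis unfolding mem_adjoin_iff by blast
    qed
  qed
  then show ?thesis
  proof (elim disjE bexE exE conjE)
    assume "f \<in> PIdl \<phi>"
    then obtain q where "q \<in> carrier R" "f = q \<otimes> \<phi>" unfolding cgenideal_def by auto
    then show ?thesis using that[of q \<zero>] \<phi>c by (simp add: remainder_def)
  next
    fix i N g e
    assume *: "i \<in> PIdl \<phi>" "g \<in> carrier R" "f = i \<oplus> x [^] (N::nat) \<otimes> g" "e < d" "has_deg g e"
    then obtain q where "q \<in> carrier R" "i = q \<otimes> \<phi>" unfolding cgenideal_def by auto
    then show ?thesis using that[of q "x [^] N \<otimes> g"] * unfolding remainder_def by auto
  qed
qed

end

section \<open>The multiplicity valuation\<close>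

context regular_parameters
begin

definition max_pow :: "nat \<Rightarrow> 'a set"
  where "max_pow n = \<mm> [^]\<^bsub>ideals_set R\<^esub> n"

lemma max_pow_0: "max_pow 0 = carrier R"
  by (simp add: max_pow_def nat_pow_def ideals_set_def)

lemma max_pow_Suc: "max_pow (Suc n) = max_pow n \<cdot> \<mm>"
  by (simp add: max_pow_def nat_pow_def ideals_set_def)

lemma max_pow_ideal: "ideal (max_pow n) R"
  by (induction n) (auto simp: max_pow_0 max_pow_Suc oneideal max_ideal intro: ideal_prod_is_ideal)

lemma max_pow_carrier: "f \<in> max_pow n \<Longrightarrow> f \<in> carrier R"
  by (rule ideal.Icarr[OF max_pow_ideal])

lemma max_pow_add:
  assumes "f \<in> max_pow n" "g \<in> carrier R"
  shows "f \<oplus> g \<in> max_pow n \<longleftrightarrow> g \<in> max_pow n"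
proof
  interpret M: ideal "max_pow n" R by (rule max_pow_ideal)
  show "f \<oplus> g \<in> max_pow n" if "g \<in> max_pow n" using that assms(1) by simp
  assume "f \<oplus> g \<in> max_pow n"
  then have "(f \<oplus> g) \<ominus> f \<in> max_pow n" using assms(1) unfolding a_minus_def by simp
  then show "g \<in> max_pow n" using add_diff_cancel_left[of f g] assms M.Icarr by simp
qed

lemma max_pow_Suc_subset: "max_pow (Suc n) \<subseteq> max_pow n"
  unfolding max_pow_Suc using ideal_prod_inter[OF max_pow_ideal max_ideal, of n] by simp

lemma max_pow_antimono: "k \<le> n \<Longrightarrow> max_pow n \<subseteq> max_pow k"
  by (rule lift_Suc_antimono_le[of max_pow]) (rule max_pow_Suc_subset)

lemma max_pow_1: "max_pow 1 = \<mm>"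
proof
  show "max_pow 1 \<subseteq> \<mm>"
    using ideal_prod_inter[OF oneideal max_ideal] by (simp add: max_pow_Suc max_pow_0)
  show "\<mm> \<subseteq> max_pow 1"
  proof
    fix f assume f: "f \<in> \<mm>"
    have "\<one> \<otimes> f \<in> max_pow 1"
      unfolding One_nat_def max_pow_Suc max_pow_0 by (rule ideal_prod.prod) (use f in auto)
    then show "f \<in> max_pow 1" using f max_carrier by simp
  qed
qed

lemma max_pow_mult:
  assumes "f \<in> max_pow n" "g \<in> max_pow k"
  shows "f \<otimes> g \<in> max_pow (n + k)"
proof -
  interpret I: comm_monoid "ideals_set R" by (rule ideals_set_is_comm_monoid)
  have "\<mm> \<in> carrier (ideals_set R)" using max_ideal by (simp add: ideals_set_def)
  then have "max_pow (n + k) = max_pow n \<otimes>\<^bsub>ideals_set R\<^esub> max_pow k"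
    unfolding max_pow_def by (simp add: I.nat_pow_mult)
  then show ?thesis using assms ideal_prod.prod by (simp add: ideals_set_def)
qed

lemma x_y_max_pow: "x \<in> max_pow 1" "y \<in> max_pow 1"
  using x_max y_max max_pow_1 by auto

lemma y_pow_max_pow: "y [^] n \<in> max_pow n"
proof (induction n)
  case (Suc n)
  then show ?case using max_pow_mult[OF Suc x_y_max_pow(2)] by simp
qed (simp add: max_pow_0)

text \<open>This recursion separates the part of a power of \<open>\<mm>\<close> that is visible
  modulo \<open>x\<close> from \<open>x\<close> times the preceding power. Later arguments on orders
  use it in place of the monomial generators.\<close>

lemma mem_max_pow_Suc_iff:
  "f \<in> max_pow (Suc n) \<longleftrightarrow> (\<exists>a\<in>carrier R. \<exists>g\<in>max_pow n. f = y [^] Suc n \<otimes> a \<oplus> x \<otimes> g)"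
proof
  interpret M: ideal "max_pow (Suc n)" R by (rule max_pow_ideal)
  assume "\<exists>a\<in>carrier R. \<exists>g\<in>max_pow n. f = y [^] Suc n \<otimes> a \<oplus> x \<otimes> g"
  then obtain a g where *: "a \<in> carrier R" "g \<in> max_pow n" "f = y [^] Suc n \<otimes> a \<oplus> x \<otimes> g" by auto
  have "x \<otimes> g \<in> max_pow (Suc n)" using max_pow_mult[OF x_y_max_pow(1) *(2)] by simp
  then show "f \<in> max_pow (Suc n)"
    unfolding *(3) using M.I_r_closed[OF y_pow_max_pow *(1)] M.a_closed by simp
next
  assume "f \<in> max_pow (Suc n)"
  then show "\<exists>a\<in>carrier R. \<exists>g\<in>max_pow n. f = y [^] Suc n \<otimes> a \<oplus> x \<otimes> g"
  proof (induction n arbitrary: f)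
    case 0
    then obtain a b where "a \<in> carrier R" "b \<in> carrier R" "f = x \<otimes> a \<oplus> y \<otimes> b"
      using max_pow_1 max_memE by (metis One_nat_def)
    then show ?case by (intro bexI[of _ b] bexI[of _ a]) (auto simp: max_pow_0 a_comm)
  next
    case (Suc n)
    interpret M: ideal "max_pow (Suc n)" R by (rule max_pow_ideal)
    from Suc.prems have "f \<in> max_pow (Suc n) \<cdot> \<mm>" unfolding max_pow_Suc[of "Suc n"] .
    then show ?case
    proof (induction rule: ideal_prod.induct)
      case (prod i j)
      obtain a g where a: "a \<in> carrier R" "g \<in> max_pow n" "i = y [^] Suc n \<otimes> a \<oplus> x \<otimes> g"
        using Suc.IH[OF prod(1)] by auto
      obtain p q where p: "p \<in> carrier R" "q \<in> carrier R" "j = x \<otimes> p \<oplus> y \<otimes> q"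
        using prod(2) by (rule max_memE)
      have c: "i \<in> carrier R" "g \<in> carrier R" using prod(1) a(2) max_pow_carrier by auto
      have "i \<otimes> j = i \<otimes> (y \<otimes> q) \<oplus> x \<otimes> (i \<otimes> p)"
        unfolding p(3) using c p(1,2) by (simp add: r_distr m_ac a_comm)
      also have "i \<otimes> (y \<otimes> q) = y [^] Suc (Suc n) \<otimes> (a \<otimes> q) \<oplus> x \<otimes> (g \<otimes> y \<otimes> q)"
        unfolding a(3) using c(2) a(1) p(1,2) by (simp add: l_distr r_distr m_ac)
      finally have eq: "i \<otimes> j = y [^] Suc (Suc n) \<otimes> (a \<otimes> q) \<oplus> x \<otimes> (g \<otimes> y \<otimes> q \<oplus> i \<otimes> p)"
        using a(1) c p(1,2) by (simp add: r_distr a_assoc del: nat_pow_Suc)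
      have "g \<otimes> y \<in> max_pow (Suc n)" using max_pow_mult[OF a(2) x_y_max_pow(2)] by simp
      then have "g \<otimes> y \<otimes> q \<oplus> i \<otimes> p \<in> max_pow (Suc n)"
        using prod(1) p M.I_r_closed M.a_closed by simp
      then show ?case using eq a(1) p(2) m_closed by blast
    next
      case (sum s t)
      obtain a g where a: "a \<in> carrier R" "g \<in> max_pow (Suc n)" "s = y [^] Suc (Suc n) \<otimes> a \<oplus> x \<otimes> g"
        using sum.IH(1) by auto
      obtain b h where b: "b \<in> carrier R" "h \<in> max_pow (Suc n)" "t = y [^] Suc (Suc n) \<otimes> b \<oplus> x \<otimes> h"
        using sum.IH(2) by auto
      have c: "g \<in> carrier R" "h \<in> carrier R" using a b M.Icarr by auto
      have "s \<oplus> t = y [^] Suc (Suc n) \<otimes> (a \<oplus> b) \<oplus> x \<otimes> (g \<oplus> h)"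
        unfolding a(3) b(3) using a(1) b(1) c by (simp add: r_distr a_ac del: nat_pow_Suc)
      then show ?case using a b M.a_closed a_closed by blast
    qed
  qed
qed

lemma has_deg_max_pow_le:
  assumes "has_deg f k" "f \<in> max_pow n"
  shows "n \<le> k"
proof (cases n)
  case (Suc n')
  then obtain a g where *: "a \<in> carrier R" "g \<in> max_pow n'" "f = y [^] n \<otimes> a \<oplus> x \<otimes> g"
    using assms(2) mem_max_pow_Suc_iff by auto
  have gc: "g \<in> carrier R" using * max_pow_carrier by auto
  have "x \<otimes> g \<in> PIdl x" unfolding mem_PIdl_iff[OF x_carrier] using gc by auto
  moreover have "f = x \<otimes> g \<oplus> y [^] n \<otimes> a" using * gc by (simp add: a_comm)
  ultimately have "f \<in> adjoin (PIdl x) (y [^] n)" unfolding mem_adjoin_iff using *(1) by blast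
  then show ?thesis using has_deg_mem_adjoin_iff[OF assms(1)] by simp
qed simp

text \<open>The initial form of \<open>x\<close> is not a zero divisor in the associated graded
  ring: primality of \<open>(x)\<close> makes the coefficient of \<open>y [^] Suc n\<close>
  divisible by \<open>x\<close>, and then \<open>x\<close> cancels.\<close>

lemma x_mult_mem_max_pow_Suc_iff:
  assumes g: "g \<in> carrier R"
  shows "x \<otimes> g \<in> max_pow (Suc n) \<longleftrightarrow> g \<in> max_pow n"
proof
  assume "g \<in> max_pow n"
  then show "x \<otimes> g \<in> max_pow (Suc n)" using max_pow_mult[OF x_y_max_pow(1)] by fastforce
next
  interpret M: ideal "max_pow n" R by (rule max_pow_ideal)
  interpret px: primeideal "PIdl x" R by (rule prime_x)
  assume "x \<otimes> g \<in> max_pow (Suc n)"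
  then obtain a h where *: "a \<in> carrier R" "h \<in> max_pow n" "x \<otimes> g = y [^] Suc n \<otimes> a \<oplus> x \<otimes> h"
    unfolding mem_max_pow_Suc_iff by auto
  have hc: "h \<in> carrier R" using * M.Icarr by auto
  have "y [^] Suc n \<otimes> a = x \<otimes> g \<ominus> x \<otimes> h"
    unfolding *(3) using add_diff_cancel_right[of "y [^] Suc n \<otimes> a" "x \<otimes> h"] *(1) hc by simp
  also have "\<dots> = x \<otimes> (g \<ominus> h)" using r_diff_distr g hc by simp
  finally have "y [^] Suc n \<otimes> a \<in> PIdl x" unfolding mem_PIdl_iff[OF x_carrier] using g hc by auto
  then have "a \<in> PIdl x" using px.I_prime[of "y [^] Suc n" a] y_pow_notin[of "Suc n"] *(1) by auto
  then obtain b where b: "b \<in> carrier R" "a = x \<otimes> b" unfolding mem_PIdl_iff[OF x_carrier] by auto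
  have "x \<otimes> g = x \<otimes> (y [^] Suc n \<otimes> b \<oplus> h)"
    unfolding *(3) b(2) using b(1) hc by (simp add: r_distr m_ac)
  then have "g = y [^] Suc n \<otimes> b \<oplus> h"
    using m_lcancel[OF x_nonzero x_carrier g] b(1) hc by simp
  moreover have "y [^] Suc n \<in> max_pow n" using y_pow_max_pow max_pow_Suc_subset by blast
  ultimately show "g \<in> max_pow n" using *(2) b(1) M.I_r_closed M.a_closed by simp
qed

text \<open>In terms of initial forms: that of \<open>f\<close> either contains the
  \<open>a\<close>-th power of \<open>y\<close> or is divisible by \<open>x\<close>.\<close>

lemma order_cases:
  assumes f: "f \<in> max_pow a" "f \<notin> max_pow (Suc a)"
  obtains "has_deg f a"
  | a' c q where "a = Suc a'" "c \<in> max_pow (Suc a)" "q \<in> max_pow a'" "q \<notin> max_pow a" "f = c \<oplus> x \<otimes> q"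
proof -
  have fc: "f \<in> carrier R" using f max_pow_carrier by blast
  obtain c q where cq: "c = \<zero> \<or> (\<exists>k. has_deg c k \<and> c \<in> max_pow k)" "q \<in> carrier R" "f = c \<oplus> x \<otimes> q"
    using fc
  proof (cases rule: multiple_or_has_deg)
    case (multiple g)
    then show ?thesis using that[of \<zero> g] by simp
  next
    case (deg n)
    then obtain u g where u: "u \<in> Units R" "u \<in> carrier R" "g \<in> carrier R" "f = u \<otimes> y [^] n \<oplus> x \<otimes> g"
      by (rule has_degE)
    have "has_deg (u \<otimes> y [^] n) n" using has_deg_mult[OF has_deg_unit[OF u(1)] has_deg_y_pow] by simp
    moreover have "u \<otimes> y [^] n \<in> max_pow n"
      using ideal.I_l_closed[OF max_pow_ideal y_pow_max_pow u(2)] .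
    ultimately show ?thesis using that[of "u \<otimes> y [^] n" g] u by blast
  qed
  have cc: "c \<in> carrier R" using cq(1) has_deg_carrier by auto
  show ?thesis
  proof (cases "has_deg f a")
    case True then show ?thesis by (rule that(1))
  next
    case False
    have c: "c \<in> max_pow (Suc a)"
      using cq(1)
    proof (elim disjE exE conjE)
      assume "c = \<zero>"
      then show ?thesis using additive_subgroup.zero_closed ideal.axioms(1) max_pow_ideal by blast
    next
      fix k assume k: "has_deg c k" "c \<in> max_pow k"
      have "has_deg f k" unfolding cq(3) by (rule has_deg_add_x[OF k(1) cq(2)])
      then have "a \<le> k" "k \<noteq> a" using has_deg_max_pow_le f(1) False by auto
      then show ?thesis using k(2) max_pow_antimono[of "Suc a" k] by auto
    qed
    then have "c \<in> max_pow a" using max_pow_Suc_subset by blast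
    then have xq: "x \<otimes> q \<in> max_pow a" "x \<otimes> q \<notin> max_pow (Suc a)"
      using max_pow_add[of c a "x \<otimes> q"] max_pow_add[OF c, of "x \<otimes> q"] cq(2,3) f by auto
    obtain a' where a': "a = Suc a'"
    proof (cases a)
      case 0
      have "x \<otimes> q \<in> max_pow (Suc 0)"
        using x_mult_mem_max_pow_Suc_iff[OF cq(2), of 0] cq(2) max_pow_0 by simp
      then show ?thesis using xq(2) 0 by simp
    qed (use that in auto)
    show ?thesis
      by (rule that(2)[OF a' c _ _ cq(3)])
        (use xq a' x_mult_mem_max_pow_Suc_iff[OF cq(2)] in auto)
  qed
qed

text \<open>The associated graded ring has no zero divisors. Factors \<open>x\<close> of initial
  forms are stripped by induction; when neither form is divisible by \<open>x\<close>, the degrees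
  \<open>a\<close> and \<open>b\<close> add, and the degree bounds the order.\<close>

lemma order_mult:
  assumes "f \<in> max_pow a" "f \<notin> max_pow (Suc a)" "g \<in> max_pow b" "g \<notin> max_pow (Suc b)"
  shows "f \<otimes> g \<notin> max_pow (Suc (a + b))"
  using assms
proof (induction "a + b" arbitrary: a b f g rule: less_induct)
  case less
  \<comment> \<open>Stated for any pair of exponents with the same sum, so that it can be applied to
    either factor.\<close>
  have step: "p \<otimes> q \<notin> max_pow (Suc (i + j))"
    if "i + j = a + b" "p \<in> max_pow i" "p \<notin> max_pow (Suc i)" "q \<in> max_pow j" "q \<notin> max_pow (Suc j)"
      "i = Suc i'" "c \<in> max_pow (Suc i)" "r \<in> max_pow i'" "r \<notin> max_pow i" "p = c \<oplus> x \<otimes> r"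
    for p q i j i' c r
  proof
    have cc: "c \<in> carrier R" "r \<in> carrier R" "q \<in> carrier R" using that max_pow_carrier by blast+
    assume *: "p \<otimes> q \<in> max_pow (Suc (i + j))"
    have "p \<otimes> q = c \<otimes> q \<oplus> x \<otimes> (r \<otimes> q)" unfolding that(10) using cc by (simp add: l_distr m_assoc)
    moreover have "c \<otimes> q \<in> max_pow (Suc (i + j))" using max_pow_mult[OF that(7,4)] by simp
    ultimately have "x \<otimes> (r \<otimes> q) \<in> max_pow (Suc (i + j))"
      using * max_pow_add[of "c \<otimes> q" _ "x \<otimes> (r \<otimes> q)"] cc by simp
    then have "r \<otimes> q \<in> max_pow (Suc (i' + j))"
      using x_mult_mem_max_pow_Suc_iff[of "r \<otimes> q"] cc that(6) by simp
    moreover have "i' + j < a + b" using that(1,6) by simp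
    ultimately show False using less.hyps[of i' j r q] that by simp
  qed
  from less.prems(1,2) show ?case
  proof (cases rule: order_cases)
    case f: 1
    from less.prems(3,4) show ?thesis
    proof (cases rule: order_cases)
      case 1
      then show ?thesis using has_deg_max_pow_le[OF has_deg_mult[OF f 1], of "Suc (a + b)"] by auto
    next
      case (2 b' c q)
      have "g \<otimes> f \<notin> max_pow (Suc (b + a))"
        by (rule step[OF _ less.prems(3,4,1,2) 2]) simp
      moreover have "g \<otimes> f = f \<otimes> g" using less.prems max_pow_carrier m_comm by blast
      ultimately show ?thesis by (simp add: add.commute)
    qed
  next
    case (2 a' c q)
    show ?thesis by (rule step[OF refl less.prems 2])
  qed
qed

text \<open>Writing \<open>f\<close> as \<open>x [^] k \<otimes> g\<close> with \<open>g\<close> of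
  degree \<open>n\<close> bounds its order by \<open>k + n\<close>.\<close>

lemma order_exists:
  assumes f: "f \<in> carrier R" "f \<noteq> \<zero>"
  obtains a where "f \<in> max_pow a" "f \<notin> max_pow (Suc a)"
proof -
  obtain k g n where g: "f = x [^] (k::nat) \<otimes> g" "has_deg g n"
    using nonzero_eq_x_pow_times[OF f] .
  have gc: "g \<in> carrier R" using g(2) has_deg_carrier by auto
  have shift: "x [^] k \<otimes> g \<in> max_pow (k + j) \<longleftrightarrow> g \<in> max_pow j" for j
  proof (induction k)
    case (Suc k)
    have "x [^] Suc k \<otimes> g = x \<otimes> (x [^] k \<otimes> g)" using gc by (simp add: m_ac)
    then show ?case using Suc x_mult_mem_max_pow_Suc_iff[of "x [^] k \<otimes> g" "k + j"] gc by simp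
  qed (use gc in simp)
  then have notin: "f \<notin> max_pow (k + Suc n)"
    using has_deg_max_pow_le[OF g(2), of "Suc n"] shift[of "Suc n"] unfolding g(1) by auto
  define a where "a = (LEAST n. f \<notin> max_pow (Suc n))"
  have "f \<notin> max_pow (Suc (k + n))" using notin by simp
  then have 1: "f \<notin> max_pow (Suc a)" unfolding a_def by (rule LeastI)
  have "f \<in> max_pow a"
  proof (cases a)
    case 0
    then show ?thesis using f max_pow_0 by simp
  next
    case (Suc a')
    then have "a' < a" by simp
    then show ?thesis using not_less_Least[of a' "\<lambda>n. f \<notin> max_pow (Suc n)"] Suc
      unfolding a_def by auto
  qed
  then show ?thesis using 1 by (rule that)
qed

lemma multiplicity_valuation_eq:
  assumes "f \<in> max_pow a" "f \<notin> max_pow (Suc a)"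
  shows "multiplicity_valuation R \<mm> f = of_nat a"
proof -
  have "f \<noteq> \<zero>" using assms(2) additive_subgroup.zero_closed ideal.axioms(1) max_pow_ideal by metis
  moreover have "{i. f \<in> max_pow i} = {..a}"
  proof (rule Set.set_eqI)
    fix i
    have "\<not> Suc a \<le> i" if "f \<in> max_pow i" using that assms(2) max_pow_antimono[of "Suc a" i] by auto
    then show "i \<in> {i. f \<in> max_pow i} \<longleftrightarrow> i \<in> {..a}"
      using assms(1) max_pow_antimono[of i a] by auto
  qed
  moreover have "Max {..a} = a" by (rule Max_eqI) auto
  ultimately show ?thesis using assms(1) max_pow_carrier by (simp add: multiplicity_valuation_def max_pow_def[symmetric])
qed

lemma multiplicity_valuation_zero: "multiplicity_valuation R \<mm> \<zero> = \<infinity>"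
  by (simp add: multiplicity_valuation_def)

lemma le_multiplicity_valuation_iff:
  assumes "f \<in> carrier R"
  shows "of_nat n \<le> multiplicity_valuation R \<mm> f \<longleftrightarrow> f \<in> max_pow n"
proof (cases "f = \<zero>")
  case True
  then show ?thesis using multiplicity_valuation_zero
      additive_subgroup.zero_closed[OF ideal.axioms(1)[OF max_pow_ideal]] by simp
next
  case False
  obtain a where a: "f \<in> max_pow a" "f \<notin> max_pow (Suc a)"
    using order_exists[OF assms False] .
  have "f \<in> max_pow n \<longleftrightarrow> n \<le> a"
    using a max_pow_antimono[of n a] max_pow_antimono[of "Suc a" n] by (auto simp: not_less_eq_eq[symmetric])
  then show ?thesis using multiplicity_valuation_eq[OF a] by simp
qed

lemma multiplicity_valuation_cases:
  assumes "f \<in> carrier R"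
  obtains "f = \<zero>" "multiplicity_valuation R \<mm> f = \<infinity>"
  | a where "f \<in> max_pow a" "f \<notin> max_pow (Suc a)" "multiplicity_valuation R \<mm> f = of_nat a"
  using order_exists[OF assms] multiplicity_valuation_eq multiplicity_valuation_zero by metis

lemma centered_multiplicity_valuation: "centered_valuation R \<mm> (multiplicity_valuation R \<mm>)"
proof
  let ?v = "multiplicity_valuation R \<mm>"
  show "?v \<in> extensional (carrier R)" by (simp add: multiplicity_valuation_def)
  show "?v \<zero> = \<infinity>" by (rule multiplicity_valuation_zero)
  show "?v \<one> = 0"
    using multiplicity_valuation_eq[of \<one> 0] max_pow_1 max_pow_0 one_notin_max by simp
  show "0 < ?v f" if "f \<in> \<mm>" for f
  proof -
    have "of_nat 1 \<le> ?v f" using le_multiplicity_valuation_iff[of f 1] that max_pow_1 max_carrier by simp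
    then show ?thesis by (metis not_gr_zero not_one_le_zero of_nat_1)
  qed
  fix f g assume f: "f \<in> carrier R" and g: "g \<in> carrier R"
  show "min (?v f) (?v g) \<le> ?v (f \<oplus> g)"
  proof -
    have main: "min (of_nat a) (of_nat b) \<le> ?v (f \<oplus> g)" if "f \<in> max_pow a" "g \<in> max_pow b" for a b
    proof -
      have "f \<in> max_pow (min a b)" "g \<in> max_pow (min a b)"
        using that max_pow_antimono[of "min a b" a] max_pow_antimono[of "min a b" b] by auto
      then have "f \<oplus> g \<in> max_pow (min a b)" using max_pow_add g by simp
      then have "of_nat (min a b) \<le> ?v (f \<oplus> g)" using le_multiplicity_valuation_iff f g by simp
      then show ?thesis by (simp add: min_def split: if_splits)
    qed
    from f show ?thesis
    proof (cases rule: multiplicity_valuation_cases)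
      case 1 then show ?thesis using g by (simp add: min_def)
    next
      case fa: (2 a)
      from g show ?thesis
      proof (cases rule: multiplicity_valuation_cases)
        case 1 then show ?thesis using f by (simp add: min_def)
      next
        case (2 b) then show ?thesis using main fa by simp
      qed
    qed
  qed
  show "?v (f \<otimes> g) = ?v f + ?v g"
    using f
  proof (cases rule: multiplicity_valuation_cases)
    case 1 then show ?thesis using g by (simp add: multiplicity_valuation_zero)
  next
    case fa: (2 a)
    from g show ?thesis
    proof (cases rule: multiplicity_valuation_cases)
      case 1 then show ?thesis using f by (simp add: multiplicity_valuation_zero)
    next
      case (2 b)
      then show ?thesis
        using multiplicity_valuation_eq[OF max_pow_mult[OF fa(1) 2(1)] order_mult[OF fa(1,2) 2(1,2)]] fa
        by simp
    qed
  qed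
qed

end

text \<open>The Archimedean property that turns estimates truncated at multiples of \<open>a\<close>
  into genuine ones; \<open>a\<close> may be infinite, in which case one multiple is enough.\<close>

lemma ennreal_less_of_nat_mult:
  assumes "0 < (a::ennreal)" "b < \<infinity>"
  obtains n where "b < of_nat n * a"
proof -
  have "b / a < \<infinity>" using assms by (auto simp add: ennreal_divide_eq_top_iff less_top[symmetric])
  then obtain n where n: "b / a < of_nat n" using ennreal_Ex_less_of_nat by auto
  show ?thesis
  proof (cases "a = \<infinity>")
    case True
    then show ?thesis using that[of 1] assms by simp
  next
    case False
    then have "b < of_nat n * a"
      using n assms(1) divide_less_ennreal[of a b "of_nat n"] by (auto simp: less_top[symmetric])
    then show ?thesis by (rule that)
  qed
qed

section \<open>Valuations on a regular local ring\<close>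

context cring
begin

context
  fixes \<mm> \<nu>
  assumes v: "centered_valuation R \<mm> \<nu>"
begin

interpretation v: centered_valuation R \<mm> \<nu> by (rule v)

lemma val_unit:
  assumes "u \<in> Units R"
  shows "\<nu> u = 0"
proof -
  have "\<nu> u + \<nu> (inv u) = 0"
    using v.val_mult[of u "inv u"] assms v.val_one by (simp add: Units_closed)
  then show ?thesis by simp
qed

lemma val_uminus:
  assumes a: "a \<in> carrier R"
  shows "\<nu> (\<ominus> a) = \<nu> a"
proof -
  have "\<ominus> \<one> \<in> Units R" by (rule Units_minus_one_closed)
  then have "\<nu> (\<ominus> \<one>) = 0" by (rule val_unit)
  moreover have "\<ominus> a = \<ominus> \<one> \<otimes> a" using a by (simp add: l_minus)
  ultimately show ?thesis using v.val_mult[of "\<ominus> \<one>" a] a by simp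
qed

lemma val_diff:
  assumes "a \<in> carrier R" "b \<in> carrier R"
  shows "min (\<nu> a) (\<nu> b) \<le> \<nu> (a \<ominus> b)"
  unfolding a_minus_def using v.val_add[of a "\<ominus> b"] val_uminus[OF assms(2)] assms by simp

lemma val_pow:
  assumes a: "a \<in> carrier R"
  shows "\<nu> (a [^] (n::nat)) = of_nat n * \<nu> a"
proof (induction n)
  case 0
  then show ?case using v.val_one by simp
next
  case (Suc n)
  then show ?case using v.val_mult[of "a [^] n" a] a by (simp add: distrib_right add.commute)
qed

lemma val_add_eq_left:
  assumes a: "a \<in> carrier R" and b: "b \<in> carrier R" and less: "\<nu> a < \<nu> b"
  shows "\<nu> (a \<oplus> b) = \<nu> a"
proof (rule antisym)
  have "a = (a \<oplus> b) \<ominus> b" using add_diff_cancel_right a b by simp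
  then have "min (\<nu> (a \<oplus> b)) (\<nu> b) \<le> \<nu> a" using val_diff[of "a \<oplus> b" b] a b by simp
  then show "\<nu> (a \<oplus> b) \<le> \<nu> a" using less by (auto simp: min_le_iff_disj)
  show "\<nu> a \<le> \<nu> (a \<oplus> b)" using v.val_add[OF a b] min_absorb1[OF less_imp_le[OF less]] by simp
qed

lemma val_add_eq_right:
  assumes a: "a \<in> carrier R" and b: "b \<in> carrier R" and less: "\<nu> b < \<nu> a"
  shows "\<nu> (a \<oplus> b) = \<nu> b"
  using val_add_eq_left[OF b a less] a_comm[OF a b] by simp

lemma val_eq_if_less_add:
  assumes a: "a \<in> carrier R" and b: "b \<in> carrier R" and less: "min (\<nu> a) (\<nu> b) < \<nu> (a \<oplus> b)"
  shows "\<nu> a = \<nu> b"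
  using val_add_eq_left[OF a b] val_add_eq_right[OF a b] less by (cases "\<nu> a" "\<nu> b" rule: linorder_cases) auto

end

end

section \<open>Elements of minimal defect, in the role of key polynomials\<close>

context regular_parameters
begin

lemma remainder_cases:
  assumes "remainder d c"
  shows "(\<exists>e<d. has_deg c e) \<or> (\<exists>c'\<in>carrier R. c = x \<otimes> c')"
  using assms unfolding remainder_def
proof (elim disjE exE conjE)
  assume "c = \<zero>"
  then show ?thesis by (intro disjI2 bexI[of _ \<zero>]) auto
next
  fix N :: nat and r e
  assume *: "c = x [^] N \<otimes> r" "has_deg r e" "e < d"
  have rc: "r \<in> carrier R" using * has_deg_carrier by auto
  show ?thesis
  proof (cases N)
    case 0
    then show ?thesis using * rc by auto
  next
    case (Suc k)
    have "c = x \<otimes> (x [^] k \<otimes> r)" unfolding *(1) Suc using rc by (simp add: m_ac)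
    then show ?thesis using rc by auto
  qed
qed

text \<open>The two valuations determine \<open>d\<close> but not \<open>\<phi>\<close>. This
  freedom matters in \<open>vals_below_comparable\<close>, where one element serves two valuations
  with the same defect degree.\<close>

definition minimal_defect :: "('a \<Rightarrow> ennreal) \<Rightarrow> ('a \<Rightarrow> ennreal) \<Rightarrow> 'a \<Rightarrow> nat \<Rightarrow> bool"
  where "minimal_defect \<rho> \<tau> \<phi> d \<longleftrightarrow> has_deg \<phi> d \<and> \<rho> \<phi> < \<tau> \<phi> \<and>
    (\<forall>r e. has_deg r e \<longrightarrow> e < d \<longrightarrow> \<rho> r = \<tau> r)"

text \<open>Normalized valuations for which \<open>x\<close> has the minimal value.\<close>
definition vals :: "('a \<Rightarrow> ennreal) set"
  where "vals = {\<nu>. centered_valuation R \<mm> \<nu> \<and> \<nu> x = 1 \<and> 1 \<le> \<nu> y}"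

abbreviation val_le :: "('a \<Rightarrow> ennreal) \<Rightarrow> ('a \<Rightarrow> ennreal) \<Rightarrow> bool"
  where "val_le \<mu> \<nu> \<equiv> \<forall>f\<in>carrier R. \<mu> f \<le> \<nu> f"

lemma valsD:
  assumes "\<nu> \<in> vals"
  shows "centered_valuation R \<mm> \<nu>" "\<nu> x = 1" "1 \<le> \<nu> y"
  using assms unfolding vals_def by auto

lemma val_le_antisym:
  assumes "\<mu> \<in> vals" "\<nu> \<in> vals" "val_le \<mu> \<nu>" "val_le \<nu> \<mu>"
  shows "\<mu> = \<nu>"
  using assms valsD(1)[OF assms(1)] valsD(1)[OF assms(2)]
  by (intro extensionalityI[of _ "carrier R"]) (auto simp: centered_valuation_def intro: antisym)

text \<open>Both valuations are 1 at \<open>x\<close>, so a power of \<open>x\<close> can be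
  cancelled from an element where they differ, and what remains has a degree.\<close>

lemma minimal_defect_exists:
  assumes \<rho>: "\<rho> \<in> vals" and \<tau>: "\<tau> \<in> vals" and le: "val_le \<rho> \<tau>" and neq: "\<rho> \<noteq> \<tau>"
  obtains \<phi> d where "minimal_defect \<rho> \<tau> \<phi> d"
proof -
  interpret s: centered_valuation R \<mm> \<rho> by (rule valsD(1)[OF \<rho>])
  interpret t: centered_valuation R \<mm> \<tau> by (rule valsD(1)[OF \<tau>])
  obtain f where f: "f \<in> carrier R" "\<rho> f < \<tau> f"
    using val_le_antisym[OF \<rho> \<tau> le] neq not_le by blast
  have "f \<noteq> \<zero>" using f(2) s.val_zero by auto
  then obtain k g n where g: "f = x [^] (k::nat) \<otimes> g" "has_deg g n"
    using nonzero_eq_x_pow_times f(1) by blast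
  have gc: "g \<in> carrier R" using has_deg_carrier g(2) .
  have "\<rho> f = of_nat k + \<rho> g" "\<tau> f = of_nat k + \<tau> g"
    unfolding g(1) using s.val_mult t.val_mult val_pow[OF valsD(1)[OF \<rho>]] val_pow[OF valsD(1)[OF \<tau>]]
      valsD(2)[OF \<rho>] valsD(2)[OF \<tau>] gc by simp_all
  then have "\<rho> g < \<tau> g" using f(2) by (simp add: ennreal_add_left_cancel_less)
  then have ex: "\<exists>n g. has_deg g n \<and> \<rho> g < \<tau> g" using g(2) by auto
  define d where "d = (LEAST n. \<exists>g. has_deg g n \<and> \<rho> g < \<tau> g)"
  obtain \<phi> where \<phi>: "has_deg \<phi> d" "\<rho> \<phi> < \<tau> \<phi>"
    using LeastI_ex[OF ex] unfolding d_def by blast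
  have "\<rho> r = \<tau> r" if "has_deg r e" "e < d" for r e
    using not_less_Least[OF that(2)[unfolded d_def]] that(1) le has_deg_carrier
    by (metis le_neq_trans)
  then show ?thesis using \<phi> that unfolding minimal_defect_def by blast
qed

context
  fixes \<rho> \<tau> \<phi> d
  assumes \<rho>: "\<rho> \<in> vals" and \<tau>: "\<tau> \<in> vals" and le: "val_le \<rho> \<tau>"
    and defect: "minimal_defect \<rho> \<tau> \<phi> d"
begin

interpretation s: centered_valuation R \<mm> \<rho> by (rule valsD(1)[OF \<rho>])
interpretation t: centered_valuation R \<mm> \<tau> by (rule valsD(1)[OF \<tau>])

lemma defect_deg: "has_deg \<phi> d" and defect_less: "\<rho> \<phi> < \<tau> \<phi>"
  and defect_low: "\<And>r e. has_deg r e \<Longrightarrow> e < d \<Longrightarrow> \<rho> r = \<tau> r"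
  using defect unfolding minimal_defect_def by auto

lemma defect_carrier: "\<phi> \<in> carrier R"
  using defect_deg has_deg_carrier by auto

lemma defect_deg_pos: "0 < d"
proof (rule ccontr)
  assume "\<not> 0 < d"
  then have "\<phi> \<in> Units R" using defect_deg has_deg_zero_unit by simp
  then show False using defect_less val_unit[OF valsD(1)[OF \<tau>]] by simp
qed

lemma defect_pos: "0 < \<rho> \<phi>"
proof -
  have "\<phi> \<notin> Units R" using has_deg_unit has_deg_unique[OF defect_deg] defect_deg_pos by auto
  then show ?thesis using unitI defect_carrier s.val_pos by blast
qed

lemma remainder_val_eq:
  assumes "remainder d c"
  shows "\<rho> c = \<tau> c"
  using assms unfolding remainder_def
proof (elim disjE exE conjE)
  assume "c = \<zero>"
  then show ?thesis using s.val_zero t.val_zero by simp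
next
  fix N :: nat and r e
  assume *: "c = x [^] N \<otimes> r" "has_deg r e" "e < d"
  have "r \<in> carrier R" using * has_deg_carrier by auto
  then show ?thesis
    unfolding *(1) using s.val_mult t.val_mult val_pow[OF valsD(1)[OF \<rho>]] val_pow[OF valsD(1)[OF \<tau>]]
      valsD(2)[OF \<rho>] valsD(2)[OF \<tau>] defect_low[OF *(2,3)] by simp
qed

text \<open>
  If the value of \<open>q \<otimes> \<phi> \<oplus> c\<close> were larger, then \<open>q \<otimes> \<phi>\<close> and \<open>c\<close> would have the same \<open>\<rho>\<close>-value, whereas
  passing to \<open>\<tau>\<close> increases only the value of the former.
\<close>
lemma val_division:
  assumes q: "q \<in> carrier R" and c: "remainder d c"
  shows "\<rho> (q \<otimes> \<phi> \<oplus> c) = min (\<rho> q + \<rho> \<phi>) (\<rho> c)"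
proof (rule antisym)
  have cc: "c \<in> carrier R" "q \<otimes> \<phi> \<in> carrier R"
    using remainder_carrier[OF c] defect_carrier q by auto
  have sq: "\<rho> (q \<otimes> \<phi>) = \<rho> q + \<rho> \<phi>" "\<tau> (q \<otimes> \<phi>) = \<tau> q + \<tau> \<phi>"
    using s.val_mult t.val_mult q defect_carrier by auto
  show "min (\<rho> q + \<rho> \<phi>) (\<rho> c) \<le> \<rho> (q \<otimes> \<phi> \<oplus> c)"
    using s.val_add[OF cc(2,1)] sq by simp
  show "\<rho> (q \<otimes> \<phi> \<oplus> c) \<le> min (\<rho> q + \<rho> \<phi>) (\<rho> c)"
  proof (rule ccontr)
    assume "\<not> ?thesis"
    then have less: "min (\<rho> (q \<otimes> \<phi>)) (\<rho> c) < \<rho> (q \<otimes> \<phi> \<oplus> c)" unfolding sq not_le .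
    then have eq: "\<rho> (q \<otimes> \<phi>) = \<rho> c" using val_eq_if_less_add[OF valsD(1)[OF \<rho>] cc(2,1)] by simp
    have fin: "\<rho> c < \<infinity>" using less_le_trans[OF less top_greatest] eq by simp
    then have "\<rho> q < \<infinity>" using eq sq fin by (auto simp: less_top[symmetric])
    have "\<tau> c = \<rho> c" using remainder_val_eq[OF c] by simp
    also have "\<dots> = \<rho> q + \<rho> \<phi>" using eq sq by simp
    also have "\<dots> < \<rho> q + \<tau> \<phi>"
      using defect_less \<open>\<rho> q < \<infinity>\<close> by (simp add: ennreal_add_left_cancel_less)
    also have "\<dots> \<le> \<tau> (q \<otimes> \<phi>)" using sq le q by (simp add: add_right_mono)
    finally have "\<tau> (q \<otimes> \<phi> \<oplus> c) = \<tau> c" using val_add_eq_right[OF valsD(1)[OF \<tau>] cc(2,1)] by simp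
    also have "\<dots> = \<rho> c" using remainder_val_eq[OF c] by simp
    also have "\<dots> < \<rho> (q \<otimes> \<phi> \<oplus> c)" using less eq by simp
    also have "\<dots> \<le> \<tau> (q \<otimes> \<phi> \<oplus> c)" using le cc by simp
    finally show False by simp
  qed
qed

text \<open>By \<open>val_division\<close>, \<open>\<rho>\<close> is the smallest member of
  \<open>vals\<close> with its values in degrees below \<open>d\<close> and its value at
  \<open>\<phi>\<close>.\<close>

lemma val_le_if_low_degree_le:
  assumes \<mu>: "\<mu> \<in> vals" and low: "\<And>r e. has_deg r e \<Longrightarrow> e < d \<Longrightarrow> \<tau> r \<le> \<mu> r"
    and \<phi>: "\<rho> \<phi> \<le> \<mu> \<phi>"
  shows "val_le \<rho> \<mu>"
proof
  interpret m: centered_valuation R \<mm> \<mu> by (rule valsD(1)[OF \<mu>])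
  have rem: "\<rho> c \<le> \<mu> c" if "remainder d c" for c
    using that unfolding remainder_def
  proof (elim disjE exE conjE)
    assume "c = \<zero>"
    then show ?thesis using s.val_zero m.val_zero by simp
  next
    fix N :: nat and r e
    assume *: "c = x [^] N \<otimes> r" "has_deg r e" "e < d"
    have "r \<in> carrier R" using * has_deg_carrier by auto
    then show ?thesis
      unfolding *(1) using s.val_mult m.val_mult val_pow[OF valsD(1)[OF \<rho>]] val_pow[OF valsD(1)[OF \<mu>]]
        valsD(2)[OF \<rho>] valsD(2)[OF \<mu>] low[OF *(2,3)] defect_low[OF *(2,3)] by (simp add: add_left_mono)
  qed
  \<comment> \<open>Quotients can be divided again without end, so \<open>n\<close> divisions
    control only a truncated value. The truncation is removed afterwards by
    \<open>0 < \<rho> \<phi>\<close>.\<close>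
  have bound: "min (\<rho> f) (of_nat n * \<rho> \<phi>) \<le> \<mu> f" if "f \<in> carrier R" for f n
    using that
  proof (induction n arbitrary: f)
    case (Suc n)
    obtain q c where qc: "q \<in> carrier R" "remainder d c" "f = q \<otimes> \<phi> \<oplus> c"
      using division[OF defect_deg Suc.prems] .
    have cc: "c \<in> carrier R" using qc remainder_carrier by auto
    have "min (\<rho> q + \<rho> \<phi>) (of_nat (Suc n) * \<rho> \<phi>) = min (\<rho> q) (of_nat n * \<rho> \<phi>) + \<rho> \<phi>"
      by (simp add: distrib_right min_def add.commute add_right_mono ennreal_add_left_cancel_le)
    also have "\<dots> \<le> \<mu> q + \<mu> \<phi>" by (intro add_mono Suc.IH qc \<phi>)
    also have "\<dots> = \<mu> (q \<otimes> \<phi>)" using m.val_mult qc defect_carrier by simp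
    finally have 1: "min (\<rho> q + \<rho> \<phi>) (of_nat (Suc n) * \<rho> \<phi>) \<le> \<mu> (q \<otimes> \<phi>)" .
    have "min (\<rho> f) (of_nat (Suc n) * \<rho> \<phi>) \<le> min (\<mu> (q \<otimes> \<phi>)) (\<mu> c)"
      unfolding qc(3) val_division[OF qc(1,2)] using 1 rem[OF qc(2)]
      by (meson min.boundedI min.coboundedI1 min.coboundedI2 min.cobounded1 min.cobounded2 order_trans)
    also have "\<dots> \<le> \<mu> f" unfolding qc(3) using m.val_add qc(1) cc defect_carrier by simp
    finally show ?case .
  qed simp
  fix f assume f: "f \<in> carrier R"
  show "\<rho> f \<le> \<mu> f"
  proof (rule ccontr)
    assume neg: "\<not> \<rho> f \<le> \<mu> f"
    then have "\<mu> f < \<rho> f" by (simp add: not_le)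
    then have "\<mu> f < \<infinity>" using less_le_trans[OF _ top_greatest, of "\<mu> f" "\<rho> f"] by simp
    then obtain n where "\<mu> f < of_nat n * \<rho> \<phi>" using ennreal_less_of_nat_mult[OF defect_pos] by blast
    then show False using bound[OF f, of n] neg by (simp add: min_le_iff_disj not_le)
  qed
qed

text \<open>A power of \<open>y\<close> raises the degree to exactly \<open>d\<close>. The quotient
  by \<open>\<phi>\<close> is then a unit, and the first term of the minimum in
  \<open>val_division\<close> is \<open>\<rho> \<phi>\<close>.\<close>

lemma val_le_of_deg_le:
  assumes \<psi>: "has_deg \<psi> e" and "e \<le> d"
  shows "\<rho> \<psi> \<le> \<rho> \<phi>"
proof -
  have \<psi>c: "\<psi> \<in> carrier R" using \<psi> has_deg_carrier by auto
  let ?\<psi> = "\<psi> \<otimes> y [^] (d - e)"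
  have deg: "has_deg ?\<psi> d" using has_deg_mult[OF \<psi> has_deg_y_pow[of "d - e"]] assms by simp
  obtain q c where qc: "q \<in> carrier R" "remainder d c" "?\<psi> = q \<otimes> \<phi> \<oplus> c"
    using division[OF defect_deg has_deg_carrier[OF deg]] .
  have "q \<in> Units R"
    using remainder_cases[OF qc(2)]
  proof (elim disjE exE bexE conjE)
    fix e' assume "has_deg c e'" "e' < d"
    then have "has_deg ?\<psi> e'" unfolding qc(3) using has_deg_add_lower qc(1) defect_deg by blast
    then show ?thesis using has_deg_unique[OF deg] \<open>e' < d\<close> by auto
  next
    fix c' assume "c' \<in> carrier R" "c = x \<otimes> c'"
    then obtain k where "has_deg q k" "d = k + d"
      using has_deg_factor[OF qc(1) defect_deg] deg unfolding qc(3) by metis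
    then show ?thesis using has_deg_zero_unit by simp
  qed
  then have "\<rho> q = 0" by (rule val_unit[OF valsD(1)[OF \<rho>]])
  have "\<rho> \<psi> \<le> \<rho> ?\<psi>" using s.val_mult \<psi>c by simp
  also have "\<dots> \<le> \<rho> \<phi>" unfolding qc(3) val_division[OF qc(1,2)] using \<open>\<rho> q = 0\<close> by simp
  finally show ?thesis .
qed

text \<open>A division by \<open>\<phi>\<close> lowers the degree by \<open>d\<close>, unless the
  remainder itself has a degree below \<open>d\<close>; in that case its value already bounds that
  of \<open>\<psi>\<close>.\<close>

lemma val_le_of_deg_le_mult:
  assumes "has_deg \<psi> e" "e \<le> j * d"
  shows "\<rho> \<psi> \<le> of_nat j * \<rho> \<phi>"
  using assms
proof (induction j arbitrary: \<psi> e)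
  case 0
  then have "\<psi> \<in> Units R" using has_deg_zero_unit by simp
  then show ?case using val_unit[OF valsD(1)[OF \<rho>]] by simp
next
  case (Suc j)
  obtain q c where qc: "q \<in> carrier R" "remainder d c" "\<psi> = q \<otimes> \<phi> \<oplus> c"
    using division[OF defect_deg has_deg_carrier[OF Suc.prems(1)]] .
  show ?case
    using remainder_cases[OF qc(2)]
  proof (elim disjE exE bexE conjE)
    fix e' assume *: "has_deg c e'" "e' < d"
    have "\<rho> \<psi> \<le> \<rho> c" unfolding qc(3) val_division[OF qc(1,2)] by simp
    also have "\<dots> \<le> \<rho> \<phi>" using val_le_of_deg_le[OF *(1)] *(2) by simp
    also have "\<dots> \<le> of_nat (Suc j) * \<rho> \<phi>" by (simp add: distrib_right)
    finally show ?thesis .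
  next
    fix c' assume "c' \<in> carrier R" "c = x \<otimes> c'"
    then obtain k where k: "has_deg q k" "e = k + d"
      using has_deg_factor[OF qc(1) defect_deg] Suc.prems(1) unfolding qc(3) by metis
    have "\<rho> \<psi> \<le> \<rho> q + \<rho> \<phi>" unfolding qc(3) val_division[OF qc(1,2)] by simp
    also have "\<dots> \<le> of_nat j * \<rho> \<phi> + \<rho> \<phi>"
      by (intro add_right_mono Suc.IH[OF k(1)]) (use k Suc.prems(2) in simp)
    also have "\<dots> = of_nat (Suc j) * \<rho> \<phi>" by (simp add: distrib_right add.commute)
    finally show ?thesis .
  qed
qed

text \<open>Passing to \<open>\<psi> [^] d\<close> makes the degree a multiple of \<open>d\<close>,
  so nothing is lost by rounding.\<close>

lemma val_times_deg_le:
  assumes "has_deg \<psi> e"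
  shows "of_nat d * \<rho> \<psi> \<le> of_nat e * \<rho> \<phi>"
  using val_le_of_deg_le_mult[OF has_deg_pow[OF assms, of d]] val_pow[OF valsD(1)[OF \<rho>] has_deg_carrier[OF assms]]
  by simp

end

text \<open>The valuation with the smaller defect degree \<open>d1\<close> is the candidate for the
  smaller one, as the other agrees with \<open>\<tau>\<close> below \<open>d1\<close>. If it is
  nevertheless larger at \<open>\<phi>1\<close>, the other has a defect there too, the degrees
  coincide, and the roles are exchanged with the same \<open>\<phi>1\<close>.\<close>

lemma vals_below_comparable:
  assumes \<tau>: "\<tau> \<in> vals" and 1: "\<mu>1 \<in> vals" "val_le \<mu>1 \<tau>" and 2: "\<mu>2 \<in> vals" "val_le \<mu>2 \<tau>"
  shows "val_le \<mu>1 \<mu>2 \<or> val_le \<mu>2 \<mu>1"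
proof (cases "\<mu>1 = \<tau> \<or> \<mu>2 = \<tau>")
  case True
  then show ?thesis using 1 2 by auto
next
  case False
  have main: "val_le \<mu>1 \<mu>2 \<or> val_le \<mu>2 \<mu>1"
    if "\<mu>1 \<in> vals" "val_le \<mu>1 \<tau>" "\<mu>2 \<in> vals" "val_le \<mu>2 \<tau>" "minimal_defect \<mu>1 \<tau> \<phi>1 d1"
      "minimal_defect \<mu>2 \<tau> \<phi>2 d2" "d1 \<le> d2" for \<mu>1 \<mu>2 \<phi>1 \<phi>2 d1 d2
  proof (cases "\<mu>1 \<phi>1 \<le> \<mu>2 \<phi>1")
    case True
    have "val_le \<mu>1 \<mu>2"
      by (rule val_le_if_low_degree_le[OF that(1) \<tau> that(2,5) that(3) _ True])
        (use that(6,7) in \<open>auto simp: minimal_defect_def\<close>)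
    then show ?thesis ..
  next
    case False
    have d1: "has_deg \<phi>1 d1" "\<mu>1 \<phi>1 < \<tau> \<phi>1" using that(5) by (auto simp: minimal_defect_def)
    have less: "\<mu>2 \<phi>1 < \<tau> \<phi>1" using False d1(2) by simp
    then have "\<not> d1 < d2" using that(6) d1(1) by (auto simp: minimal_defect_def)
    then have "d1 = d2" using that(7) by simp
    then have "minimal_defect \<mu>2 \<tau> \<phi>1 d1" using that(6) d1 less by (auto simp: minimal_defect_def)
    then have "val_le \<mu>2 \<mu>1"
      by (rule val_le_if_low_degree_le[OF that(3) \<tau> that(4) _ that(1)])
        (use that(5) False in \<open>auto simp: minimal_defect_def\<close>)
    then show ?thesis ..
  qed
  obtain \<phi>1 d1 where d1: "minimal_defect \<mu>1 \<tau> \<phi>1 d1"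
    using minimal_defect_exists[OF 1(1) \<tau> 1(2)] False by blast
  obtain \<phi>2 d2 where d2: "minimal_defect \<mu>2 \<tau> \<phi>2 d2"
    using minimal_defect_exists[OF 2(1) \<tau> 2(2)] False by blast
  show ?thesis using main[OF 1 2 d1 d2] main[OF 2 1 d2 d1] by linarith
qed

text \<open>The skewness relative to \<open>x\<close>; it parametrizes the segments of the tree.\<close>
definition skewness :: "('a \<Rightarrow> ennreal) \<Rightarrow> ennreal"
  where "skewness \<mu> = (SUP (\<psi>, e) \<in> {(\<psi>, e). has_deg \<psi> e \<and> 0 < e}. \<mu> \<psi> / of_nat e)"

lemma skewness_upper:
  assumes "has_deg \<psi> e" "0 < e"
  shows "\<mu> \<psi> / of_nat e \<le> skewness \<mu>"
  unfolding skewness_def using assms by (intro SUP_upper2[of "(\<psi>, e)"]) auto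

lemma skewness_leI:
  assumes "\<And>\<psi> e. has_deg \<psi> e \<Longrightarrow> 0 < e \<Longrightarrow> \<mu> \<psi> \<le> of_nat e * t"
  shows "skewness \<mu> \<le> t"
  unfolding skewness_def using assms by (auto intro!: SUP_least divide_le_posI_ennreal)

text \<open>By \<open>val_times_deg_le\<close> the ratio of value to degree is largest at
  \<open>\<phi>\<close>. So this ratio depends on \<open>\<rho>\<close> alone, although
  \<open>\<phi>\<close> was found by comparison with \<open>\<tau>\<close>.\<close>

lemma skewness_eq:
  assumes "\<rho> \<in> vals" "\<tau> \<in> vals" "val_le \<rho> \<tau>" "minimal_defect \<rho> \<tau> \<phi> d"
  shows "skewness \<rho> = \<rho> \<phi> / of_nat d"
proof (rule antisym)
  note d = defect_deg[OF assms] defect_deg_pos[OF assms]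
  show "\<rho> \<phi> / of_nat d \<le> skewness \<rho>" by (rule skewness_upper) (use d in auto)
  show "skewness \<rho> \<le> \<rho> \<phi> / of_nat d"
  proof (rule skewness_leI)
    fix \<psi> e assume \<psi>: "has_deg \<psi> e" "0 < e"
    have "of_nat d * \<rho> \<psi> \<le> of_nat e * \<rho> \<phi>" by (rule val_times_deg_le[OF assms \<psi>(1)])
    then have "of_nat d * \<rho> \<psi> / of_nat d \<le> of_nat e * \<rho> \<phi> / of_nat d"
      by (rule divide_right_mono_ennreal)
    moreover have "of_nat d * \<rho> \<psi> / of_nat d = \<rho> \<psi>"
      using ennreal_mult_divide_eq[of "of_nat d" "\<rho> \<psi>"] d(2) by (simp add: mult.commute)
    ultimately show "\<rho> \<psi> \<le> of_nat e * (\<rho> \<phi> / of_nat d)"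
      by (simp add: ennreal_times_divide)
  qed
qed

lemma skewness_strict_mono:
  assumes "\<rho> \<in> vals" "\<tau> \<in> vals" "val_le \<rho> \<tau>" "\<rho> \<noteq> \<tau>"
  shows "skewness \<rho> < skewness \<tau>"
proof -
  obtain \<phi> d where def: "minimal_defect \<rho> \<tau> \<phi> d" using minimal_defect_exists[OF assms] .
  note a = assms(1-3) def
  have d: "(of_nat d :: ennreal) \<noteq> 0" "of_nat d < (\<infinity>::ennreal)" using defect_deg_pos[OF a] by (simp_all add: less_top[symmetric])
  have "skewness \<rho> = \<rho> \<phi> / of_nat d" by (rule skewness_eq[OF a])
  also have "\<dots> < \<tau> \<phi> / of_nat d"
    unfolding divide_less_ennreal[OF d[unfolded infinity_ennreal_def]] using defect_less[OF a] d
    by (simp add: ennreal_divide_times ennreal_mult_divide_eq less_top[symmetric])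
  also have "\<dots> \<le> skewness \<tau>" by (rule skewness_upper[OF defect_deg[OF a] defect_deg_pos[OF a]])
  finally show ?thesis .
qed

section \<open>The multiplicity valuation as least element\<close>

lemma multiplicity_in_vals: "multiplicity_valuation R \<mm> \<in> vals"
proof -
  have "x \<notin> max_pow (Suc 1)"
    using x_mult_mem_max_pow_Suc_iff[of \<one> 1] max_pow_1 one_notin_max by simp
  then have "multiplicity_valuation R \<mm> x = 1"
    using multiplicity_valuation_eq[of x 1] x_y_max_pow by simp
  moreover have "1 \<le> multiplicity_valuation R \<mm> y"
    using le_multiplicity_valuation_iff[of y 1] x_y_max_pow by simp
  ultimately show ?thesis unfolding vals_def using centered_multiplicity_valuation by simp
qed

lemma skewness_multiplicity: "skewness (multiplicity_valuation R \<mm>) \<le> 1"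
proof (rule skewness_leI)
  fix \<psi> e assume \<psi>: "has_deg \<psi> e"
  show "multiplicity_valuation R \<mm> \<psi> \<le> of_nat e * 1"
  proof (rule ccontr)
    assume neg: "\<not> ?thesis"
    show False
      using has_deg_carrier[OF \<psi>]
    proof (cases rule: multiplicity_valuation_cases)
      case 1
      then show False using has_deg_not_multiple[OF \<psi>, of \<zero>] by simp
    next
      case (2 a)
      then show False using has_deg_max_pow_le[OF \<psi> 2(1)] neg by simp
    qed
  qed
qed

text \<open>The element \<open>y\<close> has degree 1 and value at least 1. Together with
  \<open>skewness_multiplicity\<close> this gives the root skewness 1, which is where the parameters
  of segments begin.\<close>

lemma one_le_skewness:
  assumes "\<tau> \<in> vals"
  shows "1 \<le> skewness \<tau>"
proof -
  have "\<tau> y / of_nat 1 \<le> skewness \<tau>" by (rule skewness_upper) (use has_deg_y_pow[of 1] in simp_all)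
  moreover have "\<tau> y / of_nat 1 = \<tau> y" using ennreal_mult_divide_eq[of 1 "\<tau> y"] by simp
  ultimately show ?thesis using valsD(3)[OF assms] by simp
qed

lemma of_nat_le_val_max_pow:
  assumes v: "centered_valuation R \<mm> \<nu>" and "1 \<le> \<nu> x" "1 \<le> \<nu> y" and "f \<in> max_pow n"
  shows "of_nat n \<le> \<nu> f"
  using assms(4)
proof (induction n arbitrary: f)
  case (Suc n)
  interpret v: centered_valuation R \<mm> \<nu> by (rule v)
  obtain a g where *: "a \<in> carrier R" "g \<in> max_pow n" "f = y [^] Suc n \<otimes> a \<oplus> x \<otimes> g"
    using Suc.prems unfolding mem_max_pow_Suc_iff by auto
  have gc: "g \<in> carrier R" using *(2) max_pow_carrier by simp
  have "of_nat (Suc n) * 1 \<le> of_nat (Suc n) * \<nu> y" using assms(3) by (intro mult_left_mono) auto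
  also have "\<dots> = \<nu> (y [^] Suc n)" using val_pow[OF v y_carrier, of "Suc n"] by simp
  also have "\<dots> \<le> \<nu> (y [^] Suc n) + \<nu> a" by simp
  also have "\<dots> = \<nu> (y [^] Suc n \<otimes> a)" using v.val_mult *(1) by (simp del: nat_pow_Suc)
  finally have 1: "of_nat (Suc n) \<le> \<nu> (y [^] Suc n \<otimes> a)" by simp
  have "of_nat (Suc n) = 1 + (of_nat n :: ennreal)" by simp
  also have "\<dots> \<le> \<nu> x + \<nu> g" by (intro add_mono assms(2) Suc.IH *(2))
  also have "\<dots> = \<nu> (x \<otimes> g)" using v.val_mult gc by simp
  finally have 2: "of_nat (Suc n) \<le> \<nu> (x \<otimes> g)" .
  have "min (\<nu> (y [^] Suc n \<otimes> a)) (\<nu> (x \<otimes> g)) \<le> \<nu> f"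
    unfolding *(3) using *(1) gc by (intro v.val_add) auto
  then show ?case using 1 2 by (meson min.boundedI order_trans)
qed simp

lemma multiplicity_least:
  assumes v: "centered_valuation R \<mm> \<nu>" and "1 \<le> \<nu> x" "1 \<le> \<nu> y"
  shows "val_le (multiplicity_valuation R \<mm>) \<nu>"
proof
  interpret v: centered_valuation R \<mm> \<nu> by (rule v)
  fix f assume "f \<in> carrier R"
  then show "multiplicity_valuation R \<mm> f \<le> \<nu> f"
  proof (cases rule: multiplicity_valuation_cases)
    case 1 then show ?thesis using v.val_zero by simp
  next
    case (2 a) then show ?thesis using of_nat_le_val_max_pow[OF assms 2(1)] by simp
  qed
qed

end

lemma add_min_ennreal: "s + min u w = min (s + u) (s + w)" for s u w :: ennreal
  by (cases u w rule: le_cases) (simp_all add: min_absorb1 min_absorb2 add_left_mono)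

text \<open>Combined with \<open>dense_le\<close> this reduces inequalities between suprema to
  single expressions. An empty family has supremum 0 and would provide no \<open>i\<close>, whence
  the second assumption.\<close>

lemma less_add_SUP_ennreal:
  fixes a v :: ennreal
  assumes "v < a + (SUP i\<in>I. f i)" "I \<noteq> {}"
  obtains i where "i \<in> I" "v < a + f i"
proof -
  have "a + (SUP i\<in>I. f i) = (SUP i\<in>I. f i + a)"
    using ennreal_SUP_add_left[OF assms(2), of f a] by (simp add: add.commute)
  then obtain i where "i \<in> I" "v < f i + a" using assms(1) by (auto simp: less_SUP_iff)
  then show ?thesis using that by (simp add: add.commute)
qed

section \<open>Augmentation\<close>

context regular_parameters
begin

text \<open>
  The value of \<open>f\<close> for the augmented valuation is the supremum over all expressions
  \<open>f = \<Sum>i\<le>n. a i \<phi>\<^sup>i\<close> of the minimum of \<open>\<rho> (a i) + i s\<close>, obtained by Horner's scheme.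
\<close>
primrec approx :: "('a \<Rightarrow> ennreal) \<Rightarrow> 'a \<Rightarrow> ennreal \<Rightarrow> nat \<Rightarrow> 'a \<Rightarrow> ennreal" where
  "approx \<rho> \<phi> s 0 = \<rho>"
| "approx \<rho> \<phi> s (Suc n) =
     (\<lambda>f. SUP (q, a) \<in> {(q, a). q \<in> carrier R \<and> a \<in> carrier R \<and> f = q \<otimes> \<phi> \<oplus> a}.
        min (\<rho> a) (s + approx \<rho> \<phi> s n q))"

definition augmented :: "('a \<Rightarrow> ennreal) \<Rightarrow> 'a \<Rightarrow> ennreal \<Rightarrow> 'a \<Rightarrow> ennreal"
  where "augmented \<rho> \<phi> s = (\<lambda>f\<in>carrier R. SUP n. approx \<rho> \<phi> s n f)"

context
  fixes \<rho> \<tau> \<phi> d s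
  assumes \<rho>: "\<rho> \<in> vals" and \<tau>: "\<tau> \<in> vals" and le: "val_le \<rho> \<tau>"
    and defect: "minimal_defect \<rho> \<tau> \<phi> d" and s: "\<rho> \<phi> < s" "s < \<tau> \<phi>"
begin

interpretation r: centered_valuation R \<mm> \<rho> by (rule valsD(1)[OF \<rho>])
interpretation t: centered_valuation R \<mm> \<tau> by (rule valsD(1)[OF \<tau>])

abbreviation "V \<equiv> approx \<rho> \<phi> s"
abbreviation "W \<equiv> augmented \<rho> \<phi> s"

lemmas context_assms = \<rho> \<tau> le defect
lemmas \<phi>_deg = defect_deg[OF context_assms]
lemmas \<phi>_carrier = defect_carrier[OF context_assms]

section \<open>Horner approximations of bounded length\<close>

lemma approx_rep:
  assumes "q \<in> carrier R" "a \<in> carrier R"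
  shows "min (\<rho> a) (s + V n q) \<le> V (Suc n) (q \<otimes> \<phi> \<oplus> a)"
  unfolding approx.simps using assms by (intro SUP_upper2[of "(q, a)"]) auto

lemma approx_repE:
  assumes "v < V (Suc n) f"
  obtains q a where "q \<in> carrier R" "a \<in> carrier R" "f = q \<otimes> \<phi> \<oplus> a" "v < min (\<rho> a) (s + V n q)"
  using assms unfolding approx.simps less_SUP_iff by auto

lemma approx_add_repE:
  assumes f: "f \<in> carrier R" and v: "v < b + V (Suc n) f"
  obtains q a where "q \<in> carrier R" "a \<in> carrier R" "f = q \<otimes> \<phi> \<oplus> a"
    "v < b + min (\<rho> a) (s + V n q)"
proof -
  let ?I = "{(q, a). q \<in> carrier R \<and> a \<in> carrier R \<and> f = q \<otimes> \<phi> \<oplus> a}"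
  have "(\<zero>, f) \<in> ?I" using f \<phi>_carrier by simp
  then have ne: "?I \<noteq> {}" by auto
  obtain qa where "qa \<in> ?I" "v < b + (case qa of (q, a) \<Rightarrow> min (\<rho> a) (s + V n q))"
    by (rule less_add_SUP_ennreal[OF v[unfolded approx.simps] ne])
  then show ?thesis using that by auto
qed

lemma approx_SucI:
  assumes "\<And>q a. q \<in> carrier R \<Longrightarrow> a \<in> carrier R \<Longrightarrow> f = q \<otimes> \<phi> \<oplus> a \<Longrightarrow> min (\<rho> a) (s + V n q) \<le> b"
  shows "V (Suc n) f \<le> b"
  unfolding approx.simps using assms by (auto intro!: SUP_least)

lemma le_approx: "f \<in> carrier R \<Longrightarrow> \<rho> f \<le> V n f"
proof (induction n arbitrary: f)
  case (Suc n)
  \<comment> \<open>\<open>f\<close> is its own constant term, and the zero quotient must not lower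
    the minimum.\<close>
  have "V n \<zero> = \<infinity>" using Suc.IH[of \<zero>] r.val_zero by (simp add: top.extremum_unique)
  then have "min (\<rho> f) (s + V n \<zero>) = \<rho> f" by simp
  moreover have "\<zero> \<otimes> \<phi> \<oplus> f = f" using Suc.prems \<phi>_carrier by simp
  ultimately show ?case using approx_rep[of \<zero> f n] Suc.prems by simp
qed simp

lemma approx_Suc_le: "f \<in> carrier R \<Longrightarrow> V n f \<le> V (Suc n) f"
proof (induction n arbitrary: f)
  case 0
  then show ?case using le_approx[of f 1] by simp
next
  case (Suc n)
  show ?case
  proof (rule approx_SucI)
    fix q a assume *: "q \<in> carrier R" "a \<in> carrier R" "f = q \<otimes> \<phi> \<oplus> a"
    have "min (\<rho> a) (s + V n q) \<le> min (\<rho> a) (s + V (Suc n) q)"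
      by (intro min.mono order_refl add_left_mono Suc.IH *)
    also have "\<dots> \<le> V (Suc (Suc n)) f" unfolding *(3) by (rule approx_rep) fact+
    finally show "min (\<rho> a) (s + V n q) \<le> V (Suc (Suc n)) f" .
  qed
qed

lemma approx_mono: "f \<in> carrier R \<Longrightarrow> n \<le> k \<Longrightarrow> V n f \<le> V k f"
  using lift_Suc_mono_le[of "\<lambda>n. V n f"] approx_Suc_le by blast

text \<open>A number strictly below both suprema selects one expression for each summand, and these
  are added coefficientwise.\<close>

lemma approx_add:
  assumes "f \<in> carrier R" "g \<in> carrier R"
  shows "min (V n f) (V n g) \<le> V n (f \<oplus> g)"
  using assms
proof (induction n arbitrary: f g)
  case 0
  then show ?case using r.val_add by simp
next
  case (Suc n)
  show ?case
  proof (rule dense_le)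
    fix v assume "v < min (V (Suc n) f) (V (Suc n) g)"
    then have v: "v < V (Suc n) f" "v < V (Suc n) g" by (auto simp only: min_less_iff_conj)
    obtain q a where q: "q \<in> carrier R" "a \<in> carrier R" "f = q \<otimes> \<phi> \<oplus> a" "v < min (\<rho> a) (s + V n q)"
      using v(1) by (rule approx_repE)
    obtain p b where p: "p \<in> carrier R" "b \<in> carrier R" "g = p \<otimes> \<phi> \<oplus> b" "v < min (\<rho> b) (s + V n p)"
      using v(2) by (rule approx_repE)
    have eq: "f \<oplus> g = (q \<oplus> p) \<otimes> \<phi> \<oplus> (a \<oplus> b)"
      unfolding q(3) p(3) using q(1,2) p(1,2) \<phi>_carrier by (simp add: l_distr a_ac)
    have "v \<le> min (\<rho> a) (\<rho> b)" using q(4) p(4) by (simp add: less_imp_le)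
    also have "\<dots> \<le> \<rho> (a \<oplus> b)" using r.val_add q p by simp
    finally have 1: "v \<le> \<rho> (a \<oplus> b)" .
    have "v \<le> min (s + V n q) (s + V n p)" using q(4) p(4) by (simp add: less_imp_le)
    also have "\<dots> = s + min (V n q) (V n p)" by (rule add_min_ennreal[symmetric])
    also have "\<dots> \<le> s + V n (q \<oplus> p)" by (intro add_left_mono Suc.IH q p)
    finally have "v \<le> min (\<rho> (a \<oplus> b)) (s + V n (q \<oplus> p))" using 1 by simp
    also have "\<dots> \<le> V (Suc n) (f \<oplus> g)" unfolding eq by (rule approx_rep) (use q p in auto)
    finally show "v \<le> V (Suc n) (f \<oplus> g)" .
  qed
qed

lemma approx_mult_left:
  assumes "a \<in> carrier R" "g \<in> carrier R"
  shows "\<rho> a + V n g \<le> V n (a \<otimes> g)"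
  using assms
proof (induction n arbitrary: g)
  case 0
  then show ?case using r.val_mult by simp
next
  case (Suc n)
  show ?case
  proof (rule dense_le)
    fix v assume v: "v < \<rho> a + V (Suc n) g"
    obtain q b where q: "q \<in> carrier R" "b \<in> carrier R" "g = q \<otimes> \<phi> \<oplus> b"
      "v < \<rho> a + min (\<rho> b) (s + V n q)"
      using Suc.prems(2) v by (rule approx_add_repE)
    have eq: "a \<otimes> g = (a \<otimes> q) \<otimes> \<phi> \<oplus> a \<otimes> b"
      unfolding q(3) using q(1,2) Suc.prems \<phi>_carrier by (simp add: r_distr m_assoc)
    have "v \<le> \<rho> a + min (\<rho> b) (s + V n q)" using q(4) by (rule less_imp_le)
    also have "\<dots> \<le> min (\<rho> (a \<otimes> b)) (s + V n (a \<otimes> q))"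
    proof (rule min.boundedI)
      show "\<rho> a + min (\<rho> b) (s + V n q) \<le> \<rho> (a \<otimes> b)"
        using r.val_mult Suc.prems q by (simp add: add_left_mono)
      have "\<rho> a + min (\<rho> b) (s + V n q) \<le> \<rho> a + (s + V n q)" by (intro add_left_mono) simp
      also have "\<dots> = s + (\<rho> a + V n q)" by (simp add: ac_simps)
      also have "\<dots> \<le> s + V n (a \<otimes> q)" by (intro add_left_mono Suc.IH Suc.prems q)
      finally show "\<rho> a + min (\<rho> b) (s + V n q) \<le> s + V n (a \<otimes> q)" .
    qed
    also have "\<dots> \<le> V (Suc n) (a \<otimes> g)"
      unfolding eq by (rule approx_rep) (use q Suc.prems in auto)
    finally show "v \<le> V (Suc n) (a \<otimes> g)" .
  qed
qed

text \<open>With \<open>f = q \<otimes> \<phi> \<oplus> a\<close>, the quotient \<open>q\<close>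
  falls under the induction hypothesis and \<open>a\<close> acts as a single coefficient, as in the
  multiplication of polynomials in \<open>\<phi>\<close>; the lengths add.\<close>

lemma approx_mult:
  assumes "f \<in> carrier R" "g \<in> carrier R"
  shows "V n f + V k g \<le> V (n + k) (f \<otimes> g)"
  using assms
proof (induction n arbitrary: f)
  case 0
  then show ?case using approx_mult_left by simp
next
  case (Suc n)
  show ?case
  proof (rule dense_le)
    fix v assume v: "v < V (Suc n) f + V k g"
    then have "v < V k g + V (Suc n) f" by (simp only: add.commute)
    with Suc.prems(1) obtain q a where q: "q \<in> carrier R" "a \<in> carrier R" "f = q \<otimes> \<phi> \<oplus> a"
      "v < V k g + min (\<rho> a) (s + V n q)"
      by (rule approx_add_repE)
    then have q4: "v < min (\<rho> a) (s + V n q) + V k g" by (simp only: add.commute)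
    have c: "q \<otimes> g \<in> carrier R" "a \<otimes> g \<in> carrier R" "(q \<otimes> g) \<otimes> \<phi> \<in> carrier R"
      using q Suc.prems \<phi>_carrier by auto
    have eq: "f \<otimes> g = (q \<otimes> g) \<otimes> \<phi> \<oplus> a \<otimes> g"
      unfolding q(3) using q(1,2) Suc.prems \<phi>_carrier by (simp add: l_distr r_distr m_ac)
    have "min (\<rho> a) (s + V n q) + V k g \<le> s + (V n q + V k g)"
      by (simp add: add.assoc[symmetric] add_right_mono)
    also have "\<dots> \<le> s + V (n + k) (q \<otimes> g)" by (intro add_left_mono Suc.IH q Suc.prems)
    also have "\<dots> = min (\<rho> \<zero>) (s + V (n + k) (q \<otimes> g))" using r.val_zero by simp
    also have "\<dots> \<le> V (Suc (n + k)) ((q \<otimes> g) \<otimes> \<phi> \<oplus> \<zero>)" by (rule approx_rep) (use c in auto)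
    also have "(q \<otimes> g) \<otimes> \<phi> \<oplus> \<zero> = (q \<otimes> g) \<otimes> \<phi>" using c by simp
    finally have 1: "min (\<rho> a) (s + V n q) + V k g \<le> V (Suc (n + k)) ((q \<otimes> g) \<otimes> \<phi>)" .
    have "min (\<rho> a) (s + V n q) + V k g \<le> \<rho> a + V k g" by (intro add_right_mono) simp
    also have "\<dots> \<le> V k (a \<otimes> g)" by (rule approx_mult_left) (use q Suc.prems in auto)
    also have "\<dots> \<le> V (Suc (n + k)) (a \<otimes> g)" by (rule approx_mono) (use c in auto)
    finally have 2: "min (\<rho> a) (s + V n q) + V k g \<le> V (Suc (n + k)) (a \<otimes> g)" .
    have "v \<le> min (V (Suc (n + k)) ((q \<otimes> g) \<otimes> \<phi>)) (V (Suc (n + k)) (a \<otimes> g))"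
      using less_imp_le[OF q4] 1 2 by (meson min.boundedI order_trans)
    also have "\<dots> \<le> V (Suc (n + k)) (f \<otimes> g)" unfolding eq by (rule approx_add) (use c in auto)
    finally show "v \<le> V (Suc n + k) (f \<otimes> g)" by (simp only: add_Suc)
  qed
qed

text \<open>This is where \<open>s < \<tau> \<phi>\<close> enters: assigning \<open>s\<close> to
  \<open>\<phi>\<close> never overestimates \<open>\<tau>\<close>, whatever expression is
  chosen.\<close>

lemma approx_le: "f \<in> carrier R \<Longrightarrow> V n f \<le> \<tau> f"
proof (induction n arbitrary: f)
  case 0
  then show ?case using le by simp
next
  case (Suc n)
  show ?case
  proof (rule approx_SucI)
    fix q a assume *: "q \<in> carrier R" "a \<in> carrier R" "f = q \<otimes> \<phi> \<oplus> a"
    have "s + V n q \<le> \<tau> \<phi> + \<tau> q" by (intro add_mono Suc.IH * less_imp_le[OF s(2)])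
    also have "\<dots> = \<tau> (q \<otimes> \<phi>)" using t.val_mult * \<phi>_carrier by (simp add: add.commute)
    finally have "min (\<rho> a) (s + V n q) \<le> min (\<tau> (q \<otimes> \<phi>)) (\<tau> a)"
      using le *(2) by (auto intro: min.coboundedI1 min.coboundedI2)
    also have "\<dots> \<le> \<tau> f" unfolding *(3) using t.val_add * \<phi>_carrier by simp
    finally show "min (\<rho> a) (s + V n q) \<le> \<tau> f" .
  qed
qed

section \<open>The augmented valuation\<close>

lemma augmented_eq: "f \<in> carrier R \<Longrightarrow> W f = (SUP n. V n f)"
  unfolding augmented_def by simp

lemma approx_le_augmented: "f \<in> carrier R \<Longrightarrow> V n f \<le> W f"
  unfolding augmented_eq by (rule SUP_upper) simp

lemma val_le_augmented: "val_le \<rho> W"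
  using approx_le_augmented[of _ 0] by simp

lemma augmented_le: "val_le W \<tau>"
  using approx_le by (simp add: augmented_eq SUP_least)

lemma augmented_rep:
  assumes "q \<in> carrier R" "a \<in> carrier R"
  shows "min (\<rho> a) (s + W q) \<le> W (q \<otimes> \<phi> \<oplus> a)"
proof (rule dense_le)
  fix v assume v: "v < min (\<rho> a) (s + W q)"
  then have "v < s + (SUP n. V n q)" unfolding augmented_eq[OF assms(1)] by simp
  then obtain n where "v < s + V n q" by (rule less_add_SUP_ennreal) simp
  then have "v \<le> min (\<rho> a) (s + V n q)" using v by (simp add: less_imp_le)
  also have "\<dots> \<le> V (Suc n) (q \<otimes> \<phi> \<oplus> a)" by (rule approx_rep) fact+
  also have "\<dots> \<le> W (q \<otimes> \<phi> \<oplus> a)" by (rule approx_le_augmented) (use assms \<phi>_carrier in auto)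
  finally show "v \<le> W (q \<otimes> \<phi> \<oplus> a)" .
qed

lemma augmented_add:
  assumes fg: "f \<in> carrier R" "g \<in> carrier R"
  shows "min (W f) (W g) \<le> W (f \<oplus> g)"
proof (rule dense_le)
  fix v assume "v < min (W f) (W g)"
  then obtain n k where "v < V n f" "v < V k g"
    unfolding augmented_eq[OF fg(1)] augmented_eq[OF fg(2)] by (auto simp: less_SUP_iff)
  then have "v \<le> min (V (max n k) f) (V (max n k) g)"
    using approx_mono[OF fg(1), of n "max n k"] approx_mono[OF fg(2), of k "max n k"]
    by (meson less_imp_le max.cobounded1 max.cobounded2 min.boundedI order_trans)
  also have "\<dots> \<le> V (max n k) (f \<oplus> g)" by (rule approx_add[OF fg])
  also have "\<dots> \<le> W (f \<oplus> g)" by (rule approx_le_augmented) (use fg in auto)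
  finally show "v \<le> W (f \<oplus> g)" .
qed

text \<open>Products of expressions give this half of multiplicativity at once; the other half needs
  division.\<close>

lemma augmented_mult_ge:
  assumes fg: "f \<in> carrier R" "g \<in> carrier R"
  shows "W f + W g \<le> W (f \<otimes> g)"
proof -
  have le: "V n f + V k g \<le> W (f \<otimes> g)" for n k
    using approx_mult[OF fg, of n k] approx_le_augmented[of "f \<otimes> g" "n + k"] fg by simp
  have 1: "V n f + W g \<le> W (f \<otimes> g)" for n
  proof (rule dense_le)
    fix v assume "v < V n f + W g"
    then have "v < V n f + (SUP k. V k g)" unfolding augmented_eq[OF fg(2)] by simp
    then obtain k where "v < V n f + V k g" by (rule less_add_SUP_ennreal) simp
    then have "v \<le> V n f + V k g" by (rule less_imp_le)
    also have "\<dots> \<le> W (f \<otimes> g)" by (rule le)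
    finally show "v \<le> W (f \<otimes> g)" .
  qed
  have "W g + W f \<le> W (f \<otimes> g)"
  proof (rule dense_le)
    fix v assume "v < W g + W f"
    then have "v < W g + (SUP n. V n f)" unfolding augmented_eq[OF fg(1)] by simp
    then obtain n where "v < W g + V n f" by (rule less_add_SUP_ennreal) simp
    then have "v \<le> V n f + W g" by (simp add: add.commute less_imp_le)
    then show "v \<le> W (f \<otimes> g)" using 1[of n] by (rule order_trans)
  qed
  then show ?thesis by (simp add: add.commute)
qed

lemma augmented_uminus:
  assumes "f \<in> carrier R"
  shows "W f \<le> W (\<ominus> f)"
proof -
  have "W f \<le> W (\<ominus> \<one>) + W f" by simp
  also have "\<dots> \<le> W (\<ominus> \<one> \<otimes> f)" by (rule augmented_mult_ge) (use assms in auto)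
  also have "\<ominus> \<one> \<otimes> f = \<ominus> f" using assms by (simp add: l_minus)
  finally show ?thesis .
qed

lemma augmented_diff:
  assumes "f \<in> carrier R" "g \<in> carrier R"
  shows "min (W f) (W g) \<le> W (f \<ominus> g)"
proof -
  have "min (W f) (W g) \<le> min (W f) (W (\<ominus> g))"
    using augmented_uminus[OF assms(2)] by (intro min.mono) auto
  also have "\<dots> \<le> W (f \<ominus> g)" unfolding a_minus_def by (rule augmented_add) (use assms in auto)
  finally show ?thesis .
qed

text \<open>The supremum defining \<open>W\<close> is attained at the expression obtained by division.\<close>
lemma augmented_division:
  assumes q: "q \<in> carrier R" and c: "remainder d c"
  shows "W (q \<otimes> \<phi> \<oplus> c) = min (\<rho> c) (s + W q)"
proof (rule antisym)
  have cc: "c \<in> carrier R" using c remainder_carrier by auto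
  note \<phi>c = \<phi>_carrier
  define f where "f = q \<otimes> \<phi> \<oplus> c"
  have fc: "f \<in> carrier R" unfolding f_def using q cc \<phi>c by simp
  show "min (\<rho> c) (s + W q) \<le> W (q \<otimes> \<phi> \<oplus> c)" by (rule augmented_rep[OF q cc])
  have "V n f \<le> min (\<rho> c) (s + W q)" for n
  proof -
    \<comment> \<open>The bound goes through level \<open>Suc n\<close>, where the value is a
      supremum over expressions even if \<open>n\<close> is 0.\<close>
    have "V (Suc n) f \<le> min (\<rho> c) (s + W q)"
    proof (rule approx_SucI)
      fix p a assume p: "p \<in> carrier R" "a \<in> carrier R" "f = p \<otimes> \<phi> \<oplus> a"
      obtain p' c' where p': "p' \<in> carrier R" "remainder d c'" "a = p' \<otimes> \<phi> \<oplus> c'"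
        using division[OF \<phi>_deg p(2)] .
      have c'c: "c' \<in> carrier R" using p' remainder_carrier by auto
      let ?v = "min (\<rho> a) (s + V n p)"
      \<comment> \<open>Dividing \<open>a\<close> turns the given expression into a second division
        of \<open>f\<close>, with quotient \<open>p \<oplus> p'\<close> and remainder
        \<open>c'\<close>; \<open>e\<close> is the difference of the two quotients.\<close>
      define e where "e = (p \<oplus> p') \<ominus> q"
      have ec: "e \<in> carrier R" unfolding e_def using p p' q by simp
      have q_eq: "q = (p \<oplus> p') \<ominus> e"
      proof -
        have "(p \<oplus> p') \<ominus> e = ((p \<oplus> p') \<oplus> q) \<ominus> (p \<oplus> p')"
          unfolding e_def using p p' q by (simp add: a_minus_def minus_add a_ac)
        then show ?thesis using add_diff_cancel_left[of "p \<oplus> p'" q] p p' q by simp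
      qed
      have "q \<otimes> \<phi> \<oplus> c = (p \<oplus> p') \<otimes> \<phi> \<oplus> c'"
        using p(3)[unfolded f_def p'(3)] p p'(1) c'c \<phi>c by (simp add: l_distr a_assoc)
      then have "c = ((p \<oplus> p') \<otimes> \<phi> \<oplus> c') \<ominus> q \<otimes> \<phi>"
        using add_diff_cancel_left[of "q \<otimes> \<phi>" c] q cc \<phi>c by simp
      also have "\<dots> = e \<otimes> \<phi> \<oplus> c'"
        unfolding e_def using p(1) p'(1) q c'c \<phi>c by (simp add: a_minus_def l_distr l_minus a_ac)
      finally have c_eq: "c = e \<otimes> \<phi> \<oplus> c'" .
      have c'_eq: "c' = (\<ominus> e) \<otimes> \<phi> \<oplus> c"
        unfolding c_eq using ec c'c \<phi>c by (simp add: l_minus a_assoc[symmetric] l_neg)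
      have 1: "\<rho> c = min (\<rho> e + \<rho> \<phi>) (\<rho> c')"
        by (subst c_eq) (rule val_division[OF context_assms ec p'(2)])
      have "\<rho> c' = min (\<rho> (\<ominus> e) + \<rho> \<phi>) (\<rho> c)"
        by (subst c'_eq) (rule val_division[OF context_assms _ c], use ec in simp)
      then have 2: "\<rho> c' = min (\<rho> e + \<rho> \<phi>) (\<rho> c)"
        using val_uminus[OF valsD(1)[OF \<rho>] ec] by simp
      \<comment> \<open>The substitute for uniqueness of division: \<open>val_division\<close>,
        applied to \<open>c\<close> in terms of \<open>c'\<close> and conversely, equates their
        values and bounds them by that of \<open>e \<otimes> \<phi>\<close>.\<close>
      have eqs: "\<rho> c = \<rho> c'" "\<rho> c \<le> \<rho> e + \<rho> \<phi>"
        using 1 2 by (metis antisym min.cobounded2, metis min.cobounded1)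
      have a_val: "\<rho> a = min (\<rho> p' + \<rho> \<phi>) (\<rho> c')"
        unfolding p'(3) by (rule val_division[OF context_assms p'(1,2)])
      have va: "?v \<le> \<rho> a" by simp
      have va': "?v \<le> min (\<rho> p' + \<rho> \<phi>) (\<rho> c')" by (rule order_trans[OF va eq_refl[OF a_val]])
      have vc: "?v \<le> \<rho> c" using order_trans[OF va' min.cobounded2] eqs(1) by (simp only:)
      have s': "\<rho> \<phi> \<le> s" using s(1) by (rule less_imp_le)
      have "?v \<le> s + V n p" by simp
      also have "\<dots> \<le> s + W p" by (intro add_left_mono approx_le_augmented p)
      finally have v1: "?v \<le> s + W p" .
      have "?v \<le> \<rho> p' + \<rho> \<phi>" by (rule order_trans[OF va' min.cobounded1])
      also have "\<dots> \<le> W p' + s" by (intro add_mono s') (use val_le_augmented p' in auto)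
      finally have v2: "?v \<le> s + W p'" by (simp add: add.commute)
      have "?v \<le> \<rho> e + \<rho> \<phi>" using vc eqs(2) by (rule order_trans)
      also have "\<dots> \<le> W e + s" by (intro add_mono s') (use val_le_augmented ec in auto)
      finally have v3: "?v \<le> s + W e" by (simp add: add.commute)
      \<comment> \<open>As \<open>q\<close> is \<open>p \<oplus> p' \<ominus> e\<close>, three
        separate bounds suffice. Those for \<open>p'\<close> and \<open>e\<close> only improve when
        the value of \<open>\<phi>\<close> is raised from \<open>\<rho> \<phi>\<close> to
        \<open>s\<close>.\<close>
      have "?v \<le> s + min (min (W p) (W p')) (W e)"
        unfolding add_min_ennreal using v1 v2 v3 by (intro min.boundedI)
      also have "\<dots> \<le> s + min (W (p \<oplus> p')) (W e)"
        by (intro add_left_mono min.mono augmented_add p p' order_refl)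
      also have "\<dots> \<le> s + W ((p \<oplus> p') \<ominus> e)"
        by (intro add_left_mono augmented_diff) (use p p' ec in auto)
      also have "(p \<oplus> p') \<ominus> e = q" using q_eq by simp
      finally show "?v \<le> min (\<rho> c) (s + W q)" using vc by (rule min.boundedI[rotated])
    qed
    then show ?thesis using approx_Suc_le[OF fc, of n] by (rule order_trans[rotated])
  qed
  then show "W (q \<otimes> \<phi> \<oplus> c) \<le> min (\<rho> c) (s + W q)"
    unfolding f_def[symmetric] augmented_eq[OF fc] by (intro SUP_least)
qed

lemma augmented_mult_phi:
  assumes "q \<in> carrier R"
  shows "W (q \<otimes> \<phi>) = s + W q"
  using augmented_division[OF assms, of \<zero>] assms \<phi>_carrier r.val_zero by (simp add: remainder_def)

text \<open>Otherwise the value of the product would come from \<open>p \<otimes> \<phi>\<close>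
  alone, where \<open>\<tau>\<close> is strictly larger. Then \<open>\<tau>\<close> would exceed
  \<open>\<rho>\<close> at \<open>c \<otimes> c'\<close>, although the two agree on both factors.
  This plays the part of the irreducibility condition on key polynomials.\<close>

lemma remainder_mult:
  assumes c: "remainder d c" "remainder d c'" and fin: "\<rho> c \<noteq> \<infinity>" "\<rho> c' \<noteq> \<infinity>"
    and p: "p \<in> carrier R" "remainder d c''" "c \<otimes> c' = p \<otimes> \<phi> \<oplus> c''"
  shows "\<rho> c'' = \<rho> c + \<rho> c'"
proof (rule ccontr)
  assume neq: "\<rho> c'' \<noteq> \<rho> c + \<rho> c'"
  have cc: "c \<in> carrier R" "c' \<in> carrier R" "c'' \<in> carrier R" using c p remainder_carrier by auto
  have "\<rho> c + \<rho> c' = \<rho> (c \<otimes> c')" using r.val_mult[OF cc(1,2)] by simp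
  also have "\<dots> = min (\<rho> p + \<rho> \<phi>) (\<rho> c'')"
    unfolding p(3) by (rule val_division[OF context_assms p(1,2)])
  finally have sum: "\<rho> c + \<rho> c' = min (\<rho> p + \<rho> \<phi>) (\<rho> c'')" .
  have fin': "\<rho> c + \<rho> c' \<noteq> \<infinity>" using fin by simp
  have "\<rho> p + \<rho> \<phi> = \<rho> c + \<rho> c'" using sum neq by (auto simp: min_def split: if_splits)
  moreover have lt: "\<rho> c + \<rho> c' < \<rho> c''" using sum neq by (auto simp: min_def split: if_splits)
  moreover have "\<rho> p \<noteq> \<infinity>"
  proof
    assume "\<rho> p = \<infinity>"
    then have "\<rho> c + \<rho> c' = \<infinity>" using \<open>\<rho> p + \<rho> \<phi> = \<rho> c + \<rho> c'\<close>[symmetric] by simp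
    with fin' show False ..
  qed
  ultimately have "\<rho> c + \<rho> c' < \<rho> p + \<tau> \<phi>"
    using defect_less[OF context_assms] by (metis ennreal_add_left_cancel_less)
  also have "\<dots> \<le> \<tau> p + \<tau> \<phi>" using le p by (intro add_right_mono) simp
  also have "\<dots> = \<tau> (p \<otimes> \<phi>)" using t.val_mult p \<phi>_carrier by simp
  finally have "\<rho> c + \<rho> c' < min (\<tau> (p \<otimes> \<phi>)) (\<tau> c'')"
    using lt remainder_val_eq[OF context_assms p(2)] by simp
  also have "\<dots> \<le> \<tau> (c \<otimes> c')" unfolding p(3) using t.val_add p cc \<phi>_carrier by simp
  also have "\<dots> = \<rho> c + \<rho> c'"
    using t.val_mult cc remainder_val_eq[OF context_assms c(1)] remainder_val_eq[OF context_assms c(2)] by simp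
  finally show False by simp
qed

lemma s_pos: "0 < s"
  using s(1) by (rule le_less_trans[OF zero_le])

text \<open>
  If the value of \<open>f = q \<otimes> \<phi> \<oplus> c\<close> or of \<open>g\<close> is not attained by the remainder, the factor \<open>\<phi>\<close> can be
  split off; otherwise the remainder of the product of the remainders attains the value of \<open>f \<otimes> g\<close>.
\<close>
lemma augmented_mult_le:
  assumes "f \<in> carrier R" "g \<in> carrier R" "W f + W g < of_nat n * s"
  shows "W (f \<otimes> g) \<le> W f + W g"
  using assms
proof (induction n arbitrary: f g)
  case (Suc n)
  note \<phi>c = \<phi>_carrier
  have split_off: "W (f \<otimes> g) \<le> W f + W g"
    if f: "f \<in> carrier R" and g: "g \<in> carrier R" and less: "W f + W g < of_nat (Suc n) * s"
      and q: "q \<in> carrier R" "remainder d c" "f = q \<otimes> \<phi> \<oplus> c" "W f < \<rho> c" for f g q c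
  proof (rule ccontr)
    assume "\<not> ?thesis"
    then have gt: "W f + W g < W (f \<otimes> g)" by simp
    have fin: "W f \<noteq> \<infinity>" "W g \<noteq> \<infinity>" using less_le_trans[OF less top_greatest] by auto
    have cc: "c \<in> carrier R" using q remainder_carrier by auto
    have "W f = min (\<rho> c) (s + W q)" unfolding q(3) by (rule augmented_division[OF q(1,2)])
    then have Wf: "W f = s + W q" using q(4) by (auto simp: min_def split: if_splits)
    \<comment> \<open>Splitting off one factor \<open>\<phi>\<close> lowers the bound by exactly one
      \<open>s\<close>, which drives the induction on \<open>n\<close>.\<close>
    have "s + (W q + W g) < s + of_nat n * s"
      using less unfolding Wf by (simp add: add.assoc distrib_right)
    then have "W q + W g < of_nat n * s" by (simp add: ennreal_add_left_cancel_less)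
    then have IH: "W (q \<otimes> g) \<le> W q + W g" by (rule Suc.IH[OF q(1) g])
    have c: "q \<otimes> g \<in> carrier R" "c \<otimes> g \<in> carrier R" "(q \<otimes> g) \<otimes> \<phi> \<in> carrier R" "f \<otimes> g \<in> carrier R"
      using f g q cc \<phi>c by auto
    have "f \<otimes> g = (q \<otimes> g) \<otimes> \<phi> \<oplus> c \<otimes> g"
      unfolding q(3) using q(1) cc g \<phi>c by (simp add: l_distr r_distr m_ac)
    then have eq: "(q \<otimes> g) \<otimes> \<phi> = f \<otimes> g \<ominus> c \<otimes> g"
      using add_diff_cancel_right[OF c(3,2)] by simp
    have "W f + W g < \<rho> c + W g" using q(4) fin by (simp add: ennreal_add_left_cancel_less add.commute)
    also have "\<dots> \<le> W c + W g" using val_le_augmented cc by (intro add_right_mono) simp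
    also have "\<dots> \<le> W (c \<otimes> g)" by (rule augmented_mult_ge[OF cc g])
    finally have "W f + W g < min (W (f \<otimes> g)) (W (c \<otimes> g))" using gt by simp
    also have "\<dots> \<le> W ((q \<otimes> g) \<otimes> \<phi>)" unfolding eq by (rule augmented_diff[OF c(4,2)])
    also have "\<dots> = s + W (q \<otimes> g)" by (rule augmented_mult_phi[OF c(1)])
    also have "\<dots> \<le> s + (W q + W g)" using IH by (rule add_left_mono)
    also have "\<dots> = W f + W g" unfolding Wf by (simp add: add.assoc)
    finally show False by simp
  qed
  obtain q c where q: "q \<in> carrier R" "remainder d c" "f = q \<otimes> \<phi> \<oplus> c"
    using division[OF \<phi>_deg Suc.prems(1)] .
  obtain q' c' where q': "q' \<in> carrier R" "remainder d c'" "g = q' \<otimes> \<phi> \<oplus> c'"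
    using division[OF \<phi>_deg Suc.prems(2)] .
  have cc: "c \<in> carrier R" "c' \<in> carrier R" using q q' remainder_carrier by auto
  have Wf: "W f = min (\<rho> c) (s + W q)" unfolding q(3) by (rule augmented_division[OF q(1,2)])
  have Wg: "W g = min (\<rho> c') (s + W q')" unfolding q'(3) by (rule augmented_division[OF q'(1,2)])
  show ?case
  proof (cases "W f < \<rho> c")
    case True
    then show ?thesis by (rule split_off[OF Suc.prems q])
  next
    case False
    then have f_eq: "W f = \<rho> c" using Wf by (simp add: min_def split: if_splits)
    show ?thesis
    proof (cases "W g < \<rho> c'")
      case True
      have "W g + W f < of_nat (Suc n) * s" using Suc.prems(3) by (simp only: add.commute)
      then have "W (g \<otimes> f) \<le> W g + W f" by (rule split_off[OF Suc.prems(2,1) _ q' True])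
      then show ?thesis using Suc.prems(1,2) by (simp add: add.commute m_comm)
    next
      case False
      then have g_eq: "W g = \<rho> c'" using Wg by (simp add: min_def split: if_splits)
      have fin: "\<rho> c \<noteq> \<infinity>" "\<rho> c' \<noteq> \<infinity>"
        using less_le_trans[OF Suc.prems(3) top_greatest] unfolding f_eq g_eq by auto
      obtain p c'' where p: "p \<in> carrier R" "remainder d c''" "c \<otimes> c' = p \<otimes> \<phi> \<oplus> c''"
        using division[OF \<phi>_deg m_closed[OF cc]] .
      have c''c: "c'' \<in> carrier R" using p remainder_carrier by auto
      have "f \<otimes> g = (q \<otimes> g) \<otimes> \<phi> \<oplus> c \<otimes> g"
        unfolding q(3) using q(1) cc Suc.prems(2) \<phi>c by (simp add: l_distr r_distr m_ac)
      also have "c \<otimes> g = (c \<otimes> q') \<otimes> \<phi> \<oplus> c \<otimes> c'"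
        unfolding q'(3) using q'(1) cc \<phi>c by (simp add: r_distr m_ac)
      finally have fg: "f \<otimes> g = (q \<otimes> g \<oplus> c \<otimes> q' \<oplus> p) \<otimes> \<phi> \<oplus> c''"
        unfolding p(3) using q(1) q'(1) cc c''c p(1) Suc.prems(2) \<phi>c by (simp add: l_distr a_assoc)
      have "W (f \<otimes> g) \<le> \<rho> c''"
        unfolding fg by (subst augmented_division) (use q(1) q'(1) cc p Suc.prems(2) in auto)
      also have "\<dots> = W f + W g" unfolding f_eq g_eq by (rule remainder_mult[OF q(2) q'(2) fin p])
      finally show ?thesis .
    qed
  qed
qed simp

lemma augmented_mult:
  assumes "f \<in> carrier R" "g \<in> carrier R"
  shows "W (f \<otimes> g) = W f + W g"
proof (rule antisym)
  show "W f + W g \<le> W (f \<otimes> g)" by (rule augmented_mult_ge[OF assms])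
  show "W (f \<otimes> g) \<le> W f + W g"
  proof (cases "W f + W g = \<infinity>")
    case False
    then obtain n where "W f + W g < of_nat n * s"
      using ennreal_less_of_nat_mult[OF s_pos, of "W f + W g"] by (auto simp: less_top[symmetric])
    then show ?thesis by (rule augmented_mult_le[OF assms])
  qed auto
qed

text \<open>\<open>W\<close> lies between \<open>\<rho>\<close> and \<open>\<tau>\<close>: the lower
  bound gives the value at \<open>\<zero>\<close>, positivity and the condition on \<open>y\<close>,
  the upper bound gives the value at \<open>\<one>\<close>, and both together fix the value at
  \<open>x\<close>.\<close>

lemma augmented_in_vals: "W \<in> vals"
proof -
  have "W \<one> = 0" using augmented_le t.val_one by (metis le_zero_eq one_closed)
  moreover have "W \<zero> = \<infinity>" using val_le_augmented r.val_zero by (metis infinity_ennreal_def top.extremum_unique zero_closed)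
  moreover have "0 < W f" if "f \<in> \<mm>" for f
    using val_le_augmented r.val_pos[OF that] max_carrier[OF that] by (metis less_le_trans)
  ultimately have "centered_valuation R \<mm> W"
    using augmented_add augmented_mult
    by (intro centered_valuation.intro) (auto simp: augmented_def)
  moreover have "W x = 1"
    using val_le_augmented augmented_le valsD(2)[OF \<rho>] valsD(2)[OF \<tau>] by (metis antisym x_carrier)
  moreover have "1 \<le> W y"
    using val_le_augmented valsD(3)[OF \<rho>] by (metis order_trans y_carrier)
  ultimately show ?thesis unfolding vals_def by simp
qed

lemma augmented_phi: "W \<phi> = s"
proof -
  have "W \<one> = 0" using augmented_le t.val_one by (metis le_zero_eq one_closed)
  then show ?thesis using augmented_mult_phi[of \<one>] \<phi>_carrier by simp
qed

text \<open>In degrees below \<open>d\<close> there is no room between \<open>\<rho>\<close> and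
  \<open>\<tau>\<close>, and \<open>s\<close> is still below \<open>\<tau> \<phi>\<close>. So the
  skewness of \<open>W\<close> can again be read off at \<open>\<phi>\<close>.\<close>

lemma augmented_minimal_defect: "minimal_defect W \<tau> \<phi> d"
proof -
  have "W r = \<tau> r" if "has_deg r e" "e < d" for r e
    using defect_low[OF context_assms that] val_le_augmented augmented_le has_deg_carrier[OF that(1)]
    by (metis antisym)
  then show ?thesis unfolding minimal_defect_def using \<phi>_deg augmented_phi s(2) by simp
qed

lemma skewness_augmented: "skewness W = s / of_nat d"
  using skewness_eq[OF augmented_in_vals \<tau> augmented_le augmented_minimal_defect] augmented_phi by simp

end

end

section \<open>The valuative tree\<close>

text \<open>The map \<open>t / (1 + t)\<close>, extended by 1 at infinity, has the gapless image
  \<open>[0, 1]\<close>. It converts skewness, which may be infinite, into a real parameter.\<close>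

lemma ennreal_order_embedding:
  obtains h :: "ennreal \<Rightarrow> real" where "strict_mono h"
    "\<forall>a b c. h a \<le> c \<longrightarrow> c \<le> h b \<longrightarrow> (\<exists>t. h t = c)"
proof -
  define h :: "ennreal \<Rightarrow> real" where "h t = (if t = \<infinity> then 1 else enn2real t / (1 + enn2real t))" for t
  have h_real: "h (ennreal r) = r / (1 + r)" if "0 \<le> r" for r using that by (simp add: h_def)
  have h_inf: "h \<infinity> = 1" by (simp add: h_def)
  have bounds: "0 \<le> h t \<and> h t \<le> 1" for t
    by (cases t) (auto simp: h_real h_inf[simplified])
  have mono: "h a < h b" if "a < b" for a b
  proof (cases a)
    case (real r)
    show ?thesis
    proof (cases b)
      case (real q)
      have "r < q" using that real \<open>a = ennreal r\<close> \<open>0 \<le> r\<close> by (simp add: ennreal_less_iff)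
      then have "r / (1 + r) < q / (1 + q)" using \<open>0 \<le> r\<close> by (simp add: field_simps)
      then show ?thesis using real \<open>a = ennreal r\<close> \<open>0 \<le> r\<close> by (simp add: h_real)
    next
      case top
      then show ?thesis using real h_inf by (simp add: h_real)
    qed
  next
    case top
    then show ?thesis using that by simp
  qed
  have onto: "\<exists>t. h t = c" if "h a \<le> c" "c \<le> h b" for a b c
  proof -
    have c: "0 \<le> c" "c \<le> 1" using bounds[of a] bounds[of b] that by auto
    show ?thesis
    proof (cases "c = 1")
      case True then show ?thesis using h_inf by blast
    next
      case False
      then have "c < 1" using c by simp
      then have "h (ennreal (c / (1 - c))) = (c / (1 - c)) / (1 + c / (1 - c))" using c by (simp add: h_real)
      also have "\<dots> = c" using \<open>c < 1\<close> by (simp add: field_simps)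
      finally show ?thesis by blast
    qed
  qed
  show ?thesis by (rule that[of h]) (auto simp: strict_mono_def mono onto)
qed

section \<open>Suprema of chains and the parametrization of segments\<close>

context regular_parameters
begin

definition chain_sup :: "('a \<Rightarrow> ennreal) set \<Rightarrow> 'a \<Rightarrow> ennreal"
  where "chain_sup C = (\<lambda>f\<in>carrier R. SUP \<mu>\<in>C. \<mu> f)"

lemma chain_sup_upper: "\<mu> \<in> C \<Longrightarrow> val_le \<mu> (chain_sup C)"
  unfolding chain_sup_def by (auto intro: SUP_upper)

lemma chain_sup_least: "(\<And>\<mu>. \<mu> \<in> C \<Longrightarrow> val_le \<mu> \<tau>) \<Longrightarrow> val_le (chain_sup C) \<tau>"
  unfolding chain_sup_def by (auto intro!: SUP_least)

text \<open>Of two members one dominates the other, so the supremum commutes with sums and respects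
  minima. A nonempty chain is needed for the value at \<open>x\<close> to be 1.\<close>

lemma chain_sup_in_vals:
  assumes C: "C \<subseteq> vals" "C \<noteq> {}" and chain: "\<And>\<mu> \<nu>. \<mu> \<in> C \<Longrightarrow> \<nu> \<in> C \<Longrightarrow> val_le \<mu> \<nu> \<or> val_le \<nu> \<mu>"
  shows "chain_sup C \<in> vals"
proof -
  have cv: "centered_valuation R \<mm> \<mu>" if "\<mu> \<in> C" for \<mu> using valsD(1) C that by auto
  obtain \<mu>0 where \<mu>0: "\<mu>0 \<in> C" using C by auto
  have eq: "chain_sup C f = (SUP \<mu>\<in>C. \<mu> f)" if "f \<in> carrier R" for f
    unfolding chain_sup_def using that by simp
  have const: "chain_sup C f = c" if "f \<in> carrier R" "\<And>\<mu>. \<mu> \<in> C \<Longrightarrow> \<mu> f = c" for f c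
    unfolding eq[OF that(1)] by (rule SUP_eq_const[OF C(2) that(2)])
  have "centered_valuation R \<mm> (chain_sup C)"
  proof
    show "chain_sup C \<in> extensional (carrier R)" unfolding chain_sup_def by simp
    show "chain_sup C \<zero> = \<infinity>" by (rule const) (use cv centered_valuation.val_zero in auto)
    show "chain_sup C \<one> = 0" by (rule const) (use cv centered_valuation.val_one in auto)
    show "0 < chain_sup C f" if "f \<in> \<mm>" for f
      using centered_valuation.val_pos[OF cv[OF \<mu>0] that] chain_sup_upper[OF \<mu>0] max_carrier[OF that]
      by (metis less_le_trans)
    fix f g assume fg: "f \<in> carrier R" "g \<in> carrier R"
    show "min (chain_sup C f) (chain_sup C g) \<le> chain_sup C (f \<oplus> g)"
    proof (rule dense_le)
      fix v assume "v < min (chain_sup C f) (chain_sup C g)"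
      then obtain \<mu> \<nu> where *: "\<mu> \<in> C" "\<nu> \<in> C" "v < \<mu> f" "v < \<nu> g"
        unfolding eq[OF fg(1)] eq[OF fg(2)] by (auto simp: less_SUP_iff)
      obtain \<kappa> where \<kappa>: "\<kappa> \<in> C" "val_le \<mu> \<kappa>" "val_le \<nu> \<kappa>" using chain[OF *(1,2)] * by auto
      have "v \<le> min (\<kappa> f) (\<kappa> g)"
        using * \<kappa> fg by (meson less_imp_le min.boundedI order_trans)
      also have "\<dots> \<le> \<kappa> (f \<oplus> g)" by (rule centered_valuation.val_add[OF cv[OF \<kappa>(1)] fg])
      also have "\<dots> \<le> chain_sup C (f \<oplus> g)" using chain_sup_upper[OF \<kappa>(1)] fg by simp
      finally show "v \<le> chain_sup C (f \<oplus> g)" .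
    qed
    have "chain_sup C (f \<otimes> g) = (SUP \<mu>\<in>C. \<mu> f + \<mu> g)"
      unfolding eq[OF m_closed[OF fg]] by (intro SUP_cong refl centered_valuation.val_mult[OF cv] fg)
    also have "\<dots> = (SUP \<mu>\<in>C. \<mu> f) + (SUP \<mu>\<in>C. \<mu> g)"
    proof (rule SUP_add_directed_ennreal)
      fix \<mu> \<nu> assume *: "\<mu> \<in> C" "\<nu> \<in> C"
      show "\<exists>\<kappa>\<in>C. \<mu> f + \<nu> g \<le> \<kappa> f + \<kappa> g"
        using chain[OF *] * fg by (auto intro: add_mono)
    qed
    finally show "chain_sup C (f \<otimes> g) = chain_sup C f + chain_sup C g"
      using eq fg by simp
  qed
  moreover have "chain_sup C x = 1" by (rule const) (use valsD(2) C in auto)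
  moreover have "1 \<le> chain_sup C y"
    using chain_sup_upper[OF \<mu>0] valsD(3)[of \<mu>0] \<mu>0 C by (metis order_trans subsetD y_carrier)
  ultimately show ?thesis unfolding vals_def by simp
qed

text \<open>The supremum of all valuations below \<open>\<tau>\<close> of skewness at most
  \<open>t\<close> again has skewness at most \<open>t\<close>, because the bounds
  \<open>\<mu> \<psi> \<le> of_nat e * t\<close> pass to suprema. If it fell short of
  \<open>t\<close>, a slight augmentation would be a member of the family that exceeds the
  supremum.\<close>

lemma segment_surjective:
  assumes \<tau>: "\<tau> \<in> vals" and t: "1 \<le> t" "t \<le> skewness \<tau>"
  obtains \<rho> where "\<rho> \<in> vals" "val_le \<rho> \<tau>" "skewness \<rho> = t"
proof (cases "t = skewness \<tau>")
  case True
  then show ?thesis using that[of \<tau>] \<tau> by simp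
next
  case False
  then have t': "t < skewness \<tau>" using t by simp
  define C where "C = {\<rho> \<in> vals. val_le \<rho> \<tau> \<and> skewness \<rho> \<le> t}"
  have "val_le (multiplicity_valuation R \<mm>) \<tau>"
    using multiplicity_least[OF valsD(1)[OF \<tau>]] valsD(2,3)[OF \<tau>] by simp
  then have "multiplicity_valuation R \<mm> \<in> C"
    unfolding C_def using multiplicity_in_vals skewness_multiplicity t(1) by (auto intro: order_trans)
  then have "C \<noteq> {}" by auto
  define \<rho> where "\<rho> = chain_sup C"
  have \<rho>: "\<rho> \<in> vals" unfolding \<rho>_def
  proof (rule chain_sup_in_vals[OF _ \<open>C \<noteq> {}\<close>])
    show "C \<subseteq> vals" unfolding C_def by auto
    show "val_le \<mu> \<nu> \<or> val_le \<nu> \<mu>" if "\<mu> \<in> C" "\<nu> \<in> C" for \<mu> \<nu>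
      using vals_below_comparable[OF \<tau>] that unfolding C_def by simp
  qed
  have le: "val_le \<rho> \<tau>" unfolding \<rho>_def by (rule chain_sup_least) (simp add: C_def)
  have "skewness \<rho> \<le> t"
  proof (rule skewness_leI)
    fix \<psi> e assume \<psi>: "has_deg \<psi> e" "0 < e"
    have "\<mu> \<psi> \<le> of_nat e * t" if "\<mu> \<in> C" for \<mu>
    proof -
      have e: "(of_nat e :: ennreal) \<noteq> 0" "(of_nat e :: ennreal) \<noteq> \<infinity>" using \<psi>(2) by auto
      have "\<mu> \<psi> = \<mu> \<psi> / of_nat e * of_nat e"
        using e by (simp add: ennreal_divide_times ennreal_divide_self less_top[symmetric])
      also have "\<dots> \<le> t * of_nat e"
      proof (rule mult_right_mono)
        have "\<mu> \<psi> / of_nat e \<le> skewness \<mu>" by (rule skewness_upper[OF \<psi>])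
        also have "\<dots> \<le> t" using that unfolding C_def by simp
        finally show "\<mu> \<psi> / of_nat e \<le> t" .
      qed simp
      finally show ?thesis by (simp only: mult.commute)
    qed
    then show "\<rho> \<psi> \<le> of_nat e * t"
      unfolding \<rho>_def chain_sup_def using has_deg_carrier[OF \<psi>(1)] by (auto intro: SUP_least)
  qed
  moreover have "\<not> skewness \<rho> < t"
  proof
    assume less: "skewness \<rho> < t"
    then have "\<rho> \<noteq> \<tau>" using t' by auto
    then obtain \<phi> d where def: "minimal_defect \<rho> \<tau> \<phi> d" by (rule minimal_defect_exists[OF \<rho> \<tau> le])
    note a = \<rho> \<tau> le def
    have d: "(of_nat d :: ennreal) \<noteq> 0" "(of_nat d :: ennreal) < top_class.top"
      using defect_deg_pos[OF a] by (simp_all add: less_top[symmetric])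
    have "\<rho> \<phi> < t * of_nat d"
      using less unfolding skewness_eq[OF a] divide_less_ennreal[OF d] .
    then have "\<rho> \<phi> < min (\<tau> \<phi>) (t * of_nat d)" using defect_less[OF a] by simp
    \<comment> \<open>Below \<open>\<tau> \<phi>\<close> so that augmentation applies, and below
      \<open>t * of_nat d\<close> so that the result stays in \<open>C\<close>.\<close>
    then obtain s where "\<rho> \<phi> < s" "s < min (\<tau> \<phi>) (t * of_nat d)" using dense by blast
    then have s: "\<rho> \<phi> < s" "s < \<tau> \<phi>" "s < t * of_nat d" by (auto simp only: min_less_iff_conj)
    let ?W = "augmented \<rho> \<phi> s"
    have "skewness ?W < t"
      unfolding skewness_augmented[OF a s(1,2)] divide_less_ennreal[OF d] by (rule s(3))
    then have "?W \<in> C"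
      unfolding C_def using augmented_in_vals[OF a s(1,2)] augmented_le[OF a s(1,2)] by simp
    then have "val_le ?W \<rho>" unfolding \<rho>_def by (rule chain_sup_upper)
    then have "s \<le> \<rho> \<phi>" using augmented_phi[OF a s(1,2)] defect_carrier[OF a] by metis
    then show False using s(1) by simp
  qed
  ultimately have "skewness \<rho> = t" by simp
  then show ?thesis using that \<rho> le by blast
qed

lemma INF_max_ideal:
  assumes v: "centered_valuation R \<mm> \<nu>"
  shows "(INF f\<in>\<mm>. \<nu> f) = min (\<nu> x) (\<nu> y)"
proof (rule antisym)
  interpret v: centered_valuation R \<mm> \<nu> by (rule v)
  show "(INF f\<in>\<mm>. \<nu> f) \<le> min (\<nu> x) (\<nu> y)"
    using x_max y_max by (auto intro: INF_lower)
  show "min (\<nu> x) (\<nu> y) \<le> (INF f\<in>\<mm>. \<nu> f)"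
  proof (rule INF_greatest)
    fix f assume "f \<in> \<mm>"
    then obtain a b where ab: "a \<in> carrier R" "b \<in> carrier R" "f = x \<otimes> a \<oplus> y \<otimes> b"
      by (rule max_memE)
    have "min (\<nu> x) (\<nu> y) \<le> min (\<nu> x + \<nu> a) (\<nu> y + \<nu> b)" by (intro min.mono) auto
    also have "\<dots> \<le> \<nu> f" using v.val_add[of "x \<otimes> a" "y \<otimes> b"] v.val_mult ab by simp
    finally show "min (\<nu> x) (\<nu> y) \<le> \<nu> f" .
  qed
qed

section \<open>The valuation poset in terms of the two parameters\<close>

lemma valuation_poset_carrier_iff:
  "\<nu> \<in> carrier (valuation_poset R \<mm>) \<longleftrightarrow> centered_valuation R \<mm> \<nu> \<and> min (\<nu> x) (\<nu> y) = 1"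
proof -
  have "proper_valuation R \<mm> \<nu>" if v: "centered_valuation R \<mm> \<nu>" and n: "min (\<nu> x) (\<nu> y) = 1"
  proof -
    interpret v: centered_valuation R \<mm> \<nu> by (rule v)
    have "\<nu> x \<noteq> 0" using n by auto
    moreover have "\<nu> x \<noteq> \<infinity> \<or> \<nu> y \<noteq> \<infinity>" using n by auto
    ultimately show ?thesis unfolding proper_valuation_def using x_nonzero x_max y_max by auto
  qed
  then show ?thesis
    unfolding valuation_poset_def normalized_valuation_def using INF_max_ideal by auto
qed

lemma vals_subset_carrier: "vals \<subseteq> carrier (valuation_poset R \<mm>)"
  unfolding vals_def by (auto simp: valuation_poset_carrier_iff min_absorb1)

lemma mem_vals_iff:
  assumes "\<nu> \<in> carrier (valuation_poset R \<mm>)"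
  shows "\<nu> \<in> vals \<longleftrightarrow> \<nu> x = 1"
  using assms unfolding vals_def valuation_poset_carrier_iff by (auto simp: min_def split: if_splits)

lemma valuation_poset_le: "le (valuation_poset R \<mm>) \<mu> \<nu> \<longleftrightarrow> val_le \<mu> \<nu>"
  by (simp add: valuation_poset_def)

lemma valuation_poset_antisym:
  assumes "\<mu> \<in> carrier (valuation_poset R \<mm>)" "\<nu> \<in> carrier (valuation_poset R \<mm>)"
    "val_le \<mu> \<nu>" "val_le \<nu> \<mu>"
  shows "\<mu> = \<nu>"
  using assms unfolding valuation_poset_carrier_iff
  by (intro extensionalityI[of _ "carrier R"]) (auto simp: centered_valuation_def intro: antisym)

text \<open>Normalization bounds the value at \<open>x\<close> from below by 1, and
  \<open>\<tau>\<close> bounds it from above by 1.\<close>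

lemma vals_downward_closed:
  assumes \<tau>: "\<tau> \<in> vals" and \<rho>: "\<rho> \<in> carrier (valuation_poset R \<mm>)" and le: "val_le \<rho> \<tau>"
  shows "\<rho> \<in> vals"
proof -
  have "1 \<le> \<rho> x" using \<rho> unfolding valuation_poset_carrier_iff by (metis min.cobounded1)
  moreover have "\<rho> x \<le> 1" using le valsD(2)[OF \<tau>] by (metis x_carrier)
  ultimately show ?thesis unfolding mem_vals_iff[OF \<rho>] by simp
qed

lemma multiplicity_valuation_lower_bound:
  assumes "\<nu> \<in> carrier (valuation_poset R \<mm>)"
  shows "val_le (multiplicity_valuation R \<mm>) \<nu>"
proof (rule multiplicity_least)
  have \<nu>: "centered_valuation R \<mm> \<nu>" "min (\<nu> x) (\<nu> y) = 1"
    using assms unfolding valuation_poset_carrier_iff by auto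
  then show "centered_valuation R \<mm> \<nu>" "1 \<le> \<nu> x" "1 \<le> \<nu> y"
    by (simp, metis min.cobounded1, metis min.cobounded2)
qed

lemma partial_order_valuation_poset: "partial_order (valuation_poset R \<mm>)"
proof -
  let ?P = "valuation_poset R \<mm>"
  have eq: "(.=\<^bsub>?P\<^esub>) = (=)" by (simp add: valuation_poset_def)
  show ?thesis
  proof
    fix \<mu> \<nu> \<kappa>
    assume c: "\<mu> \<in> carrier ?P" "\<nu> \<in> carrier ?P"
    show "\<mu> .=\<^bsub>?P\<^esub> \<nu>" if "\<mu> \<sqsubseteq>\<^bsub>?P\<^esub> \<nu>" "\<nu> \<sqsubseteq>\<^bsub>?P\<^esub> \<mu>"
      using valuation_poset_antisym[OF c] that unfolding eq valuation_poset_le by simp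
  next
    fix \<mu> \<nu> \<kappa>
    assume "\<mu> \<sqsubseteq>\<^bsub>?P\<^esub> \<nu>" "\<nu> \<sqsubseteq>\<^bsub>?P\<^esub> \<kappa>"
    then show "\<mu> \<sqsubseteq>\<^bsub>?P\<^esub> \<kappa>" unfolding valuation_poset_le by (meson order_trans)
  qed (simp_all add: eq valuation_poset_le)
qed

text \<open>On a chain, skewness reflects the order as well as preserving it;
  \<open>segment_surjective\<close> and convexity close the gaps in its image.\<close>

lemma convex_chain_interval:
  assumes S: "S \<subseteq> vals"
    and chain: "\<And>\<mu> \<nu>. \<mu> \<in> S \<Longrightarrow> \<nu> \<in> S \<Longrightarrow> val_le \<mu> \<nu> \<or> val_le \<nu> \<mu>"
    and convex: "\<And>\<mu> \<nu> \<kappa>. \<mu> \<in> S \<Longrightarrow> \<nu> \<in> S \<Longrightarrow> \<kappa> \<in> vals \<Longrightarrow> val_le \<mu> \<kappa> \<Longrightarrow> val_le \<kappa> \<nu> \<Longrightarrow> \<kappa> \<in> S"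
  shows "iso_real_interval (valuation_poset R \<mm>) S"
proof -
  obtain h :: "ennreal \<Rightarrow> real" where h: "strict_mono h"
    and onto: "\<forall>a b c. h a \<le> c \<longrightarrow> c \<le> h b \<longrightarrow> (\<exists>t. h t = c)"
    using ennreal_order_embedding .
  have h_le: "h a \<le> h b \<longleftrightarrow> a \<le> b" for a b by (rule strict_mono_less_eq[OF h])
  have iff: "skewness \<mu> \<le> skewness \<nu> \<longleftrightarrow> val_le \<mu> \<nu>" if "\<mu> \<in> S" "\<nu> \<in> S" for \<mu> \<nu>
  proof
    assume "val_le \<mu> \<nu>"
    then show "skewness \<mu> \<le> skewness \<nu>"
      using skewness_strict_mono[of \<mu> \<nu>] that S by (cases "\<mu> = \<nu>") (auto intro: less_imp_le)
  next
    assume le: "skewness \<mu> \<le> skewness \<nu>"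
    show "val_le \<mu> \<nu>"
    proof (rule ccontr)
      assume neg: "\<not> val_le \<mu> \<nu>"
      then have "val_le \<nu> \<mu>" "\<nu> \<noteq> \<mu>" using chain[OF that] by auto
      then have "skewness \<nu> < skewness \<mu>" using skewness_strict_mono[of \<nu> \<mu>] that S by auto
      then show False using le by simp
    qed
  qed
  have eq: "\<mu> = \<nu>" if "\<mu> \<in> S" "\<nu> \<in> S" "skewness \<mu> = skewness \<nu>" for \<mu> \<nu>
    using iff[OF that(1,2)] iff[OF that(2,1)] that val_le_antisym[of \<mu> \<nu>] S by auto
  let ?f = "\<lambda>\<mu>. h (skewness \<mu>)"
  let ?J = "?f ` S"
  have "is_interval ?J"
    unfolding is_interval_1
  proof (intro ballI allI impI)
    fix a b c assume "a \<in> ?J" "b \<in> ?J" and "a \<le> c \<and> c \<le> b"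
    then have "a \<le> c" "c \<le> b" by auto
    obtain \<mu> \<nu> where \<mu>: "\<mu> \<in> S" "a = ?f \<mu>" and \<nu>: "\<nu> \<in> S" "b = ?f \<nu>"
      using \<open>a \<in> ?J\<close> \<open>b \<in> ?J\<close> by auto
    obtain t where t: "h t = c" using onto \<open>a \<le> c\<close> \<open>c \<le> b\<close> unfolding \<mu>(2) \<nu>(2) by blast
    then have bounds: "skewness \<mu> \<le> t" "t \<le> skewness \<nu>"
      using \<open>a \<le> c\<close> \<open>c \<le> b\<close> h_le \<mu>(2) \<nu>(2) by auto
    have \<mu>\<nu>: "val_le \<mu> \<nu>" using iff[OF \<mu>(1) \<nu>(1)] bounds by (meson order_trans)
    have \<nu>': "\<nu> \<in> vals" "\<mu> \<in> vals" using \<mu> \<nu> S by auto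
    have "1 \<le> t" using one_le_skewness[OF \<nu>'(2)] bounds(1) by (rule order_trans)
    then obtain \<kappa> where \<kappa>: "\<kappa> \<in> vals" "val_le \<kappa> \<nu>" "skewness \<kappa> = t"
      using segment_surjective[OF \<nu>'(1) _ bounds(2)] by auto
    \<comment> \<open>\<open>\<kappa>\<close> is comparable with \<open>\<mu>\<close>, both being
      below \<open>\<nu>\<close>, and it cannot lie strictly below \<open>\<mu>\<close> because its
      skewness is at least that of \<open>\<mu>\<close>.\<close>
    have "\<kappa> \<in> S"
    proof (cases "val_le \<mu> \<kappa>")
      case True
      then show ?thesis using convex \<mu>(1) \<nu>(1) \<kappa> by blast
    next
      case False
      then have "val_le \<kappa> \<mu>" "\<kappa> \<noteq> \<mu>" using vals_below_comparable[OF \<nu>'(1) \<nu>'(2) \<mu>\<nu> \<kappa>(1,2)] by auto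
      then show ?thesis using skewness_strict_mono[OF \<kappa>(1) \<nu>'(2)] \<kappa>(3) bounds(1) by simp
    qed
    then show "c \<in> ?J" using t \<kappa>(3) by auto
  qed
  moreover have "bij_betw ?f S ?J"
    by (intro bij_betw_imageI inj_onI eq) (use strict_mono_eq[OF h] in auto)
  moreover have "order_emb ((valuation_poset R \<mm>)\<lparr>carrier := S\<rparr>) \<lparr>carrier = ?J, eq = (=), le = (\<le>)\<rparr> ?f"
    unfolding order_emb_def
  proof (intro conjI ballI)
    show "weak_partial_order ((valuation_poset R \<mm>)\<lparr>carrier := S\<rparr>)"
    proof (rule weak_partial_order_subset)
      show "weak_partial_order (valuation_poset R \<mm>)"
        using partial_order_valuation_poset by (rule partial_order.axioms(1))
      show "S \<subseteq> carrier (valuation_poset R \<mm>)" using S vals_subset_carrier by (rule subset_trans)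
    qed
    show "weak_partial_order \<lparr>carrier = ?J, eq = (=), le = (\<le>)\<rparr>"
      by unfold_locales auto
  qed (auto simp: h_le iff valuation_poset_le)
  ultimately show ?thesis unfolding iso_real_interval_def by blast
qed

text \<open>One member \<open>\<tau>\<close> in \<open>vals\<close> places all lower bounds on the
  segment below \<open>\<tau>\<close>. They form a chain, and its supremum is still a lower
  bound.\<close>

lemma glb_exists:
  assumes S: "S \<subseteq> carrier (valuation_poset R \<mm>)" and \<tau>: "\<tau> \<in> S" "\<tau> \<in> vals"
  shows "\<exists>\<rho>. greatest (valuation_poset R \<mm>) \<rho> (Lower (valuation_poset R \<mm>) S)"
proof -
  let ?P = "valuation_poset R \<mm>"
  define L where "L = Lower ?P S"
  have mem_L: "\<rho> \<in> L \<longleftrightarrow> \<rho> \<in> carrier ?P \<and> (\<forall>\<mu>\<in>S. val_le \<rho> \<mu>)" for \<rho>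
    unfolding L_def Lower_def using S by (auto simp: valuation_poset_le)
  have Lv: "L \<subseteq> vals" using vals_downward_closed[OF \<tau>(2)] \<tau>(1) mem_L by auto
  have "multiplicity_valuation R \<mm> \<in> L"
    unfolding mem_L
  proof (rule conjI)
    show "multiplicity_valuation R \<mm> \<in> carrier ?P" using multiplicity_in_vals vals_subset_carrier by auto
    show "\<forall>\<mu>\<in>S. val_le (multiplicity_valuation R \<mm>) \<mu>"
      using multiplicity_valuation_lower_bound S by auto
  qed
  then have "L \<noteq> {}" by auto
  have sup: "chain_sup L \<in> vals"
    by (rule chain_sup_in_vals[OF Lv \<open>L \<noteq> {}\<close>], rule vals_below_comparable[OF \<tau>(2)])
      (use Lv mem_L \<tau>(1) in auto)
  have "chain_sup L \<in> L"
    unfolding mem_L using sup vals_subset_carrier chain_sup_least[of L] mem_L by auto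
  then have "greatest ?P (chain_sup L) L"
    unfolding greatest_def using mem_L chain_sup_upper by (auto simp: valuation_poset_le)
  then show ?thesis unfolding L_def by blast
qed

end

section \<open>Gluing the part with value 1 at \<open>x\<close> and the part with value 1 at
  \<open>y\<close>\<close>

locale regular_parameter_pair = xy: regular_parameters R \<mm> x y + yx: regular_parameters R \<mm> y x
  for R (structure) and \<mm> x y
begin

abbreviation "P \<equiv> valuation_poset R \<mm>"

lemma carrier_cases:
  assumes "\<nu> \<in> carrier P"
  shows "\<nu> \<in> xy.vals \<or> \<nu> \<in> yx.vals"
  using assms xy.mem_vals_iff yx.mem_vals_iff unfolding xy.valuation_poset_carrier_iff
  by (auto simp: min_def split: if_splits)

text \<open>Both parts are closed downwards. If \<open>\<mu>\<close> is outside one of them, so is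
  everything above \<open>\<mu>\<close>, while \<open>\<mu>\<close> and everything below it lie in
  the other.\<close>

lemma chain_subset_vals:
  assumes S: "S \<subseteq> carrier P"
    and chain: "\<And>\<mu> \<nu>. \<mu> \<in> S \<Longrightarrow> \<nu> \<in> S \<Longrightarrow> xy.val_le \<mu> \<nu> \<or> xy.val_le \<nu> \<mu>"
  shows "S \<subseteq> xy.vals \<or> S \<subseteq> yx.vals"
proof (rule disjCI)
  assume "\<not> S \<subseteq> yx.vals"
  then obtain \<mu> where \<mu>: "\<mu> \<in> S" "\<mu> \<notin> yx.vals" by auto
  then have \<mu>v: "\<mu> \<in> xy.vals" using carrier_cases S by auto
  show "S \<subseteq> xy.vals"
  proof
    fix \<nu> assume \<nu>: "\<nu> \<in> S"
    show "\<nu> \<in> xy.vals"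
    proof (cases "xy.val_le \<nu> \<mu>")
      case True
      then show ?thesis using xy.vals_downward_closed[OF \<mu>v] S \<nu> by auto
    next
      case False
      then have "xy.val_le \<mu> \<nu>" using chain[OF \<mu>(1) \<nu>] by blast
      then have "\<nu> \<notin> yx.vals" using yx.vals_downward_closed[of \<nu> \<mu>] \<mu> S by auto
      then show ?thesis using carrier_cases S \<nu> by auto
    qed
  qed
qed

lemma tree: "complete_rooted_nonmetric_tree P"
proof -
  interpret P: partial_order P by (rule xy.partial_order_valuation_poset)
  have T2: "iso_real_interval P S"
    if S: "S \<subseteq> carrier P" and chain: "\<And>\<mu> \<nu>. \<mu> \<in> S \<Longrightarrow> \<nu> \<in> S \<Longrightarrow> xy.val_le \<mu> \<nu> \<or> xy.val_le \<nu> \<mu>"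
      and convex: "\<And>\<mu> \<nu> \<kappa>. \<mu> \<in> S \<Longrightarrow> \<nu> \<in> S \<Longrightarrow> \<kappa> \<in> carrier P \<Longrightarrow> xy.val_le \<mu> \<kappa> \<Longrightarrow> xy.val_le \<kappa> \<nu> \<Longrightarrow> \<kappa> \<in> S"
    for S
    using chain_subset_vals[OF S chain]
  proof
    assume "S \<subseteq> xy.vals"
    then show ?thesis
      by (rule xy.convex_chain_interval[OF _ chain convex]) (use xy.vals_subset_carrier in auto)
  next
    assume "S \<subseteq> yx.vals"
    then show ?thesis
      by (rule yx.convex_chain_interval[OF _ chain convex]) (use yx.vals_subset_carrier in auto)
  qed
  show ?thesis
  proof
    fix \<tau> assume \<tau>: "\<tau> \<in> carrier P"
    show "iso_real_interval P {\<sigma> \<in> carrier P. \<sigma> \<sqsubseteq>\<^bsub>P\<^esub> \<tau>}"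
    proof (rule T2)
      fix \<mu> \<nu> assume *: "\<mu> \<in> {\<sigma> \<in> carrier P. \<sigma> \<sqsubseteq>\<^bsub>P\<^esub> \<tau>}" "\<nu> \<in> {\<sigma> \<in> carrier P. \<sigma> \<sqsubseteq>\<^bsub>P\<^esub> \<tau>}"
      show "xy.val_le \<mu> \<nu> \<or> xy.val_le \<nu> \<mu>"
        using carrier_cases[OF \<tau>]
      proof
        assume "\<tau> \<in> xy.vals"
        then show ?thesis
          using xy.vals_below_comparable[of \<tau> \<mu> \<nu>] xy.vals_downward_closed[of \<tau>] *
          by (auto simp: xy.valuation_poset_le)
      next
        assume "\<tau> \<in> yx.vals"
        then show ?thesis
          using yx.vals_below_comparable[of \<tau> \<mu> \<nu>] yx.vals_downward_closed[of \<tau>] *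
          by (auto simp: xy.valuation_poset_le)
      qed
    next
      show "\<kappa> \<in> {\<sigma> \<in> carrier P. \<sigma> \<sqsubseteq>\<^bsub>P\<^esub> \<tau>}"
        if "\<nu> \<in> {\<sigma> \<in> carrier P. \<sigma> \<sqsubseteq>\<^bsub>P\<^esub> \<tau>}" "\<kappa> \<in> carrier P" "xy.val_le \<kappa> \<nu>" for \<nu> \<kappa>
        using that \<tau> P.le_trans[of \<kappa> \<nu> \<tau>] xy.valuation_poset_le[of \<kappa> \<nu>] by simp
    qed simp
  next
    fix S assume S: "S \<subseteq> carrier P" "\<forall>\<sigma>\<in>S. \<forall>\<tau>\<in>S. \<sigma> \<sqsubseteq>\<^bsub>P\<^esub> \<tau> \<or> \<tau> \<sqsubseteq>\<^bsub>P\<^esub> \<sigma>"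
      "\<forall>\<sigma>\<in>S. \<forall>\<sigma>'\<in>S. \<forall>\<tau>\<in>carrier P. \<sigma> \<sqsubseteq>\<^bsub>P\<^esub> \<tau> \<and> \<tau> \<sqsubseteq>\<^bsub>P\<^esub> \<sigma>' \<longrightarrow> \<tau> \<in> S"
    show "iso_real_interval P S"
    proof (rule T2[OF S(1)])
      show "xy.val_le \<mu> \<nu> \<or> xy.val_le \<nu> \<mu>" if "\<mu> \<in> S" "\<nu> \<in> S" for \<mu> \<nu>
        using S(2) that unfolding xy.valuation_poset_le by blast
      show "\<kappa> \<in> S" if "\<mu> \<in> S" "\<nu> \<in> S" "\<kappa> \<in> carrier P" "xy.val_le \<mu> \<kappa>" "xy.val_le \<kappa> \<nu>" for \<mu> \<nu> \<kappa>
        using S(3) that unfolding xy.valuation_poset_le by blast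
    qed
  next
    fix S assume S: "S \<subseteq> carrier P" "S \<noteq> {}"
    then obtain \<tau> where \<tau>: "\<tau> \<in> S" by auto
    then show "\<exists>\<sigma>. greatest P \<sigma> (Lower P S)"
      using carrier_cases[of \<tau>] xy.glb_exists[OF S(1) \<tau>] yx.glb_exists[OF S(1) \<tau>] S by auto
  next
    fix \<tau> :: "nat \<Rightarrow> 'a \<Rightarrow> ennreal"
    assume \<tau>: "\<And>i. \<tau> i \<in> carrier P" and inc: "\<And>i. \<tau> i \<sqsubseteq>\<^bsub>P\<^esub> \<tau> (Suc i)"
    have mono: "xy.val_le (\<tau> i) (\<tau> j)" if "i \<le> j" for i j
      using that
    proof (induction rule: dec_induct)
      case (step n)
      then show ?case using inc[of n] unfolding xy.valuation_poset_le by (meson order_trans)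
    qed simp
    have chain: "xy.val_le \<mu> \<nu> \<or> xy.val_le \<nu> \<mu>" if "\<mu> \<in> range \<tau>" "\<nu> \<in> range \<tau>" for \<mu> \<nu>
      using that mono nat_le_linear by (metis rangeE)
    have sub: "range \<tau> \<subseteq> carrier P" using \<tau> by auto
    have ne: "range \<tau> \<noteq> {}" by simp
    show "\<exists>\<upsilon>\<in>carrier P. \<forall>i. \<tau> i \<sqsubseteq>\<^bsub>P\<^esub> \<upsilon>"
      using chain_subset_vals[OF sub chain]
    proof
      assume *: "range \<tau> \<subseteq> xy.vals"
      have "xy.chain_sup (range \<tau>) \<in> carrier P"
        by (rule subsetD[OF xy.vals_subset_carrier xy.chain_sup_in_vals[OF * ne chain]])
      moreover have "\<tau> i \<sqsubseteq>\<^bsub>P\<^esub> xy.chain_sup (range \<tau>)" for i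
        unfolding xy.valuation_poset_le by (rule xy.chain_sup_upper) simp
      ultimately show ?thesis by auto
    next
      assume *: "range \<tau> \<subseteq> yx.vals"
      have "yx.chain_sup (range \<tau>) \<in> carrier P"
        by (rule subsetD[OF yx.vals_subset_carrier yx.chain_sup_in_vals[OF * ne chain]])
      moreover have "\<tau> i \<sqsubseteq>\<^bsub>P\<^esub> yx.chain_sup (range \<tau>)" for i
        unfolding xy.valuation_poset_le by (rule yx.chain_sup_upper) simp
      ultimately show ?thesis by auto
    qed
  qed
qed

lemma root: "tree_root P (multiplicity_valuation R \<mm>)"
  unfolding tree_root_def least_def
proof (intro conjI ballI subset_refl)
  show "multiplicity_valuation R \<mm> \<in> carrier P"
    using xy.multiplicity_in_vals xy.vals_subset_carrier by auto
  show "multiplicity_valuation R \<mm> \<sqsubseteq>\<^bsub>P\<^esub> \<nu>" if "\<nu> \<in> carrier P" for \<nu>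
    unfolding xy.valuation_poset_le by (rule xy.multiplicity_valuation_lower_bound[OF that])
qed

end

theorem theorem6p4:
  fixes R :: "('a, 'b) ring_scheme" and \<mm> :: "'a set"
  assumes "regular_local_ring R \<mm>" and "krull_dim R = 2"
  shows "complete_rooted_nonmetric_tree (valuation_poset R \<mm>) \<and>
         tree_root (valuation_poset R \<mm>) (multiplicity_valuation R \<mm>)"
proof -
  obtain x y where xy: "regular_parameters R \<mm> x y" "regular_parameters R \<mm> y x"
    using regular_local_ring_parameters[OF assms] .
  interpret regular_parameter_pair R \<mm> x y
    by (rule regular_parameter_pair.intro) fact+
  show ?thesis using tree root by blast
qed

end
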